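(* Let $R$ be an associative ring with unity. (a) If $R$ is not right perfect or $R$ is not left coherent, then there exists a torsionless right $R$-module that is not projective. (b) Let $M$ be a torsionless right $R$-module that is not projective. Then $M$ has no decomposition $M=P\oplus N$ with $P$ a projective submodule and $N$ a stable submodule in either of the following cases: (i) $R$ is a right hereditary ring; (ii) $R$ is a right semihereditary ring and $M$ is finitely generated.
   Context: Modules are unital right modules unless said otherwise. A ring $R$ is right perfect if every right $R$-module has a projective cover (an epimorphism from a projective module with superfluous kernel). A ring $R$ is left coherent if every finitely generated left ideal of $R$ is finitely presented as a left $R$-module. A ring $R$ is right hereditary (resp. right semihereditary) if every right ideal (resp. every finitely generated right ideal) of $R$ is projective. A right $R$-module is torsionless if it embeds as a submodule in a direct product $\prod_{i\in I}R_R$ of copies of $R$ for some index set $I$. A module is called stable if it has no nonzero projective direct summand. *)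

theory Defs
  imports "HOL-Algebra.Module" "HOL-Algebra.AbelCoset"
begin

text \<open>
  Modules over a not necessarily commutative ring. The library record \<open>module\<close> and its
  locale \<open>submodule\<close> are reused; only the locale \<open>module\<close> itself, which assumes a
  commutative ring, is replaced. The element \<open>r \<odot>\<^bsub>M\<^esub> x\<close> stands for the right action \<open>x r\<close>.
  The fields \<open>mult\<close> and \<open>one\<close> of the record carry no meaning for a module.
\<close>

locale right_module = R?: ring R + M?: abelian_group M
  for R :: "('a, 'r) ring_scheme" (structure) and M :: "('a, 'm) module" (structure) +
  assumes smult_closed:
      "\<lbrakk>r \<in> carrier R; x \<in> carrier M\<rbrakk> \<Longrightarrow> r \<odot>\<^bsub>M\<^esub> x \<in> carrier M"
    and smult_l_distr:
      "\<lbrakk>r \<in> carrier R; s \<in> carrier R; x \<in> carrier M\<rbrakk> \<Longrightarrow>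
        (r \<oplus> s) \<odot>\<^bsub>M\<^esub> x = r \<odot>\<^bsub>M\<^esub> x \<oplus>\<^bsub>M\<^esub> s \<odot>\<^bsub>M\<^esub> x"
    and smult_r_distr:
      "\<lbrakk>r \<in> carrier R; x \<in> carrier M; y \<in> carrier M\<rbrakk> \<Longrightarrow>
        r \<odot>\<^bsub>M\<^esub> (x \<oplus>\<^bsub>M\<^esub> y) = r \<odot>\<^bsub>M\<^esub> x \<oplus>\<^bsub>M\<^esub> r \<odot>\<^bsub>M\<^esub> y"
    and smult_assoc:
      "\<lbrakk>r \<in> carrier R; s \<in> carrier R; x \<in> carrier M\<rbrakk> \<Longrightarrow>
        (r \<otimes> s) \<odot>\<^bsub>M\<^esub> x = s \<odot>\<^bsub>M\<^esub> (r \<odot>\<^bsub>M\<^esub> x)"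
    and smult_one:
      "x \<in> carrier M \<Longrightarrow> \<one> \<odot>\<^bsub>M\<^esub> x = x"

text \<open>A left \<open>R\<close>-module is a right module over the opposite ring.\<close>

definition opp_ring :: "('a, 'r) ring_scheme \<Rightarrow> ('a, 'r) ring_scheme"
  where "opp_ring R = R\<lparr>mult := \<lambda>a b. b \<otimes>\<^bsub>R\<^esub> a\<rparr>"

definition mod_hom ::
    "('a, 'r) ring_scheme \<Rightarrow> ('a, 'm) module \<Rightarrow> ('a, 'n) module \<Rightarrow> ('m \<Rightarrow> 'n) set"
  where "mod_hom R M N =
    {f \<in> carrier M \<rightarrow> carrier N.
      (\<forall>x \<in> carrier M. \<forall>y \<in> carrier M. f (x \<oplus>\<^bsub>M\<^esub> y) = f x \<oplus>\<^bsub>N\<^esub> f y) \<and>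
      (\<forall>r \<in> carrier R. \<forall>x \<in> carrier M. f (r \<odot>\<^bsub>M\<^esub> x) = r \<odot>\<^bsub>N\<^esub> f x)}"

definition mod_epi ::
    "('a, 'r) ring_scheme \<Rightarrow> ('a, 'm) module \<Rightarrow> ('a, 'n) module \<Rightarrow> ('m \<Rightarrow> 'n) set"
  where "mod_epi R M N = {f \<in> mod_hom R M N. f ` carrier M = carrier N}"

definition regular_module :: "('a, 'r) ring_scheme \<Rightarrow> ('a, 'a) module"
  where "regular_module R =
    \<lparr>carrier = carrier R, mult = mult R, one = \<one>\<^bsub>R\<^esub>, zero = \<zero>\<^bsub>R\<^esub>,
     add = add R, smult = (\<lambda>r x. x \<otimes>\<^bsub>R\<^esub> r)\<rparr>"

definition power_module :: "('a, 'r) ring_scheme \<Rightarrow> 'i set \<Rightarrow> ('a, 'i \<Rightarrow> 'a) module"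
  where "power_module R I =
    \<lparr>carrier = I \<rightarrow>\<^sub>E carrier R, mult = (\<lambda>f g. \<lambda>i\<in>I. f i \<otimes>\<^bsub>R\<^esub> g i), one = (\<lambda>i\<in>I. \<one>\<^bsub>R\<^esub>),
     zero = (\<lambda>i\<in>I. \<zero>\<^bsub>R\<^esub>), add = (\<lambda>f g. \<lambda>i\<in>I. f i \<oplus>\<^bsub>R\<^esub> g i),
     smult = (\<lambda>r f. \<lambda>i\<in>I. f i \<otimes>\<^bsub>R\<^esub> r)\<rparr>"

text \<open>
  The index set may be taken inside \<open>'m \<Rightarrow> 'a\<close>, because a torsionless module embeds in the
  power indexed by its own homomorphisms to the ring; see \<open>torsionlessI\<close> below.
\<close>

definition torsionless :: "('a, 'r) ring_scheme \<Rightarrow> ('a, 'm) module \<Rightarrow> bool"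
  where "torsionless R M \<longleftrightarrow> right_module R M \<and>
    (\<exists>(I :: ('m \<Rightarrow> 'a) set) f. f \<in> mod_hom R M (power_module R I) \<and> inj_on f (carrier M))"

text \<open>
  Projectivity is the lifting property along epimorphisms. A definition cannot quantify over
  types, so \<open>A\<close> and \<open>B\<close> range over types in which the free cover of \<open>P\<close> and \<open>P\<close> itself live; lifting
  along epimorphisms between modules over arbitrary types follows, see \<open>projective_lift\<close> below.
\<close>

definition projective :: "('a, 'r) ring_scheme \<Rightarrow> ('a, 'p) module \<Rightarrow> bool"
  where "projective R P \<longleftrightarrow> right_module R P \<and>
    (\<forall>(A :: ('a, 'p \<Rightarrow> 'a) module) (B :: ('a, 'p) module) g f.
      right_module R A \<longrightarrow> right_module R B \<longrightarrow> g \<in> mod_epi R A B \<longrightarrow> f \<in> mod_hom R P B \<longrightarrow>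
      (\<exists>h \<in> mod_hom R P A. \<forall>x \<in> carrier P. g (h x) = f x))"

definition superfluous :: "('a, 'r) ring_scheme \<Rightarrow> ('a, 'm) module \<Rightarrow> 'm set \<Rightarrow> bool"
  where "superfluous R M K \<longleftrightarrow> submodule K R M \<and>
    (\<forall>N. submodule N R M \<longrightarrow> K <+>\<^bsub>M\<^esub> N = carrier M \<longrightarrow> N = carrier M)"

definition projective_cover ::
    "('a, 'r) ring_scheme \<Rightarrow> ('a, 'm) module \<Rightarrow> ('a, 'p) module \<Rightarrow> ('p \<Rightarrow> 'm) \<Rightarrow> bool"
  where "projective_cover R M P f \<longleftrightarrow>
    projective R P \<and> f \<in> mod_epi R P M \<and> superfluous R P (a_kernel P M f)"

text \<open>
  A projective cover over any type has an isomorphic copy inside the free module on the carrier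
  of \<open>M\<close>, hence over the type \<open>'m \<Rightarrow> 'a\<close>; see \<open>has_projective_coverI\<close> below.
\<close>

definition has_projective_cover :: "('a, 'r) ring_scheme \<Rightarrow> ('a, 'm) module \<Rightarrow> bool"
  where "has_projective_cover R M \<longleftrightarrow>
    (\<exists>(P :: ('a, 'm \<Rightarrow> 'a) module) f. projective_cover R M P f)"

text \<open>
  Perfectness tested on the modules over the type \<open>'m\<close>. A ring is right perfect if this holds for
  every \<open>'m\<close>; it fails to be right perfect if \<open>right_perfect TYPE('m) R\<close> fails for some \<open>'m\<close>. A
  premise \<open>\<not> right_perfect TYPE('m) R\<close> with \<open>'m\<close> a free type variable of a theorem therefore covers
  all rings that are not right perfect.
\<close>

definition right_perfect :: "'m itself \<Rightarrow> ('a, 'r) ring_scheme \<Rightarrow> bool"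
  where "right_perfect T R \<longleftrightarrow>
    (\<forall>M :: ('a, 'm) module. right_module R M \<longrightarrow> has_projective_cover R M)"

definition fin_gen :: "('a, 'r) ring_scheme \<Rightarrow> ('a, 'm) module \<Rightarrow> bool"
  where "fin_gen R M \<longleftrightarrow>
    (\<exists>X. finite X \<and> X \<subseteq> carrier M \<and> (\<forall>H. submodule H R M \<longrightarrow> X \<subseteq> H \<longrightarrow> H = carrier M))"

definition fin_presented :: "('a, 'r) ring_scheme \<Rightarrow> ('a, 'm) module \<Rightarrow> bool"
  where "fin_presented R M \<longleftrightarrow> right_module R M \<and>
    (\<exists>(n :: nat) f. f \<in> mod_epi R (power_module R {..<n}) M \<and>
      fin_gen R ((power_module R {..<n})\<lparr>carrier := a_kernel (power_module R {..<n}) M f\<rparr>))"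

definition left_coherent :: "('a, 'r) ring_scheme \<Rightarrow> bool"
  where "left_coherent R \<longleftrightarrow>
    (let S = opp_ring R in
      \<forall>L. submodule L S (regular_module S) \<longrightarrow> fin_gen S ((regular_module S)\<lparr>carrier := L\<rparr>) \<longrightarrow>
        fin_presented S ((regular_module S)\<lparr>carrier := L\<rparr>))"

definition right_hereditary :: "('a, 'r) ring_scheme \<Rightarrow> bool"
  where "right_hereditary R \<longleftrightarrow>
    (\<forall>I. submodule I R (regular_module R) \<longrightarrow> projective R ((regular_module R)\<lparr>carrier := I\<rparr>))"

definition right_semihereditary :: "('a, 'r) ring_scheme \<Rightarrow> bool"
  where "right_semihereditary R \<longleftrightarrow>
    (\<forall>I. submodule I R (regular_module R) \<longrightarrow> fin_gen R ((regular_module R)\<lparr>carrier := I\<rparr>) \<longrightarrow>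
      projective R ((regular_module R)\<lparr>carrier := I\<rparr>))"

definition internal_direct_sum ::
    "('a, 'r) ring_scheme \<Rightarrow> ('a, 'm) module \<Rightarrow> 'm set \<Rightarrow> 'm set \<Rightarrow> bool"
  where "internal_direct_sum R M P N \<longleftrightarrow>
    submodule P R M \<and> submodule N R M \<and> P \<inter> N = {\<zero>\<^bsub>M\<^esub>} \<and> P <+>\<^bsub>M\<^esub> N = carrier M"

definition stable :: "('a, 'r) ring_scheme \<Rightarrow> ('a, 'm) module \<Rightarrow> bool"
  where "stable R M \<longleftrightarrow>
    (\<forall>P N. internal_direct_sum R M P N \<longrightarrow> projective R (M\<lparr>carrier := P\<rparr>) \<longrightarrow> P = {\<zero>\<^bsub>M\<^esub>})"

text \<open>The remaining lemmas show that the choices of types made above lose nothing.\<close>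

lemma right_moduleI:
  fixes R :: "('a, 'r) ring_scheme" (structure) and M :: "('a, 'm) module"
  assumes "ring R"
    and "\<And>x y. \<lbrakk>x \<in> carrier M; y \<in> carrier M\<rbrakk> \<Longrightarrow> x \<oplus>\<^bsub>M\<^esub> y \<in> carrier M"
    and "\<zero>\<^bsub>M\<^esub> \<in> carrier M"
    and "\<And>x y z. \<lbrakk>x \<in> carrier M; y \<in> carrier M; z \<in> carrier M\<rbrakk> \<Longrightarrow>
      (x \<oplus>\<^bsub>M\<^esub> y) \<oplus>\<^bsub>M\<^esub> z = x \<oplus>\<^bsub>M\<^esub> (y \<oplus>\<^bsub>M\<^esub> z)"
    and "\<And>x y. \<lbrakk>x \<in> carrier M; y \<in> carrier M\<rbrakk> \<Longrightarrow> x \<oplus>\<^bsub>M\<^esub> y = y \<oplus>\<^bsub>M\<^esub> x"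
    and "\<And>x. x \<in> carrier M \<Longrightarrow> \<zero>\<^bsub>M\<^esub> \<oplus>\<^bsub>M\<^esub> x = x"
    and "\<And>x. x \<in> carrier M \<Longrightarrow> \<exists>y \<in> carrier M. y \<oplus>\<^bsub>M\<^esub> x = \<zero>\<^bsub>M\<^esub>"
    and "\<And>r x. \<lbrakk>r \<in> carrier R; x \<in> carrier M\<rbrakk> \<Longrightarrow> r \<odot>\<^bsub>M\<^esub> x \<in> carrier M"
    and "\<And>r s x. \<lbrakk>r \<in> carrier R; s \<in> carrier R; x \<in> carrier M\<rbrakk> \<Longrightarrow>
      (r \<oplus> s) \<odot>\<^bsub>M\<^esub> x = r \<odot>\<^bsub>M\<^esub> x \<oplus>\<^bsub>M\<^esub> s \<odot>\<^bsub>M\<^esub> x"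
    and "\<And>r x y. \<lbrakk>r \<in> carrier R; x \<in> carrier M; y \<in> carrier M\<rbrakk> \<Longrightarrow>
      r \<odot>\<^bsub>M\<^esub> (x \<oplus>\<^bsub>M\<^esub> y) = r \<odot>\<^bsub>M\<^esub> x \<oplus>\<^bsub>M\<^esub> r \<odot>\<^bsub>M\<^esub> y"
    and "\<And>r s x. \<lbrakk>r \<in> carrier R; s \<in> carrier R; x \<in> carrier M\<rbrakk> \<Longrightarrow>
      (r \<otimes> s) \<odot>\<^bsub>M\<^esub> x = s \<odot>\<^bsub>M\<^esub> (r \<odot>\<^bsub>M\<^esub> x)"
    and "\<And>x. x \<in> carrier M \<Longrightarrow> \<one> \<odot>\<^bsub>M\<^esub> x = x"
  shows "right_module R M"
  by (intro right_module.intro right_module_axioms.intro assms abelian_groupI)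

lemma mod_homD:
  assumes "f \<in> mod_hom R M N"
  shows "x \<in> carrier M \<Longrightarrow> f x \<in> carrier N"
    and "\<lbrakk>x \<in> carrier M; y \<in> carrier M\<rbrakk> \<Longrightarrow> f (x \<oplus>\<^bsub>M\<^esub> y) = f x \<oplus>\<^bsub>N\<^esub> f y"
    and "\<lbrakk>r \<in> carrier R; x \<in> carrier M\<rbrakk> \<Longrightarrow> f (r \<odot>\<^bsub>M\<^esub> x) = r \<odot>\<^bsub>N\<^esub> f x"
  using assms unfolding mod_hom_def by auto

lemma mod_homI:
  assumes "\<And>x. x \<in> carrier M \<Longrightarrow> f x \<in> carrier N"
    and "\<And>x y. \<lbrakk>x \<in> carrier M; y \<in> carrier M\<rbrakk> \<Longrightarrow> f (x \<oplus>\<^bsub>M\<^esub> y) = f x \<oplus>\<^bsub>N\<^esub> f y"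
    and "\<And>r x. \<lbrakk>r \<in> carrier R; x \<in> carrier M\<rbrakk> \<Longrightarrow> f (r \<odot>\<^bsub>M\<^esub> x) = r \<odot>\<^bsub>N\<^esub> f x"
  shows "f \<in> mod_hom R M N"
  using assms unfolding mod_hom_def by auto

lemma mod_hom_comp:
  assumes "f \<in> mod_hom R M N" "g \<in> mod_hom R N L"
  shows "(\<lambda>x. g (f x)) \<in> mod_hom R M L"
  using mod_homD[OF assms(1)] mod_homD[OF assms(2)] by (intro mod_homI) simp_all

lemma mod_hom_zero:
  assumes "f \<in> mod_hom R M N" "right_module R M" "right_module R N"
  shows "f \<zero>\<^bsub>M\<^esub> = \<zero>\<^bsub>N\<^esub>"
proof -
  interpret M: right_module R M by fact
  interpret N: right_module R N by fact
  have "f \<zero>\<^bsub>M\<^esub> \<oplus>\<^bsub>N\<^esub> f \<zero>\<^bsub>M\<^esub> = f \<zero>\<^bsub>M\<^esub>"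
    using mod_homD(2)[OF assms(1) M.M.zero_closed M.M.zero_closed] by simp
  then show ?thesis
    using mod_homD(1)[OF assms(1) M.M.zero_closed] N.M.add.r_cancel_one' by metis
qed

lemma torsionlessI:
  fixes R :: "('a, 'r) ring_scheme" and M :: "('a, 'm) module" and J :: "'j set"
  assumes "right_module R M" and F: "F \<in> mod_hom R M (power_module R J)" and inj: "inj_on F (carrier M)"
  shows "torsionless R M"
proof -
  define I where "I = (\<lambda>j x. F x j) ` J"
  define G where "G = (\<lambda>x. \<lambda>\<phi>\<in>I. \<phi> x)"
  have cl: "F x j \<in> carrier R" if "x \<in> carrier M" "j \<in> J" for x j
    using mod_homD(1)[OF F that(1)] that(2) by (auto simp: power_module_def)
  have add: "F (x \<oplus>\<^bsub>M\<^esub> y) j = F x j \<oplus>\<^bsub>R\<^esub> F y j"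
    if "x \<in> carrier M" "y \<in> carrier M" "j \<in> J" for x y j
    using mod_homD(2)[OF F that(1,2)] that(3) by (simp add: power_module_def)
  have sm: "F (r \<odot>\<^bsub>M\<^esub> x) j = F x j \<otimes>\<^bsub>R\<^esub> r"
    if "r \<in> carrier R" "x \<in> carrier M" "j \<in> J" for x r j
    using mod_homD(3)[OF F that(1,2)] that(3) by (simp add: power_module_def)
  have "G \<in> mod_hom R M (power_module R I)"
    by (rule mod_homI) (auto simp: G_def power_module_def I_def fun_eq_iff restrict_def cl add sm)
  moreover have "inj_on G (carrier M)"
  proof (rule inj_onI)
    fix x y assume xy: "x \<in> carrier M" "y \<in> carrier M" and eq: "G x = G y"
    have "F x j = F y j" if "j \<in> J" for j
      using fun_cong[OF eq, of "\<lambda>x. F x j"] that by (auto simp: G_def I_def)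
    moreover have "F x \<in> extensional J" "F y \<in> extensional J"
      using mod_homD(1)[OF F] xy by (auto simp: power_module_def PiE_def)
    ultimately have "F x = F y"
      by (intro extensionalityI[of _ J]) auto
    then show "x = y" using inj xy by (auto dest: inj_onD)
  qed
  ultimately show ?thesis
    using assms(1) unfolding torsionless_def by blast
qed

definition free_module :: "('a, 'r) ring_scheme \<Rightarrow> 'i set \<Rightarrow> ('a, 'i \<Rightarrow> 'a) module"
  where "free_module R X =
    (power_module R X)\<lparr>carrier := {u \<in> X \<rightarrow>\<^sub>E carrier R. finite {x \<in> X. u x \<noteq> \<zero>\<^bsub>R\<^esub>}}\<rparr>"

definition free_ext ::
    "('a, 'r) ring_scheme \<Rightarrow> 'i set \<Rightarrow> ('a, 'n) module \<Rightarrow> ('i \<Rightarrow> 'n) \<Rightarrow> ('i \<Rightarrow> 'a) \<Rightarrow> 'n"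
  where "free_ext R X N b u = (\<Oplus>\<^bsub>N\<^esub> x \<in> {x \<in> X. u x \<noteq> \<zero>\<^bsub>R\<^esub>}. u x \<odot>\<^bsub>N\<^esub> b x)"

lemma free_module_simps:
  "carrier (free_module R X) = {u \<in> X \<rightarrow>\<^sub>E carrier R. finite {x \<in> X. u x \<noteq> \<zero>\<^bsub>R\<^esub>}}"
  "\<zero>\<^bsub>free_module R X\<^esub> = (\<lambda>x\<in>X. \<zero>\<^bsub>R\<^esub>)"
  "u \<oplus>\<^bsub>free_module R X\<^esub> v = (\<lambda>x\<in>X. u x \<oplus>\<^bsub>R\<^esub> v x)"
  "r \<odot>\<^bsub>free_module R X\<^esub> u = (\<lambda>x\<in>X. u x \<otimes>\<^bsub>R\<^esub> r)"
  by (simp_all add: free_module_def power_module_def)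

lemma right_module_free:
  fixes R :: "('a, 'r) ring_scheme"
  assumes "ring R"
  shows "right_module R (free_module R X)"
proof -
  interpret ring R by fact
  let ?F = "free_module R X"
  have mem: "u x \<in> carrier R" if "u \<in> X \<rightarrow>\<^sub>E carrier R" "x \<in> X" for u x
    using that by auto
  have fin: "finite {x \<in> X. (\<lambda>x\<in>X. w x) x \<noteq> \<zero>\<^bsub>R\<^esub>}"
    if "finite {x \<in> X. u x \<noteq> \<zero>\<^bsub>R\<^esub>}" "finite {x \<in> X. v x \<noteq> \<zero>\<^bsub>R\<^esub>}"
      "\<And>x. x \<in> X \<Longrightarrow> u x = \<zero>\<^bsub>R\<^esub> \<Longrightarrow> v x = \<zero>\<^bsub>R\<^esub> \<Longrightarrow> w x = \<zero>\<^bsub>R\<^esub>" for u v w :: "_ \<Rightarrow> 'a"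
    by (rule finite_subset[OF _ finite_UnI[OF that(1,2)]]) (use that(3) in auto)
  have ext: "u = v" if "u \<in> X \<rightarrow>\<^sub>E carrier R" "v \<in> X \<rightarrow>\<^sub>E carrier R" "\<And>x. x \<in> X \<Longrightarrow> u x = v x" for u v
    using PiE_ext[OF that(1,2)] that(3) by blast
  show ?thesis
  proof (rule right_moduleI, unfold free_module_simps mem_Collect_eq)
    show "ring R" by fact
  next
    fix u v assume "u \<in> X \<rightarrow>\<^sub>E carrier R \<and> finite {x \<in> X. u x \<noteq> \<zero>\<^bsub>R\<^esub>}"
      "v \<in> X \<rightarrow>\<^sub>E carrier R \<and> finite {x \<in> X. v x \<noteq> \<zero>\<^bsub>R\<^esub>}"
    then show "(\<lambda>x\<in>X. u x \<oplus>\<^bsub>R\<^esub> v x) \<in> X \<rightarrow>\<^sub>E carrier R \<and>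
        finite {x \<in> X. (\<lambda>x\<in>X. u x \<oplus>\<^bsub>R\<^esub> v x) x \<noteq> \<zero>\<^bsub>R\<^esub>}"
      by (intro conjI fin[of u v]) (auto simp: mem)
  next
    fix u r assume "r \<in> carrier R" "u \<in> X \<rightarrow>\<^sub>E carrier R \<and> finite {x \<in> X. u x \<noteq> \<zero>\<^bsub>R\<^esub>}"
    then show "(\<lambda>x\<in>X. u x \<otimes>\<^bsub>R\<^esub> r) \<in> X \<rightarrow>\<^sub>E carrier R \<and>
        finite {x \<in> X. (\<lambda>x\<in>X. u x \<otimes>\<^bsub>R\<^esub> r) x \<noteq> \<zero>\<^bsub>R\<^esub>}"
      by (intro conjI fin[of u u]) (auto simp: mem)
  next
    fix u assume u: "u \<in> X \<rightarrow>\<^sub>E carrier R \<and> finite {x \<in> X. u x \<noteq> \<zero>\<^bsub>R\<^esub>}"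
    show "\<exists>y\<in>{u \<in> X \<rightarrow>\<^sub>E carrier R. finite {x \<in> X. u x \<noteq> \<zero>\<^bsub>R\<^esub>}}.
        (\<lambda>x\<in>X. y x \<oplus>\<^bsub>R\<^esub> u x) = (\<lambda>x\<in>X. \<zero>\<^bsub>R\<^esub>)"
    proof (rule bexI[of _ "\<lambda>x\<in>X. \<ominus>\<^bsub>R\<^esub> u x"])
      show "(\<lambda>x\<in>X. \<ominus>\<^bsub>R\<^esub> u x) \<in> {u \<in> X \<rightarrow>\<^sub>E carrier R. finite {x \<in> X. u x \<noteq> \<zero>\<^bsub>R\<^esub>}}"
        using u by (intro CollectI conjI fin[of u u]) (auto simp: mem)
    qed (use u mem in \<open>auto simp: fun_eq_iff restrict_def l_neg\<close>)
  qed (auto simp: fun_eq_iff restrict_def mem a_assoc a_comm a_lcomm m_assoc l_distr r_distr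
        intro!: ext)
qed

lemma (in right_module) smult_r_null:
  assumes "r \<in> carrier R" shows "r \<odot>\<^bsub>M\<^esub> \<zero>\<^bsub>M\<^esub> = \<zero>\<^bsub>M\<^esub>"
proof -
  have c: "r \<odot>\<^bsub>M\<^esub> \<zero>\<^bsub>M\<^esub> \<in> carrier M" using assms by (simp add: smult_closed)
  have "r \<odot>\<^bsub>M\<^esub> \<zero>\<^bsub>M\<^esub> \<oplus>\<^bsub>M\<^esub> r \<odot>\<^bsub>M\<^esub> \<zero>\<^bsub>M\<^esub> = r \<odot>\<^bsub>M\<^esub> \<zero>\<^bsub>M\<^esub>"
    using smult_r_distr[OF assms M.zero_closed M.zero_closed] by simp
  then show ?thesis using c M.add.r_cancel_one' by metis
qed

lemma (in right_module) smult_l_null: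
  assumes "x \<in> carrier M" shows "\<zero>\<^bsub>R\<^esub> \<odot>\<^bsub>M\<^esub> x = \<zero>\<^bsub>M\<^esub>"
proof -
  have c: "\<zero>\<^bsub>R\<^esub> \<odot>\<^bsub>M\<^esub> x \<in> carrier M" using assms by (simp add: smult_closed)
  have "\<zero>\<^bsub>R\<^esub> \<odot>\<^bsub>M\<^esub> x \<oplus>\<^bsub>M\<^esub> \<zero>\<^bsub>R\<^esub> \<odot>\<^bsub>M\<^esub> x = \<zero>\<^bsub>R\<^esub> \<odot>\<^bsub>M\<^esub> x"
    using smult_l_distr[OF R.zero_closed R.zero_closed assms] by simp
  then show ?thesis using c M.add.r_cancel_one' by metis
qed

lemma (in right_module) finsum_smult:
  assumes "finite S" "r \<in> carrier R" "f \<in> S \<rightarrow> carrier M"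
  shows "r \<odot>\<^bsub>M\<^esub> (\<Oplus>\<^bsub>M\<^esub> i \<in> S. f i) = (\<Oplus>\<^bsub>M\<^esub> i \<in> S. r \<odot>\<^bsub>M\<^esub> f i)"
  using assms
proof (induction S rule: finite_induct)
  case empty then show ?case by (simp add: smult_r_null)
next
  case (insert i S)
  have f: "f i \<in> carrier M" "f \<in> S \<rightarrow> carrier M" "(\<Oplus>\<^bsub>M\<^esub> j \<in> S. f j) \<in> carrier M"
    using insert.prems by (auto intro: M.finsum_closed)
  have g: "(\<lambda>j. r \<odot>\<^bsub>M\<^esub> f j) \<in> S \<rightarrow> carrier M" "r \<odot>\<^bsub>M\<^esub> f i \<in> carrier M"
    using f insert.prems by (auto intro: smult_closed)
  show ?case
    using insert.IH[OF insert.prems(1) f(2)] insert.hyps insert.prems(1) f g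
    by (simp add: smult_r_distr)
qed

lemma (in right_module) free_ext_eq:
  assumes "finite S" "{x \<in> X. u x \<noteq> \<zero>\<^bsub>R\<^esub>} \<subseteq> S" "S \<subseteq> X" "u \<in> X \<rightarrow> carrier R" "b \<in> X \<rightarrow> carrier M"
  shows "free_ext R X M b u = (\<Oplus>\<^bsub>M\<^esub> x \<in> S. u x \<odot>\<^bsub>M\<^esub> b x)"
  unfolding free_ext_def
proof (rule M.add.finprod_mono_neutral_cong_left)
  show "u x \<odot>\<^bsub>M\<^esub> b x = \<zero>\<^bsub>M\<^esub>" if "x \<in> S - {x \<in> X. u x \<noteq> \<zero>\<^bsub>R\<^esub>}" for x
  proof -
    have "x \<in> X" "u x = \<zero>\<^bsub>R\<^esub>" using that assms by auto
    then show ?thesis using assms(5) by (simp add: smult_l_null Pi_iff)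
  qed
qed (use assms in \<open>auto intro!: smult_closed\<close>)

lemma (in right_module) free_ext_hom:
  assumes b: "b \<in> X \<rightarrow> carrier M"
  shows "free_ext R X M b \<in> mod_hom R (free_module R X) M"
proof (rule mod_homI)
  let ?F = "free_module R X"
  let ?s = "\<lambda>u. {x \<in> X. u x \<noteq> \<zero>\<^bsub>R\<^esub>}"
  have F: "u \<in> X \<rightarrow> carrier R" "finite (?s u)" if "u \<in> carrier ?F" for u
    using that by (auto simp: free_module_simps)
  have sm: "(\<lambda>x. u x \<odot>\<^bsub>M\<^esub> b x) \<in> S \<rightarrow> carrier M" if "u \<in> carrier ?F" "S \<subseteq> X" for u S
    using F[OF that(1)] b that(2) by (auto intro!: smult_closed)
  interpret F: right_module R ?F by (rule right_module_free) (rule R.ring_axioms)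
  show "free_ext R X M b u \<in> carrier M" if "u \<in> carrier ?F" for u
    unfolding free_ext_def by (rule M.finsum_closed) (rule sm[OF that], auto)
  show "free_ext R X M b (u \<oplus>\<^bsub>?F\<^esub> v) = free_ext R X M b u \<oplus>\<^bsub>M\<^esub> free_ext R X M b v"
    if u: "u \<in> carrier ?F" and v: "v \<in> carrier ?F" for u v
  proof -
    let ?S = "?s u \<union> ?s v"
    have S: "finite ?S" "?S \<subseteq> X" using F u v by auto
    have w: "u \<oplus>\<^bsub>?F\<^esub> v \<in> carrier ?F" using u v by simp
    have "free_ext R X M b (u \<oplus>\<^bsub>?F\<^esub> v) = (\<Oplus>\<^bsub>M\<^esub> x \<in> ?S. (u \<oplus>\<^bsub>?F\<^esub> v) x \<odot>\<^bsub>M\<^esub> b x)"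
      by (rule free_ext_eq[OF S(1) _ S(2) F(1)[OF w] b]) (auto simp: free_module_simps)
    also have "\<dots> = (\<Oplus>\<^bsub>M\<^esub> x \<in> ?S. u x \<odot>\<^bsub>M\<^esub> b x \<oplus>\<^bsub>M\<^esub> v x \<odot>\<^bsub>M\<^esub> b x)"
    proof (rule M.finsum_cong')
      fix x assume "x \<in> ?S"
      then have "x \<in> X" by auto
      then show "(u \<oplus>\<^bsub>?F\<^esub> v) x \<odot>\<^bsub>M\<^esub> b x = u x \<odot>\<^bsub>M\<^esub> b x \<oplus>\<^bsub>M\<^esub> v x \<odot>\<^bsub>M\<^esub> b x"
        using F(1)[OF u] F(1)[OF v] b by (auto simp: free_module_simps Pi_iff intro!: smult_l_distr)
    qed (use sm[OF u S(2)] sm[OF v S(2)] in \<open>auto simp: Pi_iff\<close>)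
    also have "\<dots> = (\<Oplus>\<^bsub>M\<^esub> x \<in> ?S. u x \<odot>\<^bsub>M\<^esub> b x) \<oplus>\<^bsub>M\<^esub> (\<Oplus>\<^bsub>M\<^esub> x \<in> ?S. v x \<odot>\<^bsub>M\<^esub> b x)"
      by (rule M.finsum_addf[OF sm[OF u S(2)] sm[OF v S(2)]])
    also have "(\<Oplus>\<^bsub>M\<^esub> x \<in> ?S. u x \<odot>\<^bsub>M\<^esub> b x) = free_ext R X M b u"
      by (rule free_ext_eq[OF S(1) _ S(2) F(1)[OF u] b, symmetric]) auto
    also have "(\<Oplus>\<^bsub>M\<^esub> x \<in> ?S. v x \<odot>\<^bsub>M\<^esub> b x) = free_ext R X M b v"
      by (rule free_ext_eq[OF S(1) _ S(2) F(1)[OF v] b, symmetric]) auto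
    finally show ?thesis .
  qed
  show "free_ext R X M b (r \<odot>\<^bsub>?F\<^esub> u) = r \<odot>\<^bsub>M\<^esub> free_ext R X M b u"
    if r: "r \<in> carrier R" and u: "u \<in> carrier ?F" for r u
  proof -
    have S: "finite (?s u)" "?s u \<subseteq> X" using F u by auto
    have w: "r \<odot>\<^bsub>?F\<^esub> u \<in> carrier ?F" using r u by (rule F.smult_closed)
    have "free_ext R X M b (r \<odot>\<^bsub>?F\<^esub> u) = (\<Oplus>\<^bsub>M\<^esub> x \<in> ?s u. (r \<odot>\<^bsub>?F\<^esub> u) x \<odot>\<^bsub>M\<^esub> b x)"
      by (rule free_ext_eq[OF S(1) _ S(2) F(1)[OF w] b]) (use r in \<open>auto simp: free_module_simps\<close>)
    also have "\<dots> = (\<Oplus>\<^bsub>M\<^esub> x \<in> ?s u. r \<odot>\<^bsub>M\<^esub> (u x \<odot>\<^bsub>M\<^esub> b x))"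
    proof (rule M.finsum_cong')
      fix x assume "x \<in> ?s u"
      then have "x \<in> X" by auto
      then show "(r \<odot>\<^bsub>?F\<^esub> u) x \<odot>\<^bsub>M\<^esub> b x = r \<odot>\<^bsub>M\<^esub> (u x \<odot>\<^bsub>M\<^esub> b x)"
        using F(1)[OF u] b r by (auto simp: free_module_simps Pi_iff intro!: smult_assoc)
    next
      show "(\<lambda>x. r \<odot>\<^bsub>M\<^esub> (u x \<odot>\<^bsub>M\<^esub> b x)) \<in> ?s u \<rightarrow> carrier M"
        using sm[OF u S(2)] by (intro funcsetI smult_closed[OF r]) (simp add: Pi_iff)
    qed simp
    also have "\<dots> = r \<odot>\<^bsub>M\<^esub> (\<Oplus>\<^bsub>M\<^esub> x \<in> ?s u. u x \<odot>\<^bsub>M\<^esub> b x)"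
      by (rule finsum_smult[OF S(1) r sm[OF u S(2)], symmetric])
    finally show ?thesis by (simp add: free_ext_def)
  qed
qed

lemma free_ext_comp:
  assumes f: "f \<in> mod_hom R M N" and M: "right_module R M" and N: "right_module R N"
    and b: "b \<in> X \<rightarrow> carrier M" and u: "u \<in> carrier (free_module R X)"
  shows "f (free_ext R X M b u) = free_ext R X N (\<lambda>x. f (b x)) u"
proof -
  interpret M: right_module R M by fact
  interpret N: right_module R N by fact
  have sum: "f (\<Oplus>\<^bsub>M\<^esub> x \<in> S. u x \<odot>\<^bsub>M\<^esub> b x) = (\<Oplus>\<^bsub>N\<^esub> x \<in> S. u x \<odot>\<^bsub>N\<^esub> f (b x))"
    if "finite S" "S \<subseteq> X" for S
    using that
  proof (induction S rule: finite_induct)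
    case empty then show ?case by (simp add: mod_hom_zero[OF f M N])
  next
    case (insert i S)
    have c: "u x \<in> carrier R" "b x \<in> carrier M" "f (b x) \<in> carrier N"
        "u x \<odot>\<^bsub>M\<^esub> b x \<in> carrier M" "u x \<odot>\<^bsub>N\<^esub> f (b x) \<in> carrier N" if "x \<in> X" for x
      using that u b mod_homD(1)[OF f]
      by (auto simp: free_module_simps Pi_iff intro!: M.smult_closed N.smult_closed)
    have s: "(\<lambda>x. u x \<odot>\<^bsub>M\<^esub> b x) \<in> S \<rightarrow> carrier M" "(\<lambda>x. u x \<odot>\<^bsub>N\<^esub> f (b x)) \<in> S \<rightarrow> carrier N"
      using c insert.prems by auto
    have i: "i \<in> X" and S: "S \<subseteq> X" using insert.prems by auto
    have "f (\<Oplus>\<^bsub>M\<^esub> x \<in> insert i S. u x \<odot>\<^bsub>M\<^esub> b x) =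
        f (u i \<odot>\<^bsub>M\<^esub> b i \<oplus>\<^bsub>M\<^esub> (\<Oplus>\<^bsub>M\<^esub> x \<in> S. u x \<odot>\<^bsub>M\<^esub> b x))"
      using insert.hyps c[OF i] s by simp
    also have "\<dots> = u i \<odot>\<^bsub>N\<^esub> f (b i) \<oplus>\<^bsub>N\<^esub> (\<Oplus>\<^bsub>N\<^esub> x \<in> S. u x \<odot>\<^bsub>N\<^esub> f (b x))"
      using mod_homD(2)[OF f c(4)[OF i] M.M.finsum_closed[OF s(1)]] mod_homD(3)[OF f c(1)[OF i] c(2)[OF i]]
        insert.IH[OF S] by simp
    also have "\<dots> = (\<Oplus>\<^bsub>N\<^esub> x \<in> insert i S. u x \<odot>\<^bsub>N\<^esub> f (b x))"
      using insert.hyps c[OF i] s by simp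
    finally show ?case .
  qed
  show ?thesis
    unfolding free_ext_def by (rule sum) (use u in \<open>auto simp: free_module_simps\<close>)
qed

lemma (in right_module) free_ext_unit:
  assumes b: "b \<in> X \<rightarrow> carrier M" and x: "x \<in> X"
  shows "\<exists>u \<in> carrier (free_module R X). free_ext R X M b u = b x"
proof
  define u where "u = (\<lambda>y\<in>X. if y = x then \<one>\<^bsub>R\<^esub> else \<zero>\<^bsub>R\<^esub>)"
  have sub: "{y \<in> X. u y \<noteq> \<zero>\<^bsub>R\<^esub>} \<subseteq> {x}" by (auto simp: u_def)
  have uc: "u \<in> X \<rightarrow>\<^sub>E carrier R" by (auto simp: u_def)
  show "u \<in> carrier (free_module R X)"
    using uc finite_subset[OF sub] by (simp add: free_module_simps)
  have "free_ext R X M b u = (\<Oplus>\<^bsub>M\<^esub> y \<in> {x}. u y \<odot>\<^bsub>M\<^esub> b y)"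
    by (rule free_ext_eq[OF _ sub _ _ b]) (use uc x in auto)
  also have "\<dots> = b x"
    using b x by (auto simp: u_def smult_one smult_closed Pi_iff)
  finally show "free_ext R X M b u = b x" .
qed

lemma projective_lift:
  fixes R :: "('a, 'r) ring_scheme" and P :: "('a, 'p) module"
    and A :: "('a, 'm) module" and B :: "('a, 'n) module"
  assumes P: "projective R P" and A: "right_module R A" and B: "right_module R B"
    and g: "g \<in> mod_epi R A B" and f: "f \<in> mod_hom R P B"
  shows "\<exists>h \<in> mod_hom R P A. \<forall>x \<in> carrier P. g (h x) = f x"
proof -
  have PM: "right_module R P" using P unfolding projective_def by blast
  interpret P: right_module R P by fact
  interpret A: right_module R A by fact
  have R: "ring R" using PM unfolding right_module_def by blast
  let ?X = "carrier P" and ?F = "free_module R (carrier P)"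
  let ?p = "free_ext R ?X P (\<lambda>x. x)"
  have p: "?p \<in> mod_hom R ?F P" by (rule P.free_ext_hom) auto
  have "carrier P \<subseteq> ?p ` carrier ?F"
  proof
    fix x assume "x \<in> carrier P"
    then obtain u where "u \<in> carrier ?F" "?p u = x"
      using P.free_ext_unit[of "\<lambda>x. x" ?X x] by auto
    then show "x \<in> ?p ` carrier ?F" by blast
  qed
  then have pe: "?p \<in> mod_epi R ?F P"
    using p mod_homD(1)[OF p] unfolding mod_epi_def by auto
  have "(\<lambda>x. x) \<in> mod_hom R P P" by (rule mod_homI) auto
  with P[unfolded projective_def, THEN conjunct2, rule_format, OF right_module_free[OF R] PM pe]
  obtain s where s: "s \<in> mod_hom R P ?F" "\<And>x. x \<in> carrier P \<Longrightarrow> ?p (s x) = x"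
    by blast
  have gh: "g \<in> mod_hom R A B" and gs: "g ` carrier A = carrier B"
    using g by (auto simp: mod_epi_def)
  have "\<forall>x \<in> ?X. \<exists>y \<in> carrier A. g y = f x"
  proof
    fix x assume "x \<in> ?X"
    then have "f x \<in> g ` carrier A" using mod_homD(1)[OF f] gs by simp
    then show "\<exists>y \<in> carrier A. g y = f x" by (metis imageE)
  qed
  then have "\<forall>x \<in> ?X. \<exists>y. y \<in> carrier A \<and> g y = f x" by blast
  from bchoice[OF this] obtain a where a: "\<And>x. x \<in> ?X \<Longrightarrow> a x \<in> carrier A \<and> g (a x) = f x"
    by blast
  have a': "a \<in> ?X \<rightarrow> carrier A" using a by auto
  have h: "(\<lambda>x. free_ext R ?X A a (s x)) \<in> mod_hom R P A"
    by (rule mod_hom_comp[OF s(1) A.free_ext_hom[OF a']])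
  have "g (free_ext R ?X A a (s x)) = f x" if x: "x \<in> carrier P" for x
  proof -
    have sx: "s x \<in> carrier ?F" using mod_homD(1)[OF s(1) x] .
    have "g (free_ext R ?X A a (s x)) = free_ext R ?X B (\<lambda>y. g (a y)) (s x)"
      by (rule free_ext_comp[OF gh A B a' sx])
    also have "\<dots> = free_ext R ?X B (\<lambda>y. f y) (s x)"
      unfolding free_ext_def
    proof (rule abelian_monoid.finsum_cong')
      show "abelian_monoid B"
        using B unfolding right_module_def abelian_group_def by blast
      show "(\<lambda>y. s x y \<odot>\<^bsub>B\<^esub> f y) \<in> {y \<in> ?X. s x y \<noteq> \<zero>\<^bsub>R\<^esub>} \<rightarrow> carrier B"
      proof (rule funcsetI)
        fix y assume "y \<in> {y \<in> ?X. s x y \<noteq> \<zero>\<^bsub>R\<^esub>}"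
        then have y: "y \<in> ?X" by simp
        then have "s x y \<in> carrier R" using sx by (auto simp: free_module_simps)
        then show "s x y \<odot>\<^bsub>B\<^esub> f y \<in> carrier B"
          using mod_homD(1)[OF f y] by (rule right_module.smult_closed[OF B])
      qed
    qed (simp_all add: a)
    also have "\<dots> = f (?p (s x))"
      by (rule free_ext_comp[OF f PM B _ sx, symmetric]) auto
    finally show ?thesis using s(2)[OF x] by simp
  qed
  with h show ?thesis by (intro bexI[of _ "\<lambda>x. free_ext R ?X A a (s x)"]) auto
qed

lemma submoduleD:
  fixes R :: "('a, 'r) ring_scheme" and M :: "('a, 'm) module"
  assumes "submodule H R M"
  shows "H \<subseteq> carrier M" and "\<zero>\<^bsub>M\<^esub> \<in> H"
    and "\<lbrakk>x \<in> H; y \<in> H\<rbrakk> \<Longrightarrow> x \<oplus>\<^bsub>M\<^esub> y \<in> H"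
    and "\<lbrakk>r \<in> carrier R; x \<in> H\<rbrakk> \<Longrightarrow> r \<odot>\<^bsub>M\<^esub> x \<in> H"
    and "x \<in> H \<Longrightarrow> \<ominus>\<^bsub>M\<^esub> x \<in> H"
proof -
  interpret submodule H R M by fact
  show "H \<subseteq> carrier M" and "\<zero>\<^bsub>M\<^esub> \<in> H"
    and "\<lbrakk>x \<in> H; y \<in> H\<rbrakk> \<Longrightarrow> x \<oplus>\<^bsub>M\<^esub> y \<in> H"
    and "\<lbrakk>r \<in> carrier R; x \<in> H\<rbrakk> \<Longrightarrow> r \<odot>\<^bsub>M\<^esub> x \<in> H"
    and "x \<in> H \<Longrightarrow> \<ominus>\<^bsub>M\<^esub> x \<in> H"
    using subset one_closed m_closed m_inv_closed smult_closed by (auto simp: a_inv_def)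
qed

lemma (in right_module) submoduleI:
  assumes "H \<subseteq> carrier M" "H \<noteq> {}"
    and add: "\<And>x y. \<lbrakk>x \<in> H; y \<in> H\<rbrakk> \<Longrightarrow> x \<oplus>\<^bsub>M\<^esub> y \<in> H"
    and smult: "\<And>r x. \<lbrakk>r \<in> carrier R; x \<in> H\<rbrakk> \<Longrightarrow> r \<odot>\<^bsub>M\<^esub> x \<in> H"
  shows "submodule H R M"
proof -
  have "\<ominus>\<^bsub>M\<^esub> x \<in> H" if x: "x \<in> H" for x
  proof -
    have c: "x \<in> carrier M" using x assms(1) by auto
    have "(\<ominus>\<^bsub>R\<^esub> \<one>\<^bsub>R\<^esub>) \<odot>\<^bsub>M\<^esub> x \<oplus>\<^bsub>M\<^esub> x = \<zero>\<^bsub>M\<^esub>"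
      using smult_l_distr[of "\<ominus>\<^bsub>R\<^esub> \<one>\<^bsub>R\<^esub>" "\<one>\<^bsub>R\<^esub>" x] c
      by (simp add: smult_one smult_l_null R.l_neg)
    then have "\<ominus>\<^bsub>M\<^esub> x = (\<ominus>\<^bsub>R\<^esub> \<one>\<^bsub>R\<^esub>) \<odot>\<^bsub>M\<^esub> x"
      using c by (intro M.minus_equality) (auto intro: smult_closed)
    then show ?thesis using smult x by simp
  qed
  then show ?thesis
    using assms
    by (intro submodule.intro submodule_axioms.intro M.add.subgroupI) (auto simp: a_inv_def)
qed

lemma set_add_iff: "x \<in> A <+>\<^bsub>M\<^esub> B \<longleftrightarrow> (\<exists>a \<in> A. \<exists>b \<in> B. x = a \<oplus>\<^bsub>M\<^esub> b)"
  by (auto simp: set_add_def set_mult_def)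

lemma has_projective_coverI:
  fixes R :: "('a, 'r) ring_scheme" and M :: "('a, 'm) module" and P :: "('a, 'p) module"
  assumes MM: "right_module R M" and cov: "projective_cover R M P f"
  shows "has_projective_cover R M"
proof -
  have P: "projective R P" and f: "f \<in> mod_hom R P M" and fs: "f ` carrier P = carrier M"
    and sup: "superfluous R P (a_kernel P M f)"
    using cov by (auto simp: projective_cover_def mod_epi_def)
  have PM: "right_module R P" using P unfolding projective_def by blast
  interpret M: right_module R M by fact
  interpret P: right_module R P by fact
  have R: "ring R" using PM unfolding right_module_def by blast
  define F where "F = free_module R (carrier M)"
  have FM: "right_module R F" unfolding F_def by (rule right_module_free[OF R])
  interpret F: right_module R F by fact
  have ker: "a_kernel P' M f' = {x \<in> carrier P'. f' x = \<zero>\<^bsub>M\<^esub>}"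
    for P' :: "('a, 'q) module" and f'
    by (simp add: a_kernel_def kernel_def)
  have "\<forall>x \<in> carrier M. \<exists>y \<in> carrier P. f y = x" unfolding fs[symmetric] by blast
  then have "\<forall>x \<in> carrier M. \<exists>y. y \<in> carrier P \<and> f y = x" by blast
  from bchoice[OF this] obtain b where b: "\<And>x. x \<in> carrier M \<Longrightarrow> b x \<in> carrier P \<and> f (b x) = x"
    by blast
  have b': "b \<in> carrier M \<rightarrow> carrier P" using b by auto
  define h where "h = free_ext R (carrier M) P b"
  have h: "h \<in> mod_hom R F P" unfolding h_def F_def by (rule P.free_ext_hom[OF b'])
  note hD = mod_homD[OF h] and fD = mod_homD[OF f]
  have K: "submodule (a_kernel P M f) R P" using sup by (simp add: superfluous_def)
  have hsub: "submodule (h ` H) R P" if "H \<subseteq> carrier F" "H \<noteq> {}"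
    "\<And>x y. \<lbrakk>x \<in> H; y \<in> H\<rbrakk> \<Longrightarrow> x \<oplus>\<^bsub>F\<^esub> y \<in> H"
    "\<And>r x. \<lbrakk>r \<in> carrier R; x \<in> H\<rbrakk> \<Longrightarrow> r \<odot>\<^bsub>F\<^esub> x \<in> H" for H
  proof (rule P.submoduleI)
    show "h ` H \<subseteq> carrier P" using that(1) hD(1) by auto
    show "h ` H \<noteq> {}" using that(2) by simp
    show "x \<oplus>\<^bsub>P\<^esub> y \<in> h ` H" if "x \<in> h ` H" "y \<in> h ` H" for x y
      using that \<open>H \<subseteq> carrier F\<close> \<open>\<And>x y. \<lbrakk>x \<in> H; y \<in> H\<rbrakk> \<Longrightarrow> x \<oplus>\<^bsub>F\<^esub> y \<in> H\<close>
      by (auto simp: hD(2)[symmetric] subset_iff)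
    show "r \<odot>\<^bsub>P\<^esub> x \<in> h ` H" if "r \<in> carrier R" "x \<in> h ` H" for r x
      using that \<open>H \<subseteq> carrier F\<close> \<open>\<And>r x. \<lbrakk>r \<in> carrier R; x \<in> H\<rbrakk> \<Longrightarrow> r \<odot>\<^bsub>F\<^esub> x \<in> H\<close>
      by (auto simp: hD(3)[symmetric] subset_iff)
  qed
  have "a_kernel P M f <+>\<^bsub>P\<^esub> (h ` carrier F) = carrier P"
  proof
    show "a_kernel P M f <+>\<^bsub>P\<^esub> (h ` carrier F) \<subseteq> carrier P"
      proof
      fix x assume "x \<in> a_kernel P M f <+>\<^bsub>P\<^esub> (h ` carrier F)"
      then obtain k u where "k \<in> carrier P" "u \<in> carrier F" "x = k \<oplus>\<^bsub>P\<^esub> h u"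
        by (auto simp: set_add_iff ker)
      then show "x \<in> carrier P" using hD(1)[of u] by simp
    qed
    show "carrier P \<subseteq> a_kernel P M f <+>\<^bsub>P\<^esub> (h ` carrier F)"
    proof
      fix p assume p: "p \<in> carrier P"
      obtain u where u: "u \<in> carrier F" "h u = b (f p)"
        using P.free_ext_unit[OF b' fD(1)[OF p]] unfolding h_def F_def by auto
      have hu: "h u \<in> carrier P" "f (h u) = f p" using hD(1) u b fD(1)[OF p] by auto
      define k where "k = p \<oplus>\<^bsub>P\<^esub> (\<ominus>\<^bsub>P\<^esub> h u)"
      have kc: "k \<in> carrier P" using p hu by (simp add: k_def)
      have pk: "p = k \<oplus>\<^bsub>P\<^esub> h u" using p hu by (simp add: k_def P.M.a_assoc P.M.l_neg)
      have "f p = f k \<oplus>\<^bsub>M\<^esub> f p" using fD(2)[OF kc hu(1)] hu(2) pk by simp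
      then have "f k = \<zero>\<^bsub>M\<^esub>" using fD(1)[OF kc] fD(1)[OF p] by (simp add: M.M.add.r_cancel_one')
      then have "k \<in> a_kernel P M f" using kc by (simp add: ker)
      then show "p \<in> a_kernel P M f <+>\<^bsub>P\<^esub> (h ` carrier F)"
        unfolding set_add_iff using u(1) pk by blast
    qed
  qed
  moreover have "submodule (h ` carrier F) R P"
    by (rule hsub) (use F.M.zero_closed in \<open>auto intro: F.smult_closed\<close>)
  ultimately have hF: "h ` carrier F = carrier P" using sup by (simp add: superfluous_def)
  then have he: "h \<in> mod_epi R F P" using h by (simp add: mod_epi_def)
  have "(\<lambda>x. x) \<in> mod_hom R P P" by (rule mod_homI) auto
  from projective_lift[OF P FM PM he this]
  obtain s where s: "s \<in> mod_hom R P F" and hs: "\<And>x. x \<in> carrier P \<Longrightarrow> h (s x) = x"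
    by blast
  note sD = mod_homD[OF s]
  define Q where "Q = F\<lparr>carrier := s ` carrier P\<rparr>"
  have Qc: "carrier Q = s ` carrier P" and Qa: "x \<oplus>\<^bsub>Q\<^esub> y = x \<oplus>\<^bsub>F\<^esub> y"
    and Qm: "r \<odot>\<^bsub>Q\<^esub> x = r \<odot>\<^bsub>F\<^esub> x" and Qz: "\<zero>\<^bsub>Q\<^esub> = \<zero>\<^bsub>F\<^esub>" for x y r
    by (simp_all add: Q_def)
  have s0: "s \<zero>\<^bsub>P\<^esub> = \<zero>\<^bsub>F\<^esub>" by (rule mod_hom_zero[OF s PM FM])
  have QF: "x \<in> carrier F" if "x \<in> carrier Q" for x using that sD(1) by (auto simp: Qc)
  have sh: "s (h x) = x" if "x \<in> carrier Q" for x using that hs by (auto simp: Qc)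
  have sQ: "s x \<in> carrier Q" if "x \<in> carrier P" for x using that by (simp add: Qc)
  have sQh: "s \<in> mod_hom R P Q" by (rule mod_homI) (simp_all add: sQ sD Qa Qm)
  have hQ: "h \<in> mod_hom R Q P" by (rule mod_homI) (simp_all add: QF hD Qa Qm)
  have QM: "right_module R Q"
  proof (rule right_moduleI[OF R])
    show "x \<oplus>\<^bsub>Q\<^esub> y \<in> carrier Q" if "x \<in> carrier Q" "y \<in> carrier Q" for x y
      using that by (auto simp: Qc Qa sD(2)[symmetric])
    show "r \<odot>\<^bsub>Q\<^esub> x \<in> carrier Q" if "r \<in> carrier R" "x \<in> carrier Q" for r x
      using that by (auto simp: Qc Qm sD(3)[symmetric] intro: P.smult_closed)
    show "\<zero>\<^bsub>Q\<^esub> \<in> carrier Q" using s0 P.M.zero_closed by (auto simp: Qc Qz intro!: image_eqI)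
    show "\<exists>y\<in>carrier Q. y \<oplus>\<^bsub>Q\<^esub> x = \<zero>\<^bsub>Q\<^esub>" if x: "x \<in> carrier Q" for x
    proof -
      obtain p where p: "p \<in> carrier P" "x = s p" using x by (auto simp: Qc)
      have "s (\<ominus>\<^bsub>P\<^esub> p) \<oplus>\<^bsub>Q\<^esub> x = \<zero>\<^bsub>Q\<^esub>"
        using sD(2)[of "\<ominus>\<^bsub>P\<^esub> p" p] p s0 by (simp add: Qa Qz P.M.l_neg)
      then show ?thesis using p sQ by blast
    qed
  qed (auto simp: Qa Qm Qz QF F.M.a_assoc F.smult_l_distr F.smult_r_distr F.smult_assoc F.smult_one
      F.M.a_comm F.M.a_lcomm)
  have projQ: "projective R Q"
    unfolding projective_def
  proof (intro conjI allI impI QM)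
    fix A :: "('a, ('m \<Rightarrow> 'a) \<Rightarrow> 'a) module" and B :: "('a, 'm \<Rightarrow> 'a) module" and g k
    assume A: "right_module R A" and B: "right_module R B" and g: "g \<in> mod_epi R A B"
      and k: "k \<in> mod_hom R Q B"
    obtain l where l: "l \<in> mod_hom R P A" "\<And>x. x \<in> carrier P \<Longrightarrow> g (l x) = k (s x)"
      using projective_lift[OF P A B g mod_hom_comp[OF sQh k]] by blast
    have "g (l (h x)) = k x" if "x \<in> carrier Q" for x
      using l(2)[of "h x"] hD(1) QF sh that by simp
    then show "\<exists>h\<in>mod_hom R Q A. \<forall>x\<in>carrier Q. g (h x) = k x"
      using mod_hom_comp[OF hQ l(1)] by (intro bexI[of _ "\<lambda>x. l (h x)"]) auto
  qed
  define f' where "f' = (\<lambda>x. f (h x))"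
  have f': "f' \<in> mod_hom R Q M" unfolding f'_def by (rule mod_hom_comp[OF hQ f])
  have "f' ` carrier Q = carrier M"
    using fs hs by (simp add: Qc f'_def image_image cong: image_cong_simp)
  with f' have f'e: "f' \<in> mod_epi R Q M" by (simp add: mod_epi_def)
  interpret Q: right_module R Q by fact
  have kerQ: "x \<in> a_kernel Q M f' \<longleftrightarrow> x \<in> carrier Q \<and> h x \<in> a_kernel P M f" for x
    using hD(1) QF by (auto simp: ker f'_def)
  have "superfluous R Q (a_kernel Q M f')"
    unfolding superfluous_def
  proof (intro conjI allI impI)
    show "submodule (a_kernel Q M f') R Q"
    proof (rule Q.submoduleI)
      have "h \<zero>\<^bsub>Q\<^esub> = \<zero>\<^bsub>P\<^esub>" by (rule mod_hom_zero[OF hQ QM PM])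
      then have "\<zero>\<^bsub>Q\<^esub> \<in> a_kernel Q M f'"
        using submoduleD(2)[OF K] Q.M.zero_closed by (simp add: kerQ)
      then show "a_kernel Q M f' \<noteq> {}" by blast
      show "a_kernel Q M f' \<subseteq> carrier Q" by (auto simp: kerQ)
      show "x \<oplus>\<^bsub>Q\<^esub> y \<in> a_kernel Q M f'" if "x \<in> a_kernel Q M f'" "y \<in> a_kernel Q M f'" for x y
        using that submoduleD(3)[OF K] mod_homD(2)[OF hQ] by (simp add: kerQ)
      show "r \<odot>\<^bsub>Q\<^esub> x \<in> a_kernel Q M f'" if "r \<in> carrier R" "x \<in> a_kernel Q M f'" for r x
        using that submoduleD(4)[OF K] mod_homD(3)[OF hQ] Q.smult_closed by (simp add: kerQ)
    qed
  next
    fix N assume N: "submodule N R Q" and sum: "a_kernel Q M f' <+>\<^bsub>Q\<^esub> N = carrier Q"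
    note ND = submoduleD[OF N]
    have NF: "N \<subseteq> carrier F" using ND(1) QF by blast
    have hN: "submodule (h ` N) R P"
      by (rule hsub) (use NF ND in \<open>auto simp: Qa Qm\<close>)
    have "a_kernel P M f <+>\<^bsub>P\<^esub> (h ` N) = carrier P"
    proof
      show "a_kernel P M f <+>\<^bsub>P\<^esub> (h ` N) \<subseteq> carrier P"
        proof
        fix x assume "x \<in> a_kernel P M f <+>\<^bsub>P\<^esub> (h ` N)"
        then obtain k v where "k \<in> carrier P" "v \<in> N" "x = k \<oplus>\<^bsub>P\<^esub> h v"
          by (auto simp: set_add_iff ker)
        moreover have "v \<in> carrier F" using NF calculation(2) by blast
        ultimately show "x \<in> carrier P" using hD(1)[of v] by simp
      qed
      show "carrier P \<subseteq> a_kernel P M f <+>\<^bsub>P\<^esub> (h ` N)"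
      proof
        fix p assume p: "p \<in> carrier P"
        then have "s p \<in> a_kernel Q M f' <+>\<^bsub>Q\<^esub> N" using sum sQ by simp
        then obtain u v where uv: "u \<in> a_kernel Q M f'" "v \<in> N" "s p = u \<oplus>\<^bsub>Q\<^esub> v"
          unfolding set_add_iff by blast
        have "p = h u \<oplus>\<^bsub>P\<^esub> h v"
          using mod_homD(2)[OF hQ, of u v] uv ND(1) hs[OF p] by (auto simp: kerQ)
        then show "p \<in> a_kernel P M f <+>\<^bsub>P\<^esub> (h ` N)"
          unfolding set_add_iff using uv(1,2) by (auto simp: kerQ)
      qed
    qed
    then have hNP: "h ` N = carrier P" using sup hN by (simp add: superfluous_def)
    show "N = carrier Q"
    proof
      show "N \<subseteq> carrier Q" by (rule ND(1))
      show "carrier Q \<subseteq> N"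
      proof
        fix x assume x: "x \<in> carrier Q"
        then have "h x \<in> h ` N" using hNP hD(1) QF by auto
        then obtain y where y: "y \<in> N" "h x = h y" by auto
        then have "x = y" using sh x ND(1) by (metis subsetD)
        then show "x \<in> N" using y by simp
      qed
    qed
  qed
  then have "projective_cover R M Q f'"
    using projQ f'e by (simp add: projective_cover_def)
  then show ?thesis unfolding has_projective_cover_def by blast
qed

end

theory Submission
  imports Defs
begin

text \<open>
  Part (a) is proved by contraposition. Suppose that every torsionless right module is projective.
  This is applied to powers of \<open>R\<close> and to the cyclic modules \<open>aR\<close>.

  Left coherence. Let \<open>K \<subseteq> R\<^sup>n\<close> be the left module of relations of \<open>a\<^sub>1, \<dots>, a\<^sub>n\<close>. The tautological
  elements \<open>x\<^sub>i = (k\<^sub>i)\<close> of the power of \<open>R\<close> indexed by \<open>K\<close> itself satisfy \<open>\<Sum> x\<^sub>i a\<^sub>i = 0\<close>. Expanding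
  them in a dual basis of this projective module involves finitely many coordinates only; the
  coordinate vectors are relations of the \<open>a\<^sub>i\<close>, and reading the expansion at the index \<open>k\<close> writes \<open>k\<close>
  as a combination of them (\<open>left_coherent_of_projective_powers\<close>).

  Chain condition. By an argument of Chase, projectivity of the power indexed by lists over \<open>R\<close>
  forces the descending chain condition on principal left ideals. Embed the power in a free module.
  Along a strictly descending chain \<open>R a\<^sub>n\<close> there is some \<open>n\<close> such that all but finitely many
  coordinates map the vectors over \<open>R a\<^sub>n\<close> that vanish at the indices of length below \<open>n\<close> into
  \<open>R a\<^sub>n\<^sub>+\<^sub>1\<close>, since otherwise a vector with infinitely many nonzero coordinates can be assembled.
  Among these vectors, those with entries \<open>0\<close> and \<open>a\<^sub>n\<close>, one for each set of indices,
  are then told apart by finitely many elements of \<open>R\<close>, and Cantor's theorem is contradicted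
  (\<open>chain_stabilises\<close>).

  Perfectness. The chain condition splits \<open>1\<close> into finitely many orthogonal primitive idempotents.
  Projectivity of \<open>aR\<close> makes the kernel of multiplication by \<open>a\<close> a direct summand, so that each
  nonzero map between the indecomposable modules \<open>eR\<close> is injective; with the chain condition, each
  \<open>eRe\<close> is a division ring. Hence the relation \<open>eJf \<noteq> 0\<close> for the radical \<open>J\<close> is a strict order on the
  finitely many idempotents, and induction along it shows that \<open>MJ\<close> is superfluous in every module \<open>M\<close>
  (\<open>times_J_superfluous\<close>). A direct sum of modules \<open>eR\<close>, one for each member of a maximal family of
  elements \<open>x = xe\<close> of \<open>M\<close> that is independent modulo \<open>MJ\<close>, is then a projective cover of \<open>M\<close>.

  For part (b), the stable summand \<open>N\<close> is nonzero, because \<open>M\<close> is not projective. A torsionless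
  module has enough homomorphisms to \<open>R\<close>, so some homomorphism is nonzero on \<open>N\<close>. Its image is a right
  ideal, finitely generated if \<open>M\<close> is, hence projective. It therefore splits off \<open>N\<close>, against
  stability (\<open>nonzero_torsionless_summand_not_stable\<close>).
\<close>

section \<open>Modules, sums and retracts\<close>

lemma submodule_carrier_simps [simp]:
  "carrier (M\<lparr>carrier := H\<rparr>) = H"
  "\<zero>\<^bsub>M\<lparr>carrier := H\<rparr>\<^esub> = \<zero>\<^bsub>M\<^esub>"
  "x \<oplus>\<^bsub>M\<lparr>carrier := H\<rparr>\<^esub> y = x \<oplus>\<^bsub>M\<^esub> y"
  "r \<odot>\<^bsub>M\<lparr>carrier := H\<rparr>\<^esub> x = r \<odot>\<^bsub>M\<^esub> x"
  for M :: "('a, 'm) module"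
  by simp_all

lemma right_module_submodule:
  fixes R :: "('a, 'r) ring_scheme" and M :: "('a, 'm) module"
  assumes M: "right_module R M" and H: "submodule H R M"
  shows "right_module R (M\<lparr>carrier := H\<rparr>)"
proof -
  interpret right_module R M by fact
  note HD = submoduleD[OF H]
  have c: "x \<in> H \<Longrightarrow> x \<in> carrier M" for x using HD(1) by blast
  show ?thesis
  proof (rule right_moduleI[OF R.ring_axioms])
    fix x assume "x \<in> carrier (M\<lparr>carrier := H\<rparr>)"
    then show "\<exists>y\<in>carrier (M\<lparr>carrier := H\<rparr>). y \<oplus>\<^bsub>M\<lparr>carrier := H\<rparr>\<^esub> x = \<zero>\<^bsub>M\<lparr>carrier := H\<rparr>\<^esub>"
      using HD(5)[of x] c M.l_neg by auto
  qed (auto simp: HD c M.a_assoc M.a_comm M.a_lcomm smult_l_distr smult_r_distr smult_assoc smult_one)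
qed

lemma power_module_simps:
  "carrier (power_module R I) = (I \<rightarrow>\<^sub>E carrier R)"
  "\<zero>\<^bsub>power_module R I\<^esub> = (\<lambda>i\<in>I. \<zero>\<^bsub>R\<^esub>)"
  "u \<oplus>\<^bsub>power_module R I\<^esub> v = (\<lambda>i\<in>I. u i \<oplus>\<^bsub>R\<^esub> v i)"
  "r \<odot>\<^bsub>power_module R I\<^esub> u = (\<lambda>i\<in>I. u i \<otimes>\<^bsub>R\<^esub> r)"
  by (simp_all add: power_module_def)

lemma regular_module_simps:
  "carrier (regular_module R) = carrier R"
  "\<zero>\<^bsub>regular_module R\<^esub> = \<zero>\<^bsub>R\<^esub>"
  "x \<oplus>\<^bsub>regular_module R\<^esub> y = x \<oplus>\<^bsub>R\<^esub> y"
  "r \<odot>\<^bsub>regular_module R\<^esub> x = x \<otimes>\<^bsub>R\<^esub> r"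
  by (simp_all add: regular_module_def)

lemma finsum_regular_module: "finsum (regular_module R) f A = finsum R f A"
  by (simp add: finsum_def finprod_def regular_module_def)

lemma right_module_regular:
  fixes R :: "('a, 'r) ring_scheme"
  assumes "ring R"
  shows "right_module R (regular_module R)"
proof -
  interpret ring R by fact
  show ?thesis
    by (rule right_moduleI[OF assms])
      (auto simp: regular_module_simps a_assoc a_comm a_lcomm l_distr r_distr m_assoc
        intro!: bexI[of _ "\<ominus>\<^bsub>R\<^esub> _"] l_neg)
qed

lemma right_module_power:
  fixes R :: "('a, 'r) ring_scheme"
  assumes "ring R"
  shows "right_module R (power_module R I)"
proof -
  interpret ring R by fact
  have mem: "u x \<in> carrier R" if "u \<in> I \<rightarrow>\<^sub>E carrier R" "x \<in> I" for u x
    using that by auto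
  have ext: "u = v" if "u \<in> I \<rightarrow>\<^sub>E carrier R" "v \<in> I \<rightarrow>\<^sub>E carrier R" "\<And>x. x \<in> I \<Longrightarrow> u x = v x" for u v
    using PiE_ext[OF that(1,2)] that(3) by blast
  show ?thesis
  proof (rule right_moduleI[OF assms], unfold power_module_simps)
    fix u assume u: "u \<in> I \<rightarrow>\<^sub>E carrier R"
    show "\<exists>y\<in>I \<rightarrow>\<^sub>E carrier R. (\<lambda>i\<in>I. y i \<oplus>\<^bsub>R\<^esub> u i) = (\<lambda>i\<in>I. \<zero>\<^bsub>R\<^esub>)"
      by (rule bexI[of _ "\<lambda>x\<in>I. \<ominus>\<^bsub>R\<^esub> u x"])
        (use u mem in \<open>auto simp: fun_eq_iff restrict_def l_neg\<close>)
  qed (auto simp: fun_eq_iff restrict_def mem a_assoc a_comm a_lcomm m_assoc l_distr r_distr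
        intro!: ext)
qed

lemma eval_hom_power: "i \<in> I \<Longrightarrow> (\<lambda>u. u i) \<in> mod_hom R (power_module R I) (regular_module R)"
  by (rule mod_homI) (auto simp: power_module_simps regular_module_simps)

lemma eval_hom_free: "i \<in> I \<Longrightarrow> (\<lambda>u. u i) \<in> mod_hom R (free_module R I) (regular_module R)"
  by (rule mod_homI) (auto simp: free_module_simps regular_module_simps)

lemma mod_hom_finsum:
  assumes f: "f \<in> mod_hom R M N" and M: "right_module R M" and N: "right_module R N"
    and "finite S" "g \<in> S \<rightarrow> carrier M"
  shows "f (\<Oplus>\<^bsub>M\<^esub> i \<in> S. g i) = (\<Oplus>\<^bsub>N\<^esub> i \<in> S. f (g i))"
proof -
  interpret M: right_module R M by fact
  interpret N: right_module R N by fact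
  show ?thesis using assms(4,5)
  proof (induction S rule: finite_induct)
    case empty then show ?case by (simp add: mod_hom_zero[OF f M N])
  next
    case (insert i S)
    then have "g i \<in> carrier M" "g \<in> S \<rightarrow> carrier M" "(\<lambda>j. f (g j)) \<in> S \<rightarrow> carrier N" "f (g i) \<in> carrier N"
      using mod_homD(1)[OF f] by auto
    then show ?case using insert by (simp add: mod_homD(2)[OF f])
  qed
qed

lemma mod_hom_minus:
  assumes f: "f \<in> mod_hom R M N" and M: "right_module R M" and N: "right_module R N"
    and x: "x \<in> carrier M"
  shows "f (\<ominus>\<^bsub>M\<^esub> x) = \<ominus>\<^bsub>N\<^esub> f x"
proof -
  interpret M: right_module R M by fact
  interpret N: right_module R N by fact
  have "f (\<ominus>\<^bsub>M\<^esub> x) \<oplus>\<^bsub>N\<^esub> f x = \<zero>\<^bsub>N\<^esub>"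
    using mod_homD(2)[OF f, of "\<ominus>\<^bsub>M\<^esub> x" x] x M.M.l_neg mod_hom_zero[OF f M N] by simp
  then show ?thesis using mod_homD(1)[OF f] x by (intro N.M.minus_equality[symmetric]) auto
qed

lemma (in right_module) finsum_mem_submodule:
  assumes H: "submodule H R M" and "finite S" "\<And>i. i \<in> S \<Longrightarrow> g i \<in> H"
  shows "(\<Oplus>\<^bsub>M\<^esub> i \<in> S. g i) \<in> H"
  using assms(2,3)
proof (induction S rule: finite_induct)
  case empty then show ?case using submoduleD(2)[OF H] by simp
next
  case (insert i S)
  then have "g i \<in> carrier M" "g \<in> S \<rightarrow> carrier M" using submoduleD(1)[OF H] by auto
  then show ?case using insert submoduleD(3)[OF H] by simp
qed

lemma mod_hom_image_submodule:
  assumes f: "f \<in> mod_hom R M N" and M: "right_module R M" and N: "right_module R N"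
    and H: "submodule H R M"
  shows "submodule (f ` H) R N"
proof -
  interpret N: right_module R N by fact
  note HD = submoduleD[OF H] and fD = mod_homD[OF f]
  have c: "x \<in> H \<Longrightarrow> x \<in> carrier M" for x using HD(1) by blast
  show ?thesis
    by (rule N.submoduleI)
      (use HD fD c in \<open>auto simp: fD(2)[symmetric] fD(3)[symmetric] simp del: fD(2) fD(3)\<close>)
qed

lemma mod_hom_vimage_submodule:
  assumes f: "f \<in> mod_hom R M N" and M: "right_module R M" and N: "right_module R N"
    and H: "submodule H R N"
  shows "submodule {x \<in> carrier M. f x \<in> H} R M"
proof -
  interpret M: right_module R M by fact
  show ?thesis
    by (rule M.submoduleI)
      (use submoduleD[OF H] mod_homD[OF f] mod_hom_zero[OF f M N] M.M.zero_closed M.smult_closed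
        in \<open>auto intro: exI[of _ "\<zero>\<^bsub>M\<^esub>"]\<close>)
qed

lemma (in right_module) submodule_carrier: "submodule (carrier M) R M"
  by (rule submoduleI) (auto intro: smult_closed)

lemma (in right_module) smult_hom:
  assumes "x \<in> carrier M" shows "(\<lambda>r. r \<odot>\<^bsub>M\<^esub> x) \<in> mod_hom R (regular_module R) M"
  by (rule mod_homI) (use assms in \<open>auto simp: regular_module_simps smult_closed smult_l_distr smult_assoc\<close>)

lemma (in right_module) zero_submodule: "submodule {\<zero>\<^bsub>M\<^esub>} R M"
  by (rule submoduleI) (auto simp: smult_r_null)

lemma (in right_module) set_add_submodule:
  assumes H: "submodule H R M" and K: "submodule K R M"
  shows "submodule (H <+>\<^bsub>M\<^esub> K) R M"
proof (rule submoduleI)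
  note HD = submoduleD[OF H] and KD = submoduleD[OF K]
  have Hc: "x \<in> H \<Longrightarrow> x \<in> carrier M" and Kc: "x \<in> K \<Longrightarrow> x \<in> carrier M" for x
    using HD(1) KD(1) by auto
  show "H <+>\<^bsub>M\<^esub> K \<subseteq> carrier M" using Hc Kc by (auto simp: set_add_iff)
  show "H <+>\<^bsub>M\<^esub> K \<noteq> {}" using HD(2) KD(2) by (metis empty_iff set_add_iff)
  show "x \<oplus>\<^bsub>M\<^esub> y \<in> H <+>\<^bsub>M\<^esub> K" if xy: "x \<in> H <+>\<^bsub>M\<^esub> K" "y \<in> H <+>\<^bsub>M\<^esub> K" for x y
  proof -
    obtain h k h' k' where e: "h \<in> H" "k \<in> K" "x = h \<oplus>\<^bsub>M\<^esub> k" "h' \<in> H" "k' \<in> K" "y = h' \<oplus>\<^bsub>M\<^esub> k'"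
      using xy unfolding set_add_iff by blast
    then have "x \<oplus>\<^bsub>M\<^esub> y = (h \<oplus>\<^bsub>M\<^esub> h') \<oplus>\<^bsub>M\<^esub> (k \<oplus>\<^bsub>M\<^esub> k')"
      using Hc Kc by (simp add: M.add.m_ac)
    then show ?thesis using e HD(3) KD(3) unfolding set_add_iff by blast
  qed
  show "r \<odot>\<^bsub>M\<^esub> x \<in> H <+>\<^bsub>M\<^esub> K" if "r \<in> carrier R" "x \<in> H <+>\<^bsub>M\<^esub> K" for r x
    using that HD(4) KD(4) Hc Kc unfolding set_add_iff by (metis smult_r_distr)
qed

lemma mod_hom_inclusion:
  fixes M :: "('a, 'm) module"
  assumes "submodule H R M" shows "(\<lambda>x. x) \<in> mod_hom R (M\<lparr>carrier := H\<rparr>) M"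
  by (rule mod_homI) (use submoduleD(1)[OF assms] in auto)

lemma submodule_trans:
  fixes R :: "('a, 'r) ring_scheme" and M :: "('a, 'm) module"
  assumes M: "right_module R M" and H: "submodule H R M" and K: "submodule K R (M\<lparr>carrier := H\<rparr>)"
  shows "submodule K R M"
proof -
  interpret right_module R M by fact
  note HD = submoduleD[OF H] and KD = submoduleD[OF K, simplified]
  show ?thesis by (rule submoduleI) (use HD(1) KD in auto)
qed

lemma (in right_module) linear_combination_hom:
  assumes "finite I" and b: "b \<in> I \<rightarrow> carrier M"
  shows "(\<lambda>u. \<Oplus>\<^bsub>M\<^esub> i \<in> I. u i \<odot>\<^bsub>M\<^esub> b i) \<in> mod_hom R (power_module R I) M"
proof (rule mod_homI)
  have c: "(\<lambda>i. u i \<odot>\<^bsub>M\<^esub> b i) \<in> I \<rightarrow> carrier M" if "u \<in> carrier (power_module R I)" for u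
    using that b by (auto simp: power_module_simps intro!: smult_closed)
  show "(\<Oplus>\<^bsub>M\<^esub> i \<in> I. u i \<odot>\<^bsub>M\<^esub> b i) \<in> carrier M" if "u \<in> carrier (power_module R I)" for u
    by (rule M.finsum_closed[OF c[OF that]])
  show "(\<Oplus>\<^bsub>M\<^esub> i \<in> I. (u \<oplus>\<^bsub>power_module R I\<^esub> v) i \<odot>\<^bsub>M\<^esub> b i) =
      (\<Oplus>\<^bsub>M\<^esub> i \<in> I. u i \<odot>\<^bsub>M\<^esub> b i) \<oplus>\<^bsub>M\<^esub> (\<Oplus>\<^bsub>M\<^esub> i \<in> I. v i \<odot>\<^bsub>M\<^esub> b i)"
    if u: "u \<in> carrier (power_module R I)" and v: "v \<in> carrier (power_module R I)" for u v
  proof -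
    have "(u \<oplus>\<^bsub>power_module R I\<^esub> v) i \<odot>\<^bsub>M\<^esub> b i = u i \<odot>\<^bsub>M\<^esub> b i \<oplus>\<^bsub>M\<^esub> v i \<odot>\<^bsub>M\<^esub> b i" if "i \<in> I" for i
      using that u v b by (auto simp: power_module_simps intro!: smult_l_distr)
    then have "(\<Oplus>\<^bsub>M\<^esub> i \<in> I. (u \<oplus>\<^bsub>power_module R I\<^esub> v) i \<odot>\<^bsub>M\<^esub> b i) =
        (\<Oplus>\<^bsub>M\<^esub> i \<in> I. u i \<odot>\<^bsub>M\<^esub> b i \<oplus>\<^bsub>M\<^esub> v i \<odot>\<^bsub>M\<^esub> b i)"
      using c[OF u] c[OF v] by (intro M.finsum_cong') (auto simp: Pi_iff)
    then show ?thesis using M.finsum_addf[OF c[OF u] c[OF v]] by simp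
  qed
  show "(\<Oplus>\<^bsub>M\<^esub> i \<in> I. (r \<odot>\<^bsub>power_module R I\<^esub> u) i \<odot>\<^bsub>M\<^esub> b i) = r \<odot>\<^bsub>M\<^esub> (\<Oplus>\<^bsub>M\<^esub> i \<in> I. u i \<odot>\<^bsub>M\<^esub> b i)"
    if r: "r \<in> carrier R" and u: "u \<in> carrier (power_module R I)" for r u
  proof -
    have "(r \<odot>\<^bsub>power_module R I\<^esub> u) i \<odot>\<^bsub>M\<^esub> b i = r \<odot>\<^bsub>M\<^esub> (u i \<odot>\<^bsub>M\<^esub> b i)" if "i \<in> I" for i
      using that u r b by (auto simp: power_module_simps intro!: smult_assoc)
    then have "(\<Oplus>\<^bsub>M\<^esub> i \<in> I. (r \<odot>\<^bsub>power_module R I\<^esub> u) i \<odot>\<^bsub>M\<^esub> b i) = (\<Oplus>\<^bsub>M\<^esub> i \<in> I. r \<odot>\<^bsub>M\<^esub> (u i \<odot>\<^bsub>M\<^esub> b i))"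
      using c[OF u] r by (intro M.finsum_cong') (auto simp: Pi_iff intro!: smult_closed[OF r])
    then show ?thesis using finsum_smult[OF assms(1) r c[OF u]] by simp
  qed
qed

lemma projective_right_module: "projective R P \<Longrightarrow> right_module R P"
  by (simp add: projective_def)

lemma projective_split_epi:
  assumes P: "projective R P" and A: "right_module R A" and g: "g \<in> mod_epi R A P"
  shows "\<exists>s \<in> mod_hom R P A. \<forall>x \<in> carrier P. g (s x) = x"
  using projective_lift[OF P A projective_right_module[OF P] g, of "\<lambda>x. x"]
  by (auto intro: mod_homI)

lemma projective_retract:
  fixes R :: "('a, 'r) ring_scheme" and P :: "('a, 'p) module" and F :: "('a, 'f) module"
  assumes F: "projective R F" and P: "right_module R P"
    and i: "i \<in> mod_hom R P F" and p: "p \<in> mod_hom R F P"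
    and pi: "\<And>x. x \<in> carrier P \<Longrightarrow> p (i x) = x"
  shows "projective R P"
  unfolding projective_def
proof (intro conjI allI impI P)
  fix A :: "('a, 'p \<Rightarrow> 'a) module" and B :: "('a, 'p) module" and g f
  assume A: "right_module R A" and B: "right_module R B" and g: "g \<in> mod_epi R A B"
    and f: "f \<in> mod_hom R P B"
  obtain h where h: "h \<in> mod_hom R F A" "\<forall>x \<in> carrier F. g (h x) = f (p x)"
    using projective_lift[OF F A B g mod_hom_comp[OF p f]] by blast
  then have "\<forall>x\<in>carrier P. g (h (i x)) = f x"
    using pi mod_homD(1)[OF i] by simp
  then show "\<exists>h\<in>mod_hom R P A. \<forall>x\<in>carrier P. g (h x) = f x"
    using mod_hom_comp[OF i h(1)] by (intro bexI[of _ "\<lambda>x. h (i x)"])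
qed

section \<open>Free modules\<close>

definition free_unit :: "('a, 'r) ring_scheme \<Rightarrow> 'i set \<Rightarrow> 'i \<Rightarrow> 'i \<Rightarrow> 'a"
  where "free_unit R X x = (\<lambda>y\<in>X. if y = x then \<one>\<^bsub>R\<^esub> else \<zero>\<^bsub>R\<^esub>)"

lemma free_unit_closed:
  assumes "ring R" shows "free_unit R X x \<in> carrier (free_module R X)"
proof -
  interpret ring R by fact
  have "finite {y \<in> X. free_unit R X x y \<noteq> \<zero>\<^bsub>R\<^esub>}"
    by (rule finite_subset[of _ "{x}"]) (auto simp: free_unit_def)
  then show ?thesis by (auto simp: free_module_simps free_unit_def)
qed

lemma free_module_split_coordinate:
  fixes R :: "('a, 'r) ring_scheme"
  assumes "ring R" and u: "u \<in> carrier (free_module R X)" and x: "x \<in> X"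
  shows "u(x := \<zero>\<^bsub>R\<^esub>) \<in> carrier (free_module R X)"
    and "u = u x \<odot>\<^bsub>free_module R X\<^esub> free_unit R X x \<oplus>\<^bsub>free_module R X\<^esub> u(x := \<zero>\<^bsub>R\<^esub>)"
proof -
  interpret ring R by fact
  have "finite {y \<in> X. (u(x := \<zero>\<^bsub>R\<^esub>)) y \<noteq> \<zero>\<^bsub>R\<^esub>}"
    by (rule finite_subset[of _ "{y \<in> X. u y \<noteq> \<zero>\<^bsub>R\<^esub>}"]) (use u in \<open>auto simp: free_module_simps\<close>)
  then show "u(x := \<zero>\<^bsub>R\<^esub>) \<in> carrier (free_module R X)"
    using u x by (auto simp: free_module_simps PiE_def extensional_def)
  have mem: "u y \<in> carrier R" if "y \<in> X" for y
    using u that by (auto simp: free_module_simps)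
  have ext: "y \<notin> X \<Longrightarrow> u y = undefined" for y
    using u by (auto simp: free_module_simps PiE_def extensional_def)
  show "u = u x \<odot>\<^bsub>free_module R X\<^esub> free_unit R X x \<oplus>\<^bsub>free_module R X\<^esub> u(x := \<zero>\<^bsub>R\<^esub>)"
    using x mem ext by (auto simp: fun_eq_iff free_module_simps free_unit_def)
qed

text \<open>
  Induction on the size of the support. The step also hands over the coordinate that is split off,
  because some properties below are only inherited coordinate by coordinate.
\<close>

lemma free_module_induct:
  fixes R :: "('a, 'r) ring_scheme"
  assumes "ring R" and u: "u \<in> carrier (free_module R X)"
    and zero: "Q (\<lambda>x\<in>X. \<zero>\<^bsub>R\<^esub>)"
    and step: "\<And>v x. \<lbrakk>v \<in> carrier (free_module R X); x \<in> X; v x \<noteq> \<zero>\<^bsub>R\<^esub>;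
        v(x := \<zero>\<^bsub>R\<^esub>) \<in> carrier (free_module R X);
        v = v x \<odot>\<^bsub>free_module R X\<^esub> free_unit R X x \<oplus>\<^bsub>free_module R X\<^esub> v(x := \<zero>\<^bsub>R\<^esub>);
        Q (v(x := \<zero>\<^bsub>R\<^esub>))\<rbrakk> \<Longrightarrow> Q v"
  shows "Q u"
proof -
  interpret ring R by fact
  have "finite {x \<in> X. u x \<noteq> \<zero>\<^bsub>R\<^esub>}" using u by (simp add: free_module_simps)
  from this u show ?thesis
  proof (induction "{x \<in> X. u x \<noteq> \<zero>\<^bsub>R\<^esub>}" arbitrary: u rule: finite_psubset_induct)
    case (psubset u)
    show ?case
    proof (cases "{x \<in> X. u x \<noteq> \<zero>\<^bsub>R\<^esub>} = {}")
      case True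
      then have "u = (\<lambda>x\<in>X. \<zero>\<^bsub>R\<^esub>)" using psubset.prems
        by (intro extensionalityI[of _ X]) (auto simp: free_module_simps PiE_def)
      then show ?thesis using zero by simp
    next
      case False
      then obtain x where x: "x \<in> X" "u x \<noteq> \<zero>\<^bsub>R\<^esub>" by blast
      note split = free_module_split_coordinate[OF ring_axioms psubset.prems x(1)]
      have "Q (u(x := \<zero>\<^bsub>R\<^esub>))" by (rule psubset.hyps(2)[OF _ split(1)]) (use x in auto)
      then show ?thesis by (rule step[OF psubset.prems x split])
    qed
  qed
qed

lemma free_ext_free_unit:
  fixes R :: "('a, 'r) ring_scheme" and M :: "('a, 'm) module"
  assumes M: "right_module R M" and b: "b \<in> X \<rightarrow> carrier M" and x: "x \<in> X"
  shows "free_ext R X M b (free_unit R X x) = b x"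
proof -
  interpret right_module R M by fact
  have "free_ext R X M b (free_unit R X x) = (\<Oplus>\<^bsub>M\<^esub> y \<in> {x}. free_unit R X x y \<odot>\<^bsub>M\<^esub> b y)"
    by (rule free_ext_eq[OF _ _ _ _ b]) (use x in \<open>auto simp: free_unit_def\<close>)
  then show ?thesis
    using b x by (auto simp: free_unit_def smult_one smult_closed Pi_iff)
qed

lemma free_module_hom_eqI:
  fixes R :: "('a, 'r) ring_scheme" and N :: "('a, 'n) module"
  assumes "ring R" and N: "right_module R N"
    and f: "f \<in> mod_hom R (free_module R X) N" and g: "g \<in> mod_hom R (free_module R X) N"
    and eq: "\<And>x. x \<in> X \<Longrightarrow> f (free_unit R X x) = g (free_unit R X x)"
    and u: "u \<in> carrier (free_module R X)"
  shows "f u = g u"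
proof (rule free_module_induct[where Q = "\<lambda>u. f u = g u", OF \<open>ring R\<close> u])
  show "f (\<lambda>x\<in>X. \<zero>\<^bsub>R\<^esub>) = g (\<lambda>x\<in>X. \<zero>\<^bsub>R\<^esub>)"
    using mod_hom_zero[OF f right_module_free[OF \<open>ring R\<close>] N]
      mod_hom_zero[OF g right_module_free[OF \<open>ring R\<close>] N]
    by (simp add: free_module_simps)
next
  fix v x assume v: "v \<in> carrier (free_module R X)" and x: "x \<in> X"
    and w: "v(x := \<zero>\<^bsub>R\<^esub>) \<in> carrier (free_module R X)"
    and eq': "v = v x \<odot>\<^bsub>free_module R X\<^esub> free_unit R X x \<oplus>\<^bsub>free_module R X\<^esub> v(x := \<zero>\<^bsub>R\<^esub>)"
    and IH: "f (v(x := \<zero>\<^bsub>R\<^esub>)) = g (v(x := \<zero>\<^bsub>R\<^esub>))"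
  interpret F: right_module R "free_module R X" by (rule right_module_free) fact
  have c: "v x \<in> carrier R" using v x by (auto simp: free_module_simps)
  note u = free_unit_closed[OF \<open>ring R\<close>, of X x]
  have s: "v x \<odot>\<^bsub>free_module R X\<^esub> free_unit R X x \<in> carrier (free_module R X)"
    by (rule F.smult_closed[OF c u])
  show "f v = g v"
    by (subst (1 2) eq')
      (simp add: mod_homD(2)[OF f s w] mod_homD(2)[OF g s w] mod_homD(3)[OF f c u]
        mod_homD(3)[OF g c u] eq[OF x] IH)
qed

lemma projective_free:
  fixes R :: "('a, 'r) ring_scheme" and X :: "'i set"
  assumes R: "ring R"
  shows "projective R (free_module R X)"
  unfolding projective_def
proof (intro conjI allI impI right_module_free[OF R])
  fix A :: "('a, ('i \<Rightarrow> 'a) \<Rightarrow> 'a) module" and B :: "('a, 'i \<Rightarrow> 'a) module" and g f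
  let ?F = "free_module R X"
  assume A: "right_module R A" and B: "right_module R B" and g: "g \<in> mod_epi R A B"
    and f: "f \<in> mod_hom R ?F B"
  have gh: "g \<in> mod_hom R A B" and gs: "g ` carrier A = carrier B"
    using g by (auto simp: mod_epi_def)
  have "\<forall>x \<in> X. \<exists>y. y \<in> carrier A \<and> g y = f (free_unit R X x)"
    using mod_homD(1)[OF f free_unit_closed[OF R]] unfolding gs[symmetric] image_iff by metis
  from bchoice[OF this] obtain a
    where a: "\<And>x. x \<in> X \<Longrightarrow> a x \<in> carrier A \<and> g (a x) = f (free_unit R X x)"
    by blast
  have a': "a \<in> X \<rightarrow> carrier A" using a by auto
  have h: "free_ext R X A a \<in> mod_hom R ?F A" by (rule right_module.free_ext_hom[OF A a'])
  have "g (free_ext R X A a u) = f u" if "u \<in> carrier ?F" for u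
    by (rule free_module_hom_eqI[OF R B mod_hom_comp[OF h gh] f _ that])
      (simp add: free_ext_free_unit[OF A a'] a)
  then show "\<exists>h\<in>mod_hom R ?F A. \<forall>u\<in>carrier ?F. g (h u) = f u"
    using h by blast
qed

text \<open>
  The dual basis of a projective module, in the form of a section of the free cover on its own
  carrier: the coordinates of \<open>x\<close> are the values of \<open>s x\<close>, and only finitely many are nonzero.
\<close>

lemma projective_coordinates:
  fixes R :: "('a, 'r) ring_scheme" and P :: "('a, 'p) module"
  assumes P: "projective R P"
  obtains s where "s \<in> mod_hom R P (free_module R (carrier P))"
    "free_ext R (carrier P) P (\<lambda>x. x) \<in> mod_hom R (free_module R (carrier P)) P"
    "\<And>x. x \<in> carrier P \<Longrightarrow> free_ext R (carrier P) P (\<lambda>x. x) (s x) = x"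
proof -
  interpret right_module R P by (rule projective_right_module[OF P])
  let ?p = "free_ext R (carrier P) P (\<lambda>x. x)" and ?F = "free_module R (carrier P)"
  have p: "?p \<in> mod_hom R ?F P" by (rule free_ext_hom) auto
  have "x \<in> ?p ` carrier ?F" if "x \<in> carrier P" for x
    using free_ext_unit[of "\<lambda>x. x" "carrier P" x] that by force
  then have "?p \<in> mod_epi R ?F P" using p mod_homD(1)[OF p] by (auto simp: mod_epi_def)
  from projective_split_epi[OF P right_module_free[OF R.ring_axioms] this] p that
  show ?thesis by blast
qed

lemma torsionless_submodule_power:
  fixes R :: "('a, 'r) ring_scheme" and I :: "'i set"
  assumes "ring R" and H: "submodule H R (power_module R I)"
  shows "torsionless R ((power_module R I)\<lparr>carrier := H\<rparr>)"
proof (rule torsionlessI[where J = I and F = "\<lambda>x. x"])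
  show "right_module R ((power_module R I)\<lparr>carrier := H\<rparr>)"
    by (rule right_module_submodule[OF right_module_power[OF assms(1)] H])
  show "(\<lambda>x. x) \<in> mod_hom R ((power_module R I)\<lparr>carrier := H\<rparr>) (power_module R I)"
    by (rule mod_homI) (use submoduleD(1)[OF H] in auto)
qed auto

section \<open>A projective power of the ring and principal left ideals\<close>

lemma power_UNIV_simps:
  "u \<in> carrier (power_module R UNIV) \<longleftrightarrow> (\<forall>i. u i \<in> carrier R)"
  "\<zero>\<^bsub>power_module R UNIV\<^esub> = (\<lambda>i. \<zero>\<^bsub>R\<^esub>)"
  "u \<oplus>\<^bsub>power_module R UNIV\<^esub> v = (\<lambda>i. u i \<oplus>\<^bsub>R\<^esub> v i)"
  "r \<odot>\<^bsub>power_module R UNIV\<^esub> u = (\<lambda>i. u i \<otimes>\<^bsub>R\<^esub> r)"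
  by (auto simp: power_module_simps restrict_def)

text \<open>
  A descending chain \<open>R a\<^sub>0 \<supseteq> R a\<^sub>1 \<supseteq> \<dots>\<close> of principal left ideals, given by its generators.
\<close>

locale left_principal_chain = ring R for R :: "('a, 'r) ring_scheme" (structure) +
  fixes a :: "nat \<Rightarrow> 'a"
  assumes chain_closed: "a n \<in> carrier R"
    and chain_dec: "\<exists>r\<in>carrier R. a (Suc n) = r \<otimes> a n"
begin

definition Ra :: "nat \<Rightarrow> 'a set" where "Ra n = (\<lambda>r. r \<otimes> a n) ` carrier R"

lemma Ra_closed: "x \<in> Ra n \<Longrightarrow> x \<in> carrier R"
  by (auto simp: Ra_def chain_closed)

lemma Ra_zero: "\<zero> \<in> Ra n"
  by (auto simp: Ra_def chain_closed intro!: image_eqI[of _ _ \<zero>])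

lemma Ra_add: "\<lbrakk>x \<in> Ra n; y \<in> Ra n\<rbrakk> \<Longrightarrow> x \<oplus> y \<in> Ra n"
  by (auto simp: Ra_def chain_closed l_distr[symmetric])

lemma Ra_minus: "x \<in> Ra n \<Longrightarrow> \<ominus> x \<in> Ra n"
  by (auto simp: Ra_def chain_closed l_minus[symmetric])

lemma Ra_self: "a n \<in> Ra n"
  by (auto simp: Ra_def chain_closed intro!: image_eqI[of _ _ \<one>])

lemma Ra_antimono: "m \<le> n \<Longrightarrow> Ra n \<subseteq> Ra m"
proof (induction rule: dec_induct)
  case (step n)
  obtain r where "r \<in> carrier R" "a (Suc n) = r \<otimes> a n" using chain_dec by blast
  then have "Ra (Suc n) \<subseteq> Ra n"
    by (auto simp: Ra_def chain_closed m_assoc[symmetric])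
  then show ?case using step.IH by blast
qed simp

text \<open>
  The vectors of \<open>tail level n\<close> vanish at all indices of level below \<open>n\<close>. A sum of vectors \<open>x\<^sub>n\<close> with
  \<open>x\<^sub>n\<close> in the \<open>n\<close>-th tail is thus a finite sum at each index, and defines a vector without any
  notion of convergence.
\<close>

definition tail :: "('i \<Rightarrow> nat) \<Rightarrow> nat \<Rightarrow> ('i \<Rightarrow> 'a) set"
  where "tail level n = {x. \<forall>i. x i \<in> Ra n \<and> (level i < n \<longrightarrow> x i = \<zero>)}"

lemma tail_closed: "x \<in> tail level n \<Longrightarrow> x \<in> carrier (power_module R UNIV)"
  using Ra_closed by (auto simp: tail_def power_UNIV_simps)

text \<open>
  A vector whose entries all lie in \<open>R a\<^sub>n\<close> is the product of a vector with the scalar \<open>a\<^sub>n\<close>, and this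
  form is preserved by homomorphisms.
\<close>

lemma hom_coordinate_Ra:
  assumes s: "s \<in> mod_hom R (power_module R UNIV) (free_module R X)"
    and x: "\<And>i. x i \<in> Ra n" and \<beta>: "\<beta> \<in> X"
  shows "s x \<beta> \<in> Ra n"
proof -
  have "\<forall>i. \<exists>r. r \<in> carrier R \<and> x i = r \<otimes> a n" using x unfolding Ra_def by blast
  then obtain y where y: "\<And>i. y i \<in> carrier R" "\<And>i. x i = y i \<otimes> a n" by metis
  have yc: "y \<in> carrier (power_module R UNIV)" using y by (simp add: power_UNIV_simps)
  have "x = a n \<odot>\<^bsub>power_module R UNIV\<^esub> y" using y by (auto simp: power_UNIV_simps)
  then have "s x \<beta> = s y \<beta> \<otimes> a n"
    using mod_homD(3)[OF s chain_closed yc, of n] \<beta> by (simp add: free_module_simps)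
  moreover have "s y \<beta> \<in> carrier R"
    using mod_homD(1)[OF s yc] \<beta> by (auto simp: free_module_simps)
  ultimately show ?thesis by (auto simp: Ra_def)
qed

text \<open>
  Chase's diagonal argument. If the claim fails, then for every \<open>k\<close> there are \<open>x\<^sub>k\<close> in the \<open>k\<close>-th
  tail and a coordinate \<open>b\<^sub>k\<close>, outside the supports of the images of \<open>x\<^sub>0, \<dots>, x\<^sub>k\<^sub>-\<^sub>1\<close>, at which the image
  of \<open>x\<^sub>k\<close> is not in \<open>R a\<^sub>k\<^sub>+\<^sub>1\<close>. Let \<open>y\<close> be the sum of all \<open>x\<^sub>k\<close>. At \<open>b\<^sub>k\<close> the earlier terms contribute
  \<open>0\<close> and the later ones an element of \<open>R a\<^sub>k\<^sub>+\<^sub>1\<close>, which cannot cancel the contribution of \<open>x\<^sub>k\<close>. Hence the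
  image of \<open>y\<close> has infinite support, which is impossible in a free module.
\<close>

lemma almost_all_coordinates_drop:
  fixes level :: "'i \<Rightarrow> nat"
  assumes s: "s \<in> mod_hom R (power_module R UNIV) (free_module R X)"
  shows "\<exists>n S. finite S \<and> (\<forall>x \<in> tail level n. \<forall>\<beta> \<in> X - S. s x \<beta> \<in> Ra (Suc n))"
proof (rule ccontr)
  let ?A = "power_module R (UNIV :: 'i set)"
  let ?supp = "\<lambda>u. {\<beta> \<in> X. u \<beta> \<noteq> \<zero>}"
  assume "\<not> ?thesis"
  then have "\<forall>n S. \<exists>p. finite S \<longrightarrow> fst p \<in> tail level n \<and> snd p \<in> X - S \<and> s (fst p) (snd p) \<notin> Ra (Suc n)"
    by fastforce
  then obtain p where p: "\<And>n S. finite S \<Longrightarrow> fst (p n S) \<in> tail level n \<and> snd (p n S) \<in> X - S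
      \<and> s (fst (p n S)) (snd (p n S)) \<notin> Ra (Suc n)"
    by metis
  \<comment> \<open>The set of coordinates met before stage \<open>k\<close>; the choice at stage \<open>k\<close> has to avoid it.\<close>
  define S where "S = rec_nat {} (\<lambda>k V. V \<union> ?supp (s (fst (p k V))))"
  define x where "x k = fst (p k (S k))" for k
  define b where "b k = snd (p k (S k))" for k
  have S0: "S 0 = {}" and SS: "S (Suc k) = S k \<union> ?supp (s (x k))" for k
    by (simp_all add: S_def x_def)
  have sc: "s u \<beta> \<in> carrier R" "finite (?supp (s u))" if "u \<in> carrier ?A" "\<beta> \<in> X" for u \<beta>
    using mod_homD(1)[OF s that(1)] that(2) by (auto simp: free_module_simps)
  have finsupp: "finite (?supp (s u))" if "u \<in> carrier ?A" for u
    using mod_homD(1)[OF s that(1)] by (auto simp: free_module_simps)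
  have sadd: "s (\<lambda>i. u i \<oplus> v i) \<beta> = s u \<beta> \<oplus> s v \<beta>"
    if "u \<in> carrier ?A" "v \<in> carrier ?A" "\<beta> \<in> X" for u v \<beta>
    using mod_homD(2)[OF s that(1,2)] that(3) by (simp add: free_module_simps power_UNIV_simps)
  have finS: "finite (S k)" for k
  proof (induction k)
    case (Suc k)
    then show ?case using finsupp[OF tail_closed, of "x k" level k] p[OF Suc, of k] by (simp add: SS x_def)
  qed (simp add: S0)
  have xt: "x k \<in> tail level k" and bX: "b k \<in> X" "b k \<notin> S k" and sxb: "s (x k) (b k) \<notin> Ra (Suc k)" for k
    using p[OF finS, of k k] by (auto simp: x_def b_def)
  have xc: "x k \<in> carrier ?A" for k by (rule tail_closed[OF xt])
  have xL: "x k i \<in> Ra k" and x0: "level i < k \<Longrightarrow> x k i = \<zero>" for k i using xt[of k] by (auto simp: tail_def)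
  have xR: "x k i \<in> carrier R" for k i by (rule Ra_closed[OF xL])
  have Smono: "j \<le> k \<Longrightarrow> S j \<subseteq> S k" for j k by (rule lift_Suc_mono_le[of S]) (auto simp: SS)
  \<comment> \<open>The partial sums. At a fixed index they are constant from some stage on, and \<open>y\<close> is their limit.\<close>
  define w where "w = rec_nat (\<lambda>i. \<zero>) (\<lambda>k v i. v i \<oplus> x k i)"
  have w0: "w 0 = (\<lambda>i. \<zero>)" and wS: "w (Suc k) = (\<lambda>i. w k i \<oplus> x k i)" for k
    by (simp_all add: w_def)
  have wR: "w k i \<in> carrier R" for k i by (induction k) (simp_all add: w0 wS xR)
  have wc: "w k \<in> carrier ?A" for k using wR by (simp add: power_UNIV_simps)
  have sw: "s (w k) \<beta> = \<zero>" if "\<beta> \<in> X" "\<beta> \<notin> S k" for k \<beta>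
    using that(2)
  proof (induction k)
    case 0
    show ?case
      using mod_hom_zero[OF s right_module_power[OF ring_axioms] right_module_free[OF ring_axioms]] that(1)
      by (simp add: w0 power_UNIV_simps free_module_simps)
  next
    case (Suc k)
    then show ?case using that(1) by (simp add: wS SS sadd[OF wc xc])
  qed
  define y where "y i = w (Suc (level i)) i" for i
  have yc: "y \<in> carrier ?A" using wR by (simp add: power_UNIV_simps y_def)
  have diff: "\<exists>l \<in> Ra k. w m i = w k i \<oplus> l" if "k \<le> m" for k m i
    using that
  proof (induction rule: dec_induct)
    case base
    show ?case using Ra_zero wR by (intro bexI[of _ \<zero>]) auto
  next
    case (step m)
    then obtain l where l: "l \<in> Ra k" "w m i = w k i \<oplus> l" by blast
    have "x m i \<in> Ra k" using xL Ra_antimono step by blast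
    then show ?case using l wR xR
      by (intro bexI[of _ "l \<oplus> x m i"]) (auto simp: wS a_assoc Ra_closed Ra_add)
  qed
  have stab: "w m i = y i" if "level i < m" for m i
    using Suc_leI[OF that]
  proof (induction rule: dec_induct)
    case (step m)
    then show ?case using wR by (simp add: wS[of m] x0 y_def)
  qed (simp add: y_def)
  have "\<exists>l \<in> Ra k. y i = w k i \<oplus> l" for k i
  proof (cases "level i < k")
    case True
    have "y i \<in> carrier R" using wR by (simp add: y_def)
    then show ?thesis using stab[OF True] Ra_zero by (intro bexI[of _ \<zero>]) auto
  next
    case False
    then show ?thesis using diff[of k "Suc (level i)" i] by (simp add: y_def)
  qed
  then obtain z where z: "\<And>k i. z k i \<in> Ra k" "\<And>k i. y i = w k i \<oplus> z k i" by metis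
  have zc: "z k \<in> carrier ?A" for k using Ra_closed[OF z(1)] by (simp add: power_UNIV_simps)
  have "s y (b k) \<noteq> \<zero>" for k
  proof
    assume 0: "s y (b k) = \<zero>"
    have "y = (\<lambda>i. w (Suc k) i \<oplus> z (Suc k) i)" by (rule ext) (rule z(2))
    then have "s y (b k) = (s (w k) (b k) \<oplus> s (x k) (b k)) \<oplus> s (z (Suc k)) (b k)"
      using sadd[OF wc[of "Suc k"] zc[of "Suc k"] bX(1)[of k]] sadd[OF wc[of k] xc[of k] bX(1)[of k]]
      by (simp add: wS)
    then have "s (x k) (b k) \<oplus> s (z (Suc k)) (b k) = \<zero>"
      using 0 sw[OF bX, of k] sc(1)[OF xc[of k] bX(1)[of k]] by simp
    then have "s (x k) (b k) = \<ominus> s (z (Suc k)) (b k)"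
      using minus_equality[OF _ sc(1)[OF zc[of "Suc k"] bX(1)[of k]] sc(1)[OF xc[of k] bX(1)[of k]]] by simp
    moreover have "s (z (Suc k)) (b k) \<in> Ra (Suc k)"
      by (rule hom_coordinate_Ra[OF s z(1) bX(1)])
    ultimately show False
      using sxb[of k] Ra_minus by simp
  qed
  then have "range b \<subseteq> ?supp (s y)" using bX by auto
  then have "finite (range b)" using finsupp[OF yc] finite_subset by blast
  moreover have "inj b"
  proof (rule linorder_injI)
    fix j k :: nat assume "j < k"
    have "s (x j) (b j) \<noteq> \<zero>" using sxb[of j] Ra_zero[of "Suc j"] by metis
    then have "b j \<in> S (Suc j)" using bX by (simp add: SS)
    then have "b j \<in> S k" using Smono[of "Suc j" k] \<open>j < k\<close> by auto
    then show "b j \<noteq> b k" using bX by metis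
  qed
  ultimately show False using finite_imageD[of b UNIV] by simp
qed

text \<open>
  The indices are lists over \<open>'a\<close> because this type is infinite, is graded by length with each set of
  lists of length at least \<open>n\<close> as large as the type itself, and contains all tuples of elements of
  \<open>R\<close>. The last property makes the list of the finitely many critical coordinates of a vector a code
  in the index type, so that the indicator vectors of sets of indices would embed the power set of
  the index type in the type.
\<close>

lemma chain_stabilises:
  assumes P: "projective R (power_module R (UNIV :: 'a list set))"
  shows "\<exists>n. \<exists>r \<in> carrier R. a n = r \<otimes> a (Suc n)"
proof (rule ccontr)
  assume strict: "\<not> ?thesis"
  then have strict: "a n \<notin> Ra (Suc n)" for n by (auto simp: Ra_def)
  let ?A = "power_module R (UNIV :: 'a list set)"
  let ?X = "carrier ?A"
  let ?F = "free_module R ?X" and ?p = "free_ext R ?X ?A (\<lambda>x. x)"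
  obtain s where s: "s \<in> mod_hom R ?A ?F" and p: "?p \<in> mod_hom R ?F ?A"
    and ps: "\<And>x. x \<in> ?X \<Longrightarrow> ?p (s x) = x"
    using projective_coordinates[OF P] by blast
  interpret A: right_module R ?A by (rule right_module_power) (rule ring_axioms)
  interpret F: right_module R ?F by (rule right_module_free) (rule ring_axioms)
  obtain n S where S: "finite S"
    and drop: "\<And>x \<beta>. \<lbrakk>x \<in> tail length n; \<beta> \<in> ?X - S\<rbrakk> \<Longrightarrow> s x \<beta> \<in> Ra (Suc n)"
    using almost_all_coordinates_drop[OF s, of length] by blast
  obtain bs where bs: "set bs = S" using finite_list[OF S] by blast
  \<comment> \<open>Prefixing \<open>n\<close> entries moves every index to level at least \<open>n\<close>, where the \<open>n\<close>-th tail is unrestricted.\<close>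
  define shift :: "'a list \<Rightarrow> 'a list" where "shift ys = replicate n \<zero> @ ys" for ys
  have shift: "inj shift" "\<not> length (shift ys) < n" for ys by (auto simp: shift_def inj_on_def)
  define x where "x T i = (if i \<in> shift ` T then a n else \<zero>)" for T i
  have xt: "x T \<in> tail length n" for T using shift by (auto simp: tail_def x_def Ra_self Ra_zero)
  have xR: "x T i \<in> carrier R" for T i by (simp add: x_def chain_closed)
  define code where "code T = map (\<lambda>\<beta>. s (x T) \<beta>) bs" for T
  have "inj code"
  proof (rule injI)
    fix T T' assume eq: "code T = code T'"
    define d where "d i = x T i \<ominus> x T' i" for i
    have dA: "d = x T \<oplus>\<^bsub>?A\<^esub> \<ominus>\<^bsub>?A\<^esub> x T'"
    proof -
      have "\<ominus>\<^bsub>?A\<^esub> x T' = (\<lambda>i. \<ominus> x T' i)"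
        by (rule A.M.minus_equality) (auto simp: power_UNIV_simps xR l_neg)
      then show ?thesis by (auto simp: d_def power_UNIV_simps a_minus_def)
    qed
    have dt: "d \<in> tail length n"
      using xt[of T] xt[of T'] by (auto simp: tail_def d_def a_minus_def Ra_add Ra_minus)
    have dc: "d \<in> ?X" by (rule tail_closed[OF dt])
    have sd: "s d \<beta> \<in> Ra (Suc n)" if \<beta>: "\<beta> \<in> ?X" for \<beta>
    proof (cases "\<beta> \<in> S")
      case False
      then show ?thesis using drop[OF dt] \<beta> by blast
    next
      case True
      then have eq\<beta>: "s (x T) \<beta> = s (x T') \<beta>" using eq bs by (auto simp: code_def)
      note hom = mod_hom_comp[OF s eval_hom_free[OF \<beta>]]
      note reg = right_module_regular[OF ring_axioms]
      interpret reg: right_module R "regular_module R" by (rule reg)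
      have c: "x T \<in> ?X" "x T' \<in> ?X" using xt tail_closed by blast+
      have "s d \<beta> = s (x T) \<beta> \<oplus>\<^bsub>regular_module R\<^esub> s (\<ominus>\<^bsub>?A\<^esub> x T') \<beta>"
        unfolding dA using mod_homD(2)[OF hom c(1), of "\<ominus>\<^bsub>?A\<^esub> x T'"] c by simp
      also have "\<dots> = \<zero>\<^bsub>regular_module R\<^esub>"
        using mod_hom_minus[OF hom A.right_module_axioms reg c(2)] mod_homD(1)[OF hom c(2)] eq\<beta>
        by (simp add: reg.M.r_neg)
      finally show ?thesis by (simp add: regular_module_simps Ra_zero)
    qed
    have sdc: "s d \<in> carrier ?F" by (rule mod_homD(1)[OF s dc])
    \<comment> \<open>The quotients by \<open>a (Suc n)\<close> are chosen as \<open>0\<close> wherever possible, to keep their support finite.\<close>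
    have "\<forall>\<beta>. \<exists>r. \<beta> \<in> ?X \<longrightarrow> r \<in> carrier R \<and> s d \<beta> = r \<otimes> a (Suc n) \<and> (s d \<beta> = \<zero> \<longrightarrow> r = \<zero>)"
    proof
      fix \<beta>
      show "\<exists>r. \<beta> \<in> ?X \<longrightarrow> r \<in> carrier R \<and> s d \<beta> = r \<otimes> a (Suc n) \<and> (s d \<beta> = \<zero> \<longrightarrow> r = \<zero>)"
        using sd[of \<beta>] unfolding Ra_def image_iff
        by (cases "s d \<beta> = \<zero>") (metis l_null chain_closed zero_closed, metis)
    qed
    then obtain v where v: "\<And>\<beta>. \<beta> \<in> ?X \<Longrightarrow> v \<beta> \<in> carrier R \<and> s d \<beta> = v \<beta> \<otimes> a (Suc n) \<and>
        (s d \<beta> = \<zero> \<longrightarrow> v \<beta> = \<zero>)"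
      by metis
    define u where "u = restrict v ?X"
    have "finite {\<beta> \<in> ?X. u \<beta> \<noteq> \<zero>}"
      by (rule finite_subset[of _ "{\<beta> \<in> ?X. s d \<beta> \<noteq> \<zero>}"])
        (use v sdc in \<open>auto simp: u_def free_module_simps\<close>)
    then have uF: "u \<in> carrier ?F" using v by (auto simp: free_module_simps u_def)
    have "s d = a (Suc n) \<odot>\<^bsub>?F\<^esub> u"
      using v sdc by (intro extensionalityI[of _ ?X]) (auto simp: free_module_simps u_def PiE_def)
    then have "d = a (Suc n) \<odot>\<^bsub>?A\<^esub> ?p u"
      using ps[OF dc] mod_homD(3)[OF p chain_closed uF, of "Suc n"] by simp
    then have dL: "d i \<in> Ra (Suc n)" for i
      using mod_homD(1)[OF p uF] by (auto simp: power_UNIV_simps Ra_def)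
    show "T = T'"
    proof (rule ccontr)
      assume "T \<noteq> T'"
      then obtain t where "t \<in> T \<longleftrightarrow> t \<notin> T'" by blast
      then have "d (shift t) = a n \<or> d (shift t) = \<ominus> a n"
        by (auto simp: d_def x_def inj_image_mem_iff[OF shift(1)] a_minus_def chain_closed)
      then have "a n \<in> Ra (Suc n)"
        using dL[of "shift t"] Ra_minus[of "d (shift t)" "Suc n"] by (auto simp: chain_closed)
      then show False using strict by blast
    qed
  qed
  then have "inv_into UNIV code ` UNIV = Pow UNIV" using inj_imp_surj_inv by auto
  then show False using Cantors_theorem by blast
qed

end

section \<open>Primitive idempotents\<close>

text \<open>
  A projective cyclic module is a direct summand of the ring, and \<open>c\<close> is an idempotent that generates
  this summand: the splitting maps the generator \<open>g \<one>\<close> to \<open>c\<close>.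
\<close>

lemma epi_from_ring_idempotent:
  fixes R :: "('a, 'r) ring_scheme" (structure) and N :: "('a, 'n) module"
  assumes "ring R" and N: "projective R N" and g: "g \<in> mod_epi R (regular_module R) N"
  shows "\<exists>c \<in> carrier R. g c = g \<one> \<and> (\<forall>x \<in> carrier R. g x = \<zero>\<^bsub>N\<^esub> \<longrightarrow> c \<otimes> x = \<zero>)"
proof -
  interpret ring R by fact
  note reg = right_module_regular[OF \<open>ring R\<close>]
  have gh: "g \<in> mod_hom R (regular_module R) N" using g by (simp add: mod_epi_def)
  note gD = mod_homD[OF gh, unfolded regular_module_simps]
  obtain s where s: "s \<in> mod_hom R N (regular_module R)" and gs: "\<And>x. x \<in> carrier N \<Longrightarrow> g (s x) = x"
    using projective_split_epi[OF N reg g] by blast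
  note sD = mod_homD[OF s, unfolded regular_module_simps]
  have "s (g \<one>) \<otimes> x = \<zero>" if "x \<in> carrier R" "g x = \<zero>\<^bsub>N\<^esub>" for x
  proof -
    have "s (g \<one>) \<otimes> x = s (x \<odot>\<^bsub>N\<^esub> g \<one>)" using sD(3) gD(1) that by simp
    also have "\<dots> = s (g x)" using gD(3)[of x \<one>] that by simp
    also have "\<dots> = \<zero>"
      using mod_hom_zero[OF s projective_right_module[OF N] reg] that by (simp add: regular_module_simps)
    finally show ?thesis .
  qed
  then show ?thesis using sD(1) gD(1) gs by (intro bexI[of _ "s (g \<one>)"]) auto
qed

context ring
begin

lemma eq_of_minus_eq_zero:
  assumes "x \<in> carrier R" "y \<in> carrier R" "x \<ominus> y = \<zero>"
  shows "x = y"
  using minus_equality[of x "\<ominus> y"] assms by (simp add: minus_eq)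

definition idempotent :: "'a \<Rightarrow> bool"
  where "idempotent e \<longleftrightarrow> e \<in> carrier R \<and> e \<otimes> e = e"

definition primitive :: "'a \<Rightarrow> bool"
  where "primitive e \<longleftrightarrow> idempotent e \<and> e \<noteq> \<zero> \<and>
    (\<forall>f. idempotent f \<and> f \<otimes> e = f \<and> e \<otimes> f = f \<longrightarrow> f = \<zero> \<or> f = e)"

definition left_principal_dcc :: bool
  where "left_principal_dcc \<longleftrightarrow>
    (\<forall>a :: nat \<Rightarrow> 'a. (\<forall>n. a n \<in> carrier R \<and> (\<exists>r \<in> carrier R. a (Suc n) = r \<otimes> a n)) \<longrightarrow>
      (\<exists>n. \<exists>r \<in> carrier R. a n = r \<otimes> a (Suc n)))"

text \<open>
  The element \<open>c\<close> is an idempotent, and the right annihilator of \<open>a\<close> is \<open>(1 - c) R\<close>. Equivalently, all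
  principal right ideals are projective.
\<close>

definition right_rickart :: bool
  where "right_rickart \<longleftrightarrow>
    (\<forall>a \<in> carrier R. \<exists>c \<in> carrier R. a \<otimes> c = a \<and> (\<forall>x \<in> carrier R. a \<otimes> x = \<zero> \<longrightarrow> c \<otimes> x = \<zero>))"

text \<open>
  Strictly descending idempotents generate strictly descending principal left ideals: if \<open>e = r f\<close>
  then \<open>e f = e\<close>, while \<open>e f = f\<close> for \<open>f\<close> below \<open>e\<close>.
\<close>

lemma wf_idempotents:
  assumes left_principal_dcc
  shows "wf {(f, e). idempotent f \<and> idempotent e \<and> f \<otimes> e = f \<and> e \<otimes> f = f \<and> f \<noteq> e}"
  unfolding wf_iff_no_infinite_down_chain
proof
  assume "\<exists>e. \<forall>i. (e (Suc i), e i) \<in> {(f, e). idempotent f \<and> idempotent e \<and> f \<otimes> e = f \<and> e \<otimes> f = f \<and> f \<noteq> e}"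
  then obtain e where e: "\<And>i. idempotent (e i)"
    "\<And>i. e (Suc i) \<otimes> e i = e (Suc i)" "\<And>i. e i \<otimes> e (Suc i) = e (Suc i)" "\<And>i. e (Suc i) \<noteq> e i"
    by auto
  have ec: "e i \<in> carrier R" "e i \<otimes> e i = e i" for i using e(1) by (auto simp: idempotent_def)
  have "\<forall>n. e n \<in> carrier R \<and> (\<exists>r \<in> carrier R. e (Suc n) = r \<otimes> e n)" using ec e(2) by metis
  then obtain n r where r: "r \<in> carrier R" "e n = r \<otimes> e (Suc n)"
    using assms unfolding left_principal_dcc_def by blast
  have "e n \<otimes> e (Suc n) = r \<otimes> (e (Suc n) \<otimes> e (Suc n))"
    using r ec(1) m_assoc by simp
  then have "e n \<otimes> e (Suc n) = e n" using r(2) ec(2) by simp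
  then show False using e(3,4) by metis
qed

text \<open>
  An idempotent that is neither zero nor primitive is the sum of two strictly smaller orthogonal ones,
  which are decomposed by well-founded induction; their parts remain orthogonal across the two sides.
\<close>

lemma primitive_decomposition:
  assumes dcc: left_principal_dcc and "idempotent e"
  shows "\<exists>E. finite E \<and> (\<forall>f \<in> E. primitive f \<and> f \<otimes> e = f \<and> e \<otimes> f = f) \<and>
    (\<forall>f \<in> E. \<forall>g \<in> E. f \<noteq> g \<longrightarrow> f \<otimes> g = \<zero>) \<and> (\<Oplus>f\<in>E. f) = e"
  using wf_idempotents[OF dcc] \<open>idempotent e\<close>
proof (induction e rule: wf_induct_rule)
  case (less e)
  have e: "e \<in> carrier R" "e \<otimes> e = e" using less.prems by (auto simp: idempotent_def)
  consider "e = \<zero>" | "primitive e" | "e \<noteq> \<zero>" "\<not> primitive e" by blast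
  then show ?case
  proof cases
    case 1
    then show ?thesis by (intro exI[of _ "{}"]) simp
  next
    case 2
    then show ?thesis using e by (intro exI[of _ "{e}"]) simp
  next
    case 3
    then obtain f where f: "idempotent f" "f \<otimes> e = f" "e \<otimes> f = f" "f \<noteq> \<zero>" "f \<noteq> e"
      using less.prems by (auto simp: primitive_def)
    have fc: "f \<in> carrier R" "f \<otimes> f = f" using f(1) by (auto simp: idempotent_def)
    define g where "g = e \<ominus> f"
    have gc: "g \<in> carrier R" and eg: "e = f \<oplus> g"
      using e fc by (auto simp: g_def minus_eq a_assoc a_comm a_lcomm l_neg r_neg)
    have g: "g \<otimes> e = g" "e \<otimes> g = g" "f \<otimes> g = \<zero>" "g \<otimes> f = \<zero>"
      using e fc f by (auto simp: g_def minus_eq l_distr r_distr l_minus r_minus r_neg)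
    have gg: "g \<otimes> g = g"
      using g(2)[unfolded eg] fc gc g(3) by (simp add: l_distr)
    have ig: "idempotent g" using gc gg by (simp add: idempotent_def)
    have ge: "g \<noteq> e" using g(3) f by auto
    obtain A where A: "finite A" "\<forall>x\<in>A. primitive x \<and> x \<otimes> f = x \<and> f \<otimes> x = x"
      "\<forall>x\<in>A. \<forall>y\<in>A. x \<noteq> y \<longrightarrow> x \<otimes> y = \<zero>" "(\<Oplus>x\<in>A. x) = f"
      using less.IH[of f] f less.prems by auto
    obtain B where B: "finite B" "\<forall>x\<in>B. primitive x \<and> x \<otimes> g = x \<and> g \<otimes> x = x"
      "\<forall>x\<in>B. \<forall>y\<in>B. x \<noteq> y \<longrightarrow> x \<otimes> y = \<zero>" "(\<Oplus>x\<in>B. x) = g"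
      using less.IH[of g] g ig ge less.prems by auto
    have Ac: "x \<in> carrier R" "x \<otimes> x = x" "x \<noteq> \<zero>" if "x \<in> A" for x
      using A(2) that by (auto simp: primitive_def idempotent_def)
    have Bc: "x \<in> carrier R" "x \<otimes> x = x" "x \<noteq> \<zero>" if "x \<in> B" for x
      using B(2) that by (auto simp: primitive_def idempotent_def)
    have xy: "x \<otimes> y = \<zero>" "y \<otimes> x = \<zero>" if "x \<in> A" "y \<in> B" for x y
    proof -
      have "x \<otimes> y = (x \<otimes> f) \<otimes> (g \<otimes> y)" "y \<otimes> x = (y \<otimes> g) \<otimes> (f \<otimes> x)"
        using A(2) B(2) that by auto
      moreover have "(x \<otimes> f) \<otimes> (g \<otimes> y) = x \<otimes> ((f \<otimes> g) \<otimes> y)" "(y \<otimes> g) \<otimes> (f \<otimes> x) = y \<otimes> ((g \<otimes> f) \<otimes> x)"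
        using Ac[OF that(1)] Bc[OF that(2)] fc gc by (simp_all add: m_assoc)
      ultimately show "x \<otimes> y = \<zero>" "y \<otimes> x = \<zero>"
        using g Ac[OF that(1)] Bc[OF that(2)] by simp_all
    qed
    have disj: "A \<inter> B = {}" using xy Ac by force
    have "(\<Oplus>x\<in>A \<union> B. x) = e"
      using finsum_Un_disjoint[OF A(1) B(1) disj, of "\<lambda>x. x"] A(4) B(4) Ac Bc eg by auto
    moreover have "x \<otimes> e = x \<and> e \<otimes> x = x" if "x \<in> A" for x
    proof -
      have x: "x = x \<otimes> f" "x = f \<otimes> x" using A(2) that by auto
      have "x \<otimes> f \<otimes> e = x \<otimes> (f \<otimes> e)" "e \<otimes> (f \<otimes> x) = (e \<otimes> f) \<otimes> x"
        using Ac[OF that] e fc by (simp_all add: m_assoc)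
      then show ?thesis using x[symmetric] f by simp
    qed
    moreover have "x \<otimes> e = x \<and> e \<otimes> x = x" if "x \<in> B" for x
    proof -
      have x: "x = x \<otimes> g" "x = g \<otimes> x" using B(2) that by auto
      have "x \<otimes> g \<otimes> e = x \<otimes> (g \<otimes> e)" "e \<otimes> (g \<otimes> x) = (e \<otimes> g) \<otimes> x"
        using Bc[OF that] e gc by (simp_all add: m_assoc)
      then show ?thesis using x[symmetric] g by simp
    qed
    ultimately show ?thesis
      using A B xy by (intro exI[of _ "A \<union> B"]) blast
  qed
qed

text \<open>
  Left multiplication by \<open>a\<close> is a map out of \<open>fR\<close> with projective image, so its kernel is a direct
  summand of \<open>fR\<close>. As \<open>f\<close> is primitive and the map is nonzero, the kernel is zero.
\<close>

lemma primitive_left_cancel: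
  assumes rick: right_rickart and f: "primitive f" and a: "a \<in> carrier R" "a \<otimes> f = a" "a \<noteq> \<zero>"
    and x: "x \<in> carrier R" "a \<otimes> x = \<zero>"
  shows "f \<otimes> x = \<zero>"
proof -
  obtain c where c: "c \<in> carrier R" "a \<otimes> c = a"
    and "\<forall>x \<in> carrier R. a \<otimes> x = \<zero> \<longrightarrow> c \<otimes> x = \<zero>"
    using bspec[OF rick[unfolded right_rickart_def] a(1)] by (elim bexE conjE) (rule that)
  then have ann: "c \<otimes> x = \<zero>" if "x \<in> carrier R" "a \<otimes> x = \<zero>" for x using that by blast
  have fc: "f \<in> carrier R" "f \<otimes> f = f" using f by (auto simp: primitive_def idempotent_def)
  have cmp: "c \<otimes> y = c \<otimes> z" if "y \<in> carrier R" "z \<in> carrier R" "a \<otimes> y = a \<otimes> z" for y z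
  proof -
    have "c \<otimes> (y \<ominus> z) = \<zero>"
    proof (rule ann)
      have "a \<otimes> (y \<ominus> z) = a \<otimes> y \<ominus> a \<otimes> z"
        using that(1,2) a(1) by (simp add: minus_eq r_distr r_minus)
      then show "a \<otimes> (y \<ominus> z) = \<zero>"
        using that a(1) by (simp add: minus_eq r_neg)
    qed (use that in simp)
    then have "c \<otimes> y \<ominus> c \<otimes> z = \<zero>"
      using that(1,2) c(1) by (simp add: minus_eq r_distr r_minus)
    then show ?thesis using that c(1) by (elim eq_of_minus_eq_zero[rotated 2]) simp_all
  qed
  have cf: "c \<otimes> f = c" using cmp[of f \<one>] fc a c by simp
  have cc: "c \<otimes> c = c" using cmp[of c \<one>] a c by simp
  \<comment> \<open>The idempotent \<open>c\<close> need not lie in \<open>fRf\<close>, but \<open>f c\<close> does, and it serves as well.\<close>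
  define d where "d = f \<otimes> c"
  have dc: "d \<in> carrier R" using fc c by (simp add: d_def)
  have fd: "f \<otimes> d = d" using fc c by (simp add: d_def m_assoc[symmetric])
  have df: "d \<otimes> f = d" using fc c cf by (simp add: d_def m_assoc)
  have "d \<otimes> d = f \<otimes> ((c \<otimes> f) \<otimes> c)" using fc c by (simp add: d_def m_assoc)
  then have "d \<otimes> d = d" by (simp add: cf cc d_def)
  moreover have "a \<otimes> d = a" using a fc c by (simp add: d_def m_assoc[symmetric])
  then have "d \<noteq> \<zero>" using a by auto
  ultimately have "d = f" using f dc fd df by (auto simp: primitive_def idempotent_def)
  then have "f \<otimes> x = f \<otimes> (c \<otimes> x)" using fc c x by (simp add: d_def m_assoc[symmetric])
  then show ?thesis using ann x fc by simp
qed

text \<open>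
  The powers of \<open>a\<close> are nonzero by cancellation, and the chain of the left ideals that they generate
  stabilises: \<open>b = r a b\<close> for some power \<open>b\<close> of \<open>a\<close>. Then \<open>e - e r a\<close> annihilates \<open>b\<close> from the left, so
  it is zero: otherwise it could be cancelled, and \<open>b\<close> would be zero.
\<close>

lemma primitive_left_inverse:
  assumes rick: right_rickart and dcc: left_principal_dcc
    and e: "primitive e" and a: "a \<in> carrier R" "a \<otimes> e = a" "e \<otimes> a = a" "a \<noteq> \<zero>"
  shows "\<exists>u \<in> carrier R. e \<otimes> u = u \<and> u \<otimes> e = u \<and> u \<otimes> a = e"
proof -
  have ec: "e \<in> carrier R" "e \<otimes> e = e" "e \<noteq> \<zero>" using e by (auto simp: primitive_def idempotent_def)
  define b where "b n = a [^] Suc n" for n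
  have b: "b n \<in> carrier R \<and> e \<otimes> b n = b n \<and> b n \<noteq> \<zero> \<and> b (Suc n) = a \<otimes> b n" for n
  proof (induction n)
    case 0
    then show ?case using a by (simp add: b_def)
  next
    case (Suc n)
    have 1: "b (Suc k) = a \<otimes> b k" for k
      unfolding b_def by (rule nat_pow_Suc2[OF a(1)])
    have "a \<otimes> b n \<noteq> \<zero>"
      using primitive_left_cancel[OF rick e a(1,2,4), of "b n"] Suc by auto
    then show ?case using Suc a ec 1 by (simp add: m_assoc[symmetric])
  qed
  have bc: "b n \<in> carrier R" and eb: "e \<otimes> b n = b n" and b0: "b n \<noteq> \<zero>" and bS: "b (Suc n) = a \<otimes> b n" for n
    using b by blast+
  have "\<exists>n. \<exists>r \<in> carrier R. b n = r \<otimes> b (Suc n)"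
    using dcc a(1) bc bS unfolding left_principal_dcc_def by metis
  then obtain n r where r: "r \<in> carrier R" "b n = r \<otimes> (a \<otimes> b n)" unfolding bS by blast
  define q where "q = e \<ominus> e \<otimes> r \<otimes> a"
  have qc: "q \<in> carrier R" using ec r(1) a by (simp add: q_def)
  have qe: "q \<otimes> e = q" using ec r(1) a by (simp add: q_def minus_eq l_distr l_minus m_assoc)
  have "q \<otimes> b n = e \<otimes> b n \<ominus> e \<otimes> (r \<otimes> (a \<otimes> b n))"
    using ec r(1) a bc by (simp add: q_def minus_eq l_distr l_minus m_assoc)
  then have qb: "q \<otimes> b n = \<zero>" using r(2)[symmetric] ec bc by (simp add: minus_eq r_neg)
  have "q = \<zero>"
    using primitive_left_cancel[OF rick e qc qe _ bc qb] eb b0 by metis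
  then have era: "e = e \<otimes> r \<otimes> a"
    using ec r(1) a(1) unfolding q_def by (elim eq_of_minus_eq_zero[rotated 2]) simp_all
  have "(e \<otimes> r \<otimes> e) \<otimes> a = e \<otimes> r \<otimes> a"
    using ec r(1) a by (simp add: m_assoc)
  then have "(e \<otimes> r \<otimes> e) \<otimes> a = e" by (simp only: era[symmetric])
  moreover have "e \<otimes> (e \<otimes> r \<otimes> e) = e \<otimes> r \<otimes> e" "(e \<otimes> r \<otimes> e) \<otimes> e = e \<otimes> r \<otimes> e"
    using ec r(1) by (simp_all add: m_assoc) (simp add: m_assoc[symmetric])
  ultimately show ?thesis using ec(1) r(1) by (intro bexI[of _ "e \<otimes> r \<otimes> e"]) auto
qed

text \<open>
  A left inverse of a nonzero element is itself nonzero and hence left invertible, which makes it an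
  inverse on both sides.
\<close>

lemma primitive_corner_division:
  assumes rick: right_rickart and dcc: left_principal_dcc
    and e: "primitive e" and a: "a \<in> carrier R" "a \<otimes> e = a" "e \<otimes> a = a" "a \<noteq> \<zero>"
  shows "\<exists>u \<in> carrier R. e \<otimes> u = u \<and> u \<otimes> e = u \<and> a \<otimes> u = e"
proof -
  have ec: "e \<in> carrier R" "e \<noteq> \<zero>" using e by (auto simp: primitive_def idempotent_def)
  obtain u where u: "u \<in> carrier R" "e \<otimes> u = u" "u \<otimes> e = u" "u \<otimes> a = e"
    using primitive_left_inverse[OF assms] by blast
  have "u \<noteq> \<zero>" using u(4) ec a by auto
  then obtain v where v: "v \<in> carrier R" "e \<otimes> v = v" "v \<otimes> e = v" "v \<otimes> u = e"
    using primitive_left_inverse[OF rick dcc e u(1,3,2)] by blast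
  have "a = (v \<otimes> u) \<otimes> a" using v a by simp
  also have "\<dots> = v \<otimes> (u \<otimes> a)" using u v a by (intro m_assoc)
  also have "\<dots> = v" using u v by simp
  finally show ?thesis using u v by blast
qed

end

section \<open>Projective covers from a decomposition of the identity\<close>

text \<open>
  The structure extracted from the chain condition and the Rickart property: an orthogonal
  decomposition of \<open>1\<close> such that the corners \<open>eRe\<close> are division rings and nonzero maps from the
  modules \<open>eR\<close> to the ring are injective.
\<close>

locale corner_division_ring = ring R for R :: "('a, 'r) ring_scheme" (structure) +
  fixes E :: "'a set"
  assumes finE: "finite E"
    and E_closed: "e \<in> E \<Longrightarrow> e \<in> carrier R"
    and E_idem: "e \<in> E \<Longrightarrow> e \<otimes> e = e"
    and E_nonzero: "e \<in> E \<Longrightarrow> e \<noteq> \<zero>"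
    and E_orth: "\<lbrakk>e \<in> E; f \<in> E; e \<noteq> f\<rbrakk> \<Longrightarrow> e \<otimes> f = \<zero>"
    and E_sum: "(\<Oplus>e\<in>E. e) = \<one>"
    and corner_inverse: "\<lbrakk>e \<in> E; a \<in> carrier R; a \<otimes> e = a; e \<otimes> a = a; a \<noteq> \<zero>\<rbrakk> \<Longrightarrow>
      \<exists>u \<in> carrier R. a \<otimes> u = e"
    and left_cancel: "\<lbrakk>f \<in> E; a \<in> carrier R; a \<otimes> f = a; a \<noteq> \<zero>; x \<in> carrier R; a \<otimes> x = \<zero>\<rbrakk> \<Longrightarrow>
      f \<otimes> x = \<zero>"
begin

text \<open>
  The Jacobson radical: an element \<open>x\<close> lies outside of \<open>J\<close> exactly if left multiplication by some
  \<open>e x\<close> maps \<open>R\<close> onto \<open>eR\<close>.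
\<close>

definition J :: "'a set" where "J = {x \<in> carrier R. \<forall>e \<in> E. \<forall>r \<in> carrier R. e \<otimes> x \<otimes> r \<noteq> e}"

lemma J_closed: "x \<in> J \<Longrightarrow> x \<in> carrier R" by (simp add: J_def)

lemma J_zero: "\<zero> \<in> J"
proof -
  have "e \<otimes> \<zero> \<otimes> r \<noteq> e" if "e \<in> E" "r \<in> carrier R" for e r
    using E_nonzero[OF that(1)] E_closed[OF that(1)] that(2) by simp
  then show ?thesis by (simp add: J_def)
qed

lemma J_r_mult:
  assumes "x \<in> J" "s \<in> carrier R"
  shows "x \<otimes> s \<in> J"
proof -
  have xc: "x \<in> carrier R" using assms J_closed by simp
  have "e \<otimes> (x \<otimes> s) \<otimes> r \<noteq> e" if "e \<in> E" "r \<in> carrier R" for e r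
  proof -
    have "e \<otimes> (x \<otimes> s) \<otimes> r = e \<otimes> x \<otimes> (s \<otimes> r)" using that assms xc E_closed by (simp add: m_assoc)
    then show ?thesis using that assms by (simp add: J_def)
  qed
  then show ?thesis using assms xc by (simp add: J_def)
qed

text \<open>
  A nonzero element of the division ring \<open>eRe\<close> has an inverse, which would exhibit \<open>x\<close> as an element
  outside of \<open>J\<close>.
\<close>

lemma J_corner_zero:
  assumes x: "x \<in> J" and e: "e \<in> E" and r: "r \<in> carrier R"
  shows "e \<otimes> x \<otimes> r \<otimes> e = \<zero>"
proof (rule ccontr)
  have c: "x \<in> carrier R" "e \<in> carrier R" "e \<otimes> e = e"
    using x e J_closed E_closed E_idem by auto
  assume "e \<otimes> x \<otimes> r \<otimes> e \<noteq> \<zero>"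
  moreover have "e \<otimes> (e \<otimes> x \<otimes> r \<otimes> e) = e \<otimes> x \<otimes> r \<otimes> e"
    using c r by (simp add: m_assoc[symmetric])
  moreover have "(e \<otimes> x \<otimes> r \<otimes> e) \<otimes> e = e \<otimes> x \<otimes> r \<otimes> (e \<otimes> e)" using c r by (simp add: m_assoc)
  ultimately obtain u where u: "u \<in> carrier R" "(e \<otimes> x \<otimes> r \<otimes> e) \<otimes> u = e"
    using corner_inverse[of e "e \<otimes> x \<otimes> r \<otimes> e"] c r e by auto
  have "e \<otimes> x \<otimes> (r \<otimes> e \<otimes> u) = e" using u c r by (simp add: m_assoc)
  moreover have "r \<otimes> e \<otimes> u \<in> carrier R" using u c r by simp
  ultimately show False using x e unfolding J_def by blast
qed

definition radical_link :: "('a \<times> 'a) set"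
  where "radical_link = {(e, f). e \<in> E \<and> f \<in> E \<and> (\<exists>j \<in> J. e \<otimes> (j \<otimes> f) \<noteq> \<zero>)}"

text \<open>
  Nonzero maps compose to nonzero maps by \<open>left_cancel\<close>, which gives transitivity; irreflexivity is
  \<open>J_corner_zero\<close>. The length of the chains in
  this order bounds the nilpotency index of the radical.
\<close>

lemma wf_radical_link: "wf radical_link"
proof (rule finite_acyclic_wf)
  show "finite radical_link"
    by (rule finite_subset[of _ "E \<times> E"]) (auto simp: radical_link_def finE)
  have "trans radical_link"
  proof (rule transI)
    fix e f g assume "(e, f) \<in> radical_link" "(f, g) \<in> radical_link"
    then obtain j k where E: "e \<in> E" "f \<in> E" "g \<in> E" and j: "j \<in> J" "e \<otimes> (j \<otimes> f) \<noteq> \<zero>"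
      and k: "k \<in> J" "f \<otimes> (k \<otimes> g) \<noteq> \<zero>"
      by (auto simp: radical_link_def)
    note c = E_closed[OF E(1)] E_closed[OF E(2)] E_closed[OF E(3)] J_closed[OF j(1)] J_closed[OF k(1)]
    have "e \<otimes> (j \<otimes> f) \<otimes> (f \<otimes> (k \<otimes> g)) \<noteq> \<zero>"
    proof
      assume 0: "e \<otimes> (j \<otimes> f) \<otimes> (f \<otimes> (k \<otimes> g)) = \<zero>"
      have "e \<otimes> (j \<otimes> f) \<otimes> f = e \<otimes> (j \<otimes> f)" using c E_idem[OF E(2)] by (simp add: m_assoc)
      then have "f \<otimes> (f \<otimes> (k \<otimes> g)) = \<zero>" using left_cancel[OF E(2) _ _ j(2) _ 0] c by simp
      then show False using k c E_idem[OF E(2)] by (simp add: m_assoc[symmetric])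
    qed
    moreover have "e \<otimes> (j \<otimes> f) \<otimes> (f \<otimes> (k \<otimes> g)) = e \<otimes> (j \<otimes> (f \<otimes> f \<otimes> k) \<otimes> g)"
      using c by (simp add: m_assoc)
    moreover have "j \<otimes> (f \<otimes> f \<otimes> k) \<in> J" using J_r_mult[OF j(1)] c by simp
    ultimately show "(e, g) \<in> radical_link" using E by (auto simp: radical_link_def)
  qed
  moreover have "(e, e) \<notin> radical_link" for e
  proof
    assume "(e, e) \<in> radical_link"
    then obtain j where j: "e \<in> E" "j \<in> J" "e \<otimes> (j \<otimes> e) \<noteq> \<zero>" by (auto simp: radical_link_def)
    then show False
      using J_corner_zero[OF j(2,1) one_closed] E_closed[OF j(1)] J_closed[OF j(2)] by (simp add: m_assoc)
  qed
  ultimately show "acyclic radical_link" by (simp add: acyclic_def)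
qed

text \<open>
  The submodule \<open>MJ\<close>, generated additively by the products of elements of \<open>M\<close> and \<open>J\<close>. The additive form
  allows induction over its elements with properties that are not closed under scalars.
\<close>

inductive_set times_J :: "('a, 'm) module \<Rightarrow> 'm set" for M :: "('a, 'm) module" where
  zero: "\<zero>\<^bsub>M\<^esub> \<in> times_J M"
| step: "\<lbrakk>x \<in> carrier M; j \<in> J; w \<in> times_J M\<rbrakk> \<Longrightarrow> j \<odot>\<^bsub>M\<^esub> x \<oplus>\<^bsub>M\<^esub> w \<in> times_J M"

lemma times_J_submodule:
  fixes M :: "('a, 'm) module"
  assumes M: "right_module R M"
  shows "submodule (times_J M) R M"
proof -
  interpret M: right_module R M by fact
  have c: "w \<in> carrier M" if "w \<in> times_J M" for w
    using that by induction (auto intro: M.smult_closed J_closed)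
  show ?thesis
  proof (rule M.submoduleI)
    show "times_J M \<subseteq> carrier M" using c by blast
    show "times_J M \<noteq> {}" using times_J.zero by blast
    show "x \<oplus>\<^bsub>M\<^esub> y \<in> times_J M" if "x \<in> times_J M" "y \<in> times_J M" for x y
      using that(1)
    proof induction
      case zero
      then show ?case using that(2) c by simp
    next
      case (step x j w)
      then show ?case
        using that(2) c times_J.step[OF step(1,2,4)]
        by (simp add: M.M.a_assoc M.smult_closed J_closed)
    qed
    show "r \<odot>\<^bsub>M\<^esub> x \<in> times_J M" if r: "r \<in> carrier R" and "x \<in> times_J M" for r x
      using that(2)
    proof induction
      case zero
      then show ?case using r times_J.zero by (simp add: M.smult_r_null)
    next
      case (step x j w)
      have "r \<odot>\<^bsub>M\<^esub> (j \<odot>\<^bsub>M\<^esub> x \<oplus>\<^bsub>M\<^esub> w) = (j \<otimes> r) \<odot>\<^bsub>M\<^esub> x \<oplus>\<^bsub>M\<^esub> r \<odot>\<^bsub>M\<^esub> w"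
        using step r c J_closed by (simp add: M.smult_r_distr M.smult_closed M.smult_assoc)
      then show ?case using times_J.step[OF step(1) J_r_mult[OF step(2) r] step(4)] by simp
    qed
  qed
qed

lemma times_J_smult:
  assumes M: "right_module R M" and "x \<in> carrier M" "j \<in> J"
  shows "j \<odot>\<^bsub>M\<^esub> x \<in> times_J M"
proof -
  interpret M: right_module R M by fact
  show ?thesis
    using times_J.step[OF assms(2,3) times_J.zero] assms J_closed by (simp add: M.smult_closed)
qed

lemma E_expansion:
  fixes M :: "('a, 'm) module"
  assumes M: "right_module R M" and x: "x \<in> carrier M"
  shows "x = (\<Oplus>\<^bsub>M\<^esub> e \<in> E. e \<odot>\<^bsub>M\<^esub> x)"
proof -
  interpret M: right_module R M by fact
  have "\<one> \<odot>\<^bsub>M\<^esub> x = (\<Oplus>\<^bsub>regular_module R\<^esub> e \<in> E. e) \<odot>\<^bsub>M\<^esub> x"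
    by (simp add: finsum_regular_module E_sum)
  also have "\<dots> = (\<Oplus>\<^bsub>M\<^esub> e \<in> E. e \<odot>\<^bsub>M\<^esub> x)"
    by (rule mod_hom_finsum[OF M.smult_hom[OF x] right_module_regular[OF ring_axioms] M finE])
      (auto simp: regular_module_simps E_closed)
  finally show ?thesis using x by (simp add: M.smult_one)
qed

text \<open>
  The form of Nakayama's lemma behind the projective covers. The components \<open>M f\<close> are shown to lie in
  \<open>N\<close> by induction along \<open>radical_link\<close>: the \<open>f\<close>-component of a product \<open>x j\<close> is the sum of
  the \<open>(x e) (e j f)\<close>, where only those \<open>e\<close> contribute that are below \<open>f\<close>, and for these \<open>x e\<close> is
  already known to lie in \<open>N\<close>.
\<close>

lemma times_J_superfluous:
  fixes M :: "('a, 'm) module"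
  assumes M: "right_module R M" and N: "submodule N R M"
    and sum: "\<And>x. x \<in> carrier M \<Longrightarrow> x \<in> times_J M <+>\<^bsub>M\<^esub> N"
  shows "N = carrier M"
proof -
  interpret M: right_module R M by fact
  note ND = submoduleD[OF N]
  have component: "\<forall>y \<in> carrier M. f \<odot>\<^bsub>M\<^esub> y \<in> N" if "f \<in> E" for f
    using wf_radical_link that
  proof (induction f rule: wf_induct_rule)
    case (less f)
    note fc = E_closed[OF less.prems]
    have "f \<odot>\<^bsub>M\<^esub> w \<in> N" if "w \<in> times_J M" for w
      using that
    proof induction
      case zero
      then show ?case using fc ND(2) by (simp add: M.smult_r_null)
    next
      case (step x j w)
      note jc = J_closed[OF step(2)]
      have wc: "w \<in> carrier M" using step(3) submoduleD(1)[OF times_J_submodule[OF M]] by blast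
      have "(j \<otimes> f) \<odot>\<^bsub>M\<^esub> (e \<odot>\<^bsub>M\<^esub> x) \<in> N" if e: "e \<in> E" for e
      proof (cases "(e, f) \<in> radical_link")
        case True
        then show ?thesis using less.IH[OF True e] step(1) ND(4) jc fc by simp
      next
        case False
        then have "e \<otimes> (j \<otimes> f) = \<zero>" using e less.prems step(2) by (auto simp: radical_link_def)
        then have "(j \<otimes> f) \<odot>\<^bsub>M\<^esub> (e \<odot>\<^bsub>M\<^esub> x) = \<zero>\<^bsub>M\<^esub>"
          using M.smult_assoc[of e "j \<otimes> f" x] E_closed[OF e] jc fc step(1) by (simp add: M.smult_l_null)
        then show ?thesis using ND(2) by simp
      qed
      then have "(\<Oplus>\<^bsub>M\<^esub> e \<in> E. (j \<otimes> f) \<odot>\<^bsub>M\<^esub> (e \<odot>\<^bsub>M\<^esub> x)) \<in> N"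
        by (rule M.finsum_mem_submodule[OF N finE])
      moreover have "(\<Oplus>\<^bsub>M\<^esub> e \<in> E. (j \<otimes> f) \<odot>\<^bsub>M\<^esub> (e \<odot>\<^bsub>M\<^esub> x)) = (j \<otimes> f) \<odot>\<^bsub>M\<^esub> (\<Oplus>\<^bsub>M\<^esub> e \<in> E. e \<odot>\<^bsub>M\<^esub> x)"
        using jc fc step(1) by (intro M.finsum_smult[symmetric] finE) (auto intro: M.smult_closed E_closed)
      ultimately have "(j \<otimes> f) \<odot>\<^bsub>M\<^esub> x \<in> N" using E_expansion[OF M step(1)] by simp
      then show ?case
        using ND(3) step fc jc wc by (simp add: M.smult_r_distr M.smult_closed M.smult_assoc)
    qed
    moreover have "\<exists>w \<in> times_J M. \<exists>n \<in> N. y = w \<oplus>\<^bsub>M\<^esub> n" if "y \<in> carrier M" for y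
      using sum[OF that] by (simp add: set_add_iff)
    moreover have "f \<odot>\<^bsub>M\<^esub> (w \<oplus>\<^bsub>M\<^esub> n) = f \<odot>\<^bsub>M\<^esub> w \<oplus>\<^bsub>M\<^esub> f \<odot>\<^bsub>M\<^esub> n" if "w \<in> times_J M" "n \<in> N" for w n
      using that ND(1) submoduleD(1)[OF times_J_submodule[OF M]] fc by (intro M.smult_r_distr) auto
    ultimately show ?case using ND(3,4) fc by metis
  qed
  have "x \<in> N" if "x \<in> carrier M" for x
    using M.finsum_mem_submodule[OF N finE, of "\<lambda>e. e \<odot>\<^bsub>M\<^esub> x"] component that E_expansion[OF M that]
    by simp
  then show ?thesis using ND(1) by blast
qed

text \<open>
  The analogue of a basis of the semisimple module \<open>M/MJ\<close>. The candidates \<open>Z\<close> are the pairs \<open>(e, x)\<close> with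
  \<open>x e = x\<close>, that is, the maps \<open>eR \<rightarrow> M\<close>; a set \<open>G\<close> of them gives \<open>span G\<close>, the direct sum of
  the modules \<open>eR\<close> realised inside one free module \<open>F\<close>, and a map \<open>\<theta>\<close> to \<open>M\<close>. Independence modulo \<open>MJ\<close>
  puts the kernel of \<open>\<theta>\<close> inside \<open>(span G) J\<close>, and maximality makes \<open>\<theta>\<close> onto modulo \<open>MJ\<close>, because a
  relation that involves a new candidate \<open>y\<close> with a coefficient outside of \<open>J\<close> can be solved for \<open>y\<close>. Both
  \<open>MJ\<close> and \<open>(span G) J\<close> are superfluous.
\<close>

lemma every_module_has_projective_cover:
  fixes M :: "('a, 'm) module"
  assumes M: "right_module R M"
  shows "has_projective_cover R M"
proof -
  interpret M: right_module R M by fact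
  define Z where "Z = {(e, x). e \<in> E \<and> x \<in> carrier M \<and> e \<odot>\<^bsub>M\<^esub> x = x}"
  define F where "F = free_module R Z"
  define \<theta> where "\<theta> = free_ext R Z M snd"
  define \<epsilon> where "\<epsilon> z = fst z \<odot>\<^bsub>F\<^esub> free_unit R Z z" for z
  define span where "span G = {u \<in> carrier F. \<forall>z \<in> Z. fst z \<otimes> u z = u z \<and> (z \<notin> G \<longrightarrow> u z = \<zero>)}" for G
  define indep where "indep G \<longleftrightarrow> G \<subseteq> Z \<and>
    (\<forall>u \<in> span G. \<theta> u \<in> times_J M \<longrightarrow> (\<forall>z \<in> Z. u z \<in> J))" for G
  have F: "right_module R F" unfolding F_def by (rule right_module_free[OF ring_axioms])
  interpret F: right_module R F by fact
  have Zc: "fst z \<in> E" "fst z \<in> carrier R" "snd z \<in> carrier M" "fst z \<odot>\<^bsub>M\<^esub> snd z = snd z" if "z \<in> Z" for z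
    using that E_closed by (auto simp: Z_def)
  have b: "snd \<in> Z \<rightarrow> carrier M" using Zc by auto
  have \<theta>: "\<theta> \<in> mod_hom R F M" unfolding \<theta>_def F_def by (rule M.free_ext_hom[OF b])
  note \<theta>D = mod_homD[OF \<theta>]
  have \<theta>unit: "\<theta> (free_unit R Z z) = snd z" if "z \<in> Z" for z
    unfolding \<theta>_def by (rule free_ext_free_unit[OF M b that])
  have unit: "free_unit R Z z \<in> carrier F" for z unfolding F_def by (rule free_unit_closed[OF ring_axioms])
  have uc: "u z \<in> carrier R" if "u \<in> carrier F" "z \<in> Z" for u z
    using that by (auto simp: F_def free_module_simps)
  have spanF: "u \<in> carrier F" if "u \<in> span G" for u G using that by (simp add: span_def)
  have span_sub: "submodule (span G) R F" for G
  proof (rule F.submoduleI)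
    show "span G \<subseteq> carrier F" by (auto simp: span_def)
    have "\<zero>\<^bsub>F\<^esub> \<in> span G"
      using F.M.zero_closed Zc by (auto simp: span_def) (auto simp: F_def free_module_simps)
    then show "span G \<noteq> {}" by blast
    show "u \<oplus>\<^bsub>F\<^esub> v \<in> span G" if "u \<in> span G" "v \<in> span G" for u v
    proof -
      have "u \<oplus>\<^bsub>F\<^esub> v \<in> carrier F" using that spanF by simp
      moreover have "(u \<oplus>\<^bsub>F\<^esub> v) z = u z \<oplus> v z" if "z \<in> Z" for z
        using that by (simp add: F_def free_module_simps)
      moreover have "u z \<in> carrier R" "v z \<in> carrier R" if "z \<in> Z" for z
        using that \<open>u \<in> span G\<close> \<open>v \<in> span G\<close> spanF uc by blast+
      ultimately show ?thesis using that Zc by (simp add: span_def r_distr)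
    qed
    show "r \<odot>\<^bsub>F\<^esub> u \<in> span G" if r: "r \<in> carrier R" and u: "u \<in> span G" for r u
    proof -
      have "r \<odot>\<^bsub>F\<^esub> u \<in> carrier F" using r u spanF F.smult_closed by blast
      moreover have "(r \<odot>\<^bsub>F\<^esub> u) z = u z \<otimes> r" if "z \<in> Z" for z
        using that by (simp add: F_def free_module_simps)
      moreover have "u z \<in> carrier R" if "z \<in> Z" for z
        using that u spanF uc by blast
      ultimately show ?thesis using u r Zc by (simp add: span_def m_assoc[symmetric])
    qed
  qed
  have span_mod: "right_module R (F\<lparr>carrier := span G\<rparr>)" for G
    by (rule right_module_submodule[OF F span_sub])
  have span_proj: "projective R (F\<lparr>carrier := span G\<rparr>)" for G
  proof (rule projective_retract[OF projective_free[OF ring_axioms, of Z] span_mod])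
    show "(\<lambda>u. u) \<in> mod_hom R (F\<lparr>carrier := span G\<rparr>) (free_module R Z)"
      by (rule mod_homI) (auto simp: spanF F_def[symmetric])
    \<comment> \<open>The projection of \<open>F\<close> onto the direct summand \<open>span G\<close>.\<close>
    let ?p = "\<lambda>u. \<lambda>z\<in>Z. if z \<in> G then fst z \<otimes> u z else \<zero>"
    have pF: "?p u \<in> carrier F" if "u \<in> carrier F" for u
    proof -
      have "finite {z \<in> Z. ?p u z \<noteq> \<zero>}"
        by (rule finite_subset[of _ "{z \<in> Z. u z \<noteq> \<zero>}"])
          (use that Zc in \<open>auto simp: F_def free_module_simps split: if_splits\<close>)
      then show ?thesis using uc[OF that] Zc by (auto simp: F_def free_module_simps)
    qed
    have pS: "?p u \<in> span G" if u: "u \<in> carrier F" for u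
      using pF[OF u] uc[OF u] Zc E_idem by (simp add: span_def m_assoc[symmetric])
    show "?p \<in> mod_hom R (free_module R Z) (F\<lparr>carrier := span G\<rparr>)"
    proof (rule mod_homI, unfold F_def[symmetric] submodule_carrier_simps)
      show "?p u \<in> span G" if "u \<in> carrier F" for u by (rule pS[OF that])
      show "?p (u \<oplus>\<^bsub>F\<^esub> v) = ?p u \<oplus>\<^bsub>F\<^esub> ?p v" if "u \<in> carrier F" "v \<in> carrier F" for u v
        using uc[OF that(1)] uc[OF that(2)] Zc
        by (auto simp: fun_eq_iff F_def free_module_simps r_distr)
      show "?p (r \<odot>\<^bsub>F\<^esub> u) = r \<odot>\<^bsub>F\<^esub> ?p u" if "r \<in> carrier R" "u \<in> carrier F" for r u
        using uc[OF that(2)] that(1) Zc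
        by (auto simp: fun_eq_iff F_def free_module_simps m_assoc)
    qed
    show "?p u = u" if "u \<in> carrier (F\<lparr>carrier := span G\<rparr>)" for u
      using that by (intro extensionalityI[of _ Z]) (auto simp: span_def F_def free_module_simps PiE_def)
  qed
  have \<epsilon>: "\<epsilon> z \<in> span G" "\<theta> (\<epsilon> z) = snd z" if "z \<in> Z" "z \<in> G" for z G
  proof -
    have "\<epsilon> z \<in> carrier F" unfolding \<epsilon>_def by (rule F.smult_closed[OF Zc(2)[OF that(1)] unit])
    moreover have "\<epsilon> z y = (if y = z then fst z else \<zero>)" if "y \<in> Z" for y
      using that Zc[OF \<open>z \<in> Z\<close>] by (simp add: \<epsilon>_def F_def free_module_simps free_unit_def)
    ultimately show "\<epsilon> z \<in> span G" using that Zc E_idem by (auto simp: span_def)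
    show "\<theta> (\<epsilon> z) = snd z"
      using \<theta>D(3)[OF Zc(2)[OF that(1)] unit] \<theta>unit Zc[OF that(1)] that(1) by (simp add: \<epsilon>_def)
  qed
  have "\<exists>G \<in> Collect indep. \<forall>H \<in> Collect indep. G \<subseteq> H \<longrightarrow> H = G"
  proof (rule subset_Zorn')
    fix C assume C: "subset.chain (Collect indep) C"
    have "\<Union>C \<subseteq> Z" using C unfolding subset.chain_def indep_def by blast
    moreover have "u z \<in> J" if u: "u \<in> span (\<Union>C)" "\<theta> u \<in> times_J M" and z: "z \<in> Z" for u z
    proof (cases "C = {}")
      case True
      then show ?thesis using u(1) z J_zero by (simp add: span_def)
    next
      case False
      have "finite {z \<in> Z. u z \<noteq> \<zero>}" using spanF[OF u(1)] by (simp add: F_def free_module_simps)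
      moreover have "{z \<in> Z. u z \<noteq> \<zero>} \<subseteq> \<Union>C" using u(1) by (auto simp: span_def)
      ultimately obtain G where G: "G \<in> C" "{z \<in> Z. u z \<noteq> \<zero>} \<subseteq> G"
        using finite_subset_Union_chain[OF _ _ False C] by blast
      then have "u \<in> span G" using u(1) by (auto simp: span_def)
      moreover have "indep G" using G(1) C by (auto simp: subset.chain_def)
      ultimately show ?thesis using u(2) z by (auto simp: indep_def)
    qed
    ultimately show "\<Union>C \<in> Collect indep" by (auto simp: indep_def)
  qed
  then obtain G where G: "indep G" and max: "\<And>H. indep H \<Longrightarrow> G \<subseteq> H \<Longrightarrow> H = G" by auto
  define P where "P = F\<lparr>carrier := span G\<rparr>"
  have P: "right_module R P" "projective R P" unfolding P_def by (rule span_mod span_proj)+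
  interpret P: right_module R P by fact
  have \<theta>P: "\<theta> \<in> mod_hom R P M"
    by (rule mod_homI) (auto simp: P_def spanF \<theta>D)
  note image = mod_hom_image_submodule[OF \<theta>P P(1) M P.submodule_carrier]
  let ?Q = "times_J M <+>\<^bsub>M\<^esub> (\<theta> ` carrier P)"
  have tJ: "submodule (times_J M) R M" by (rule times_J_submodule[OF M])
  note tJD = submoduleD[OF tJ] and imD = submoduleD[OF image]
  have Q: "submodule ?Q R M" by (rule M.set_add_submodule[OF tJ image])
  have tQ: "x \<in> ?Q" if "x \<in> times_J M" for x
    unfolding set_add_iff by (rule bexI[of _ x], rule bexI[of _ "\<zero>\<^bsub>M\<^esub>"]) (use that imD(2) tJD(1) in \<open>simp_all add: subset_iff\<close>)
  have iQ: "x \<in> ?Q" if "x \<in> \<theta> ` carrier P" for x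
    unfolding set_add_iff by (rule bexI[of _ "\<zero>\<^bsub>M\<^esub>"], rule bexI[of _ x]) (use that tJD(2) imD(1) in \<open>simp_all add: subset_iff\<close>)
  have comp: "e \<odot>\<^bsub>M\<^esub> x \<in> ?Q" if e: "e \<in> E" and x: "x \<in> carrier M" for e x
  proof -
    define y where "y = e \<odot>\<^bsub>M\<^esub> x"
    have ey: "y \<in> carrier M" "e \<odot>\<^bsub>M\<^esub> y = y"
      using e x M.smult_assoc[of e e x] by (simp_all add: y_def E_closed E_idem M.smult_closed)
    let ?z = "(e, y)"
    have z: "?z \<in> Z" using e ey by (simp add: Z_def)
    have "y \<in> ?Q"
    proof (cases "?z \<in> G")
      case True
      then have "y \<in> \<theta> ` carrier P" using \<epsilon>[OF z True] by (force simp: P_def)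
      then show ?thesis by (rule iQ)
    next
      case False
      then have "\<not> indep (insert ?z G)" using max[of "insert ?z G"] by blast
      then obtain u z' where u: "u \<in> span (insert ?z G)" "\<theta> u \<in> times_J M" and z': "z' \<in> Z" "u z' \<notin> J"
        using G z by (auto simp: indep_def)
      let ?v = "u(?z := \<zero>)" and ?a = "u ?z"
      \<comment> \<open>A nontrivial relation; its coefficient at the new candidate is \<open>?a\<close>, and \<open>?v\<close> is the rest.\<close>
      note split = free_module_split_coordinate[OF ring_axioms spanF[OF u(1), unfolded F_def] z, folded F_def]
      have vc: "?v \<in> span G" using split(1) u(1) Zc by (auto simp: span_def)
      have ac: "?a \<in> carrier R" "e \<otimes> ?a = ?a" using uc[OF spanF[OF u(1)] z] u(1) z by (auto simp: span_def)
      have \<theta>v: "\<theta> ?v \<in> carrier M" "\<theta> ?v \<in> ?Q"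
        using \<theta>D(1) spanF[OF vc] vc iQ by (auto simp: P_def)
      have "\<theta> u = \<theta> (?a \<odot>\<^bsub>F\<^esub> free_unit R Z ?z) \<oplus>\<^bsub>M\<^esub> \<theta> ?v"
        using \<theta>D(2)[OF F.smult_closed[OF ac(1) unit] split(1)] split(2) by metis
      then have \<theta>u: "\<theta> u = ?a \<odot>\<^bsub>M\<^esub> y \<oplus>\<^bsub>M\<^esub> \<theta> ?v"
        using \<theta>D(3)[OF ac(1) unit] \<theta>unit[OF z] by simp
      have ayc: "?a \<odot>\<^bsub>M\<^esub> y \<in> carrier M" using ac ey by (simp add: M.smult_closed)
      have "?a \<notin> J"
      proof
        assume a: "?a \<in> J"
        have "\<theta> ?v = \<ominus>\<^bsub>M\<^esub> (?a \<odot>\<^bsub>M\<^esub> y) \<oplus>\<^bsub>M\<^esub> \<theta> u"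
          using \<theta>u ayc \<theta>v by (simp add: M.r_neg1)
        then have "\<theta> ?v \<in> times_J M"
          using tJD(3,5) times_J_smult[OF M ey(1) a] u(2) by simp
        then have "?v z' \<in> J" using G vc z'(1) unfolding indep_def by blast
        then show False using z' a by (auto split: if_splits)
      qed
      then obtain f r where f: "f \<in> E" "r \<in> carrier R" "f \<otimes> ?a \<otimes> r = f" using ac by (auto simp: J_def)
      have fc: "f \<in> carrier R" "e \<in> carrier R" using f(1) e E_closed by auto
      have "f = e"
      proof (rule ccontr)
        assume "f \<noteq> e"
        have "f \<otimes> ?a = (f \<otimes> e) \<otimes> ?a" using ac fc by (simp add: m_assoc)
        also have "\<dots> = \<zero>" using E_orth[OF f(1) e \<open>f \<noteq> e\<close>] ac by simp
        finally show False using f E_nonzero[OF f(1)] by simp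
      qed
      then have ar: "?a \<otimes> r = e" using f(3) ac by simp
      have "?a \<odot>\<^bsub>M\<^esub> y = \<theta> u \<oplus>\<^bsub>M\<^esub> \<ominus>\<^bsub>M\<^esub> \<theta> ?v"
        using \<theta>u ayc \<theta>v by (simp add: M.a_assoc M.r_neg)
      then have "?a \<odot>\<^bsub>M\<^esub> y \<in> ?Q"
        using submoduleD(3,5)[OF Q] \<theta>v(2) tQ[OF u(2)] by simp
      then have "r \<odot>\<^bsub>M\<^esub> (?a \<odot>\<^bsub>M\<^esub> y) \<in> ?Q" by (rule submoduleD(4)[OF Q f(2)])
      then show ?thesis using M.smult_assoc[OF ac(1) f(2) ey(1)] ar ey(2) by simp
    qed
    then show ?thesis by (simp add: y_def)
  qed
  have "x \<in> ?Q" if x: "x \<in> carrier M" for x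
    using M.finsum_mem_submodule[OF Q finE, of "\<lambda>e. e \<odot>\<^bsub>M\<^esub> x"] comp x E_expansion[OF M x] by simp
  then have onto: "\<theta> ` carrier P = carrier M" by (rule times_J_superfluous[OF M image])
  have radical: "u \<in> span G \<longrightarrow> (\<forall>z \<in> Z. u z \<in> J) \<longrightarrow> u \<in> times_J P" if "u \<in> carrier F" for u
  proof (rule free_module_induct[where R = R and X = Z, folded F_def, OF ring_axioms that])
    show "(\<lambda>z\<in>Z. \<zero>) \<in> span G \<longrightarrow> (\<forall>z\<in>Z. (\<lambda>z\<in>Z. \<zero>) z \<in> J) \<longrightarrow> (\<lambda>z\<in>Z. \<zero>) \<in> times_J P"
      using times_J.zero[of P] by (simp add: P_def F_def free_module_simps)
  next
    fix v z
    assume v: "v \<in> carrier F" and z: "z \<in> Z" and nz: "v z \<noteq> \<zero>"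
      and v': "v(z := \<zero>) \<in> carrier F"
      and eq: "v = v z \<odot>\<^bsub>F\<^esub> free_unit R Z z \<oplus>\<^bsub>F\<^esub> v(z := \<zero>)"
      and IH: "v(z := \<zero>) \<in> span G \<longrightarrow> (\<forall>y\<in>Z. (v(z := \<zero>)) y \<in> J) \<longrightarrow> v(z := \<zero>) \<in> times_J P"
    show "v \<in> span G \<longrightarrow> (\<forall>y\<in>Z. v y \<in> J) \<longrightarrow> v \<in> times_J P"
    proof (intro impI)
      assume vs: "v \<in> span G" and vJ: "\<forall>y\<in>Z. v y \<in> J"
      have "v(z := \<zero>) \<in> span G" using vs v' Zc by (auto simp: span_def)
      then have 1: "v(z := \<zero>) \<in> times_J P" using IH vJ J_zero by simp
      have zG: "z \<in> G" and ez: "fst z \<otimes> v z = v z" using vs z nz by (auto simp: span_def)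
      have "v z \<odot>\<^bsub>F\<^esub> free_unit R Z z = v z \<odot>\<^bsub>F\<^esub> \<epsilon> z"
        using F.smult_assoc[OF Zc(2)[OF z] uc[OF v z] unit] ez by (simp add: \<epsilon>_def)
      then have "v = v z \<odot>\<^bsub>P\<^esub> \<epsilon> z \<oplus>\<^bsub>P\<^esub> v(z := \<zero>)" using eq by (simp add: P_def)
      moreover have "\<epsilon> z \<in> carrier P" using \<epsilon>(1)[OF z zG] by (simp add: P_def)
      ultimately show "v \<in> times_J P" using times_J.step[OF _ _ 1, of "\<epsilon> z" "v z"] vJ z by simp
    qed
  qed
  let ?K = "a_kernel P M \<theta>"
  have K: "?K = {u \<in> carrier P. \<theta> u \<in> {\<zero>\<^bsub>M\<^esub>}}" by (auto simp: a_kernel_def kernel_def)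
  have KJ: "?K \<subseteq> times_J P"
  proof
    fix u assume "u \<in> ?K"
    then have u: "u \<in> span G" "\<theta> u = \<zero>\<^bsub>M\<^esub>" unfolding K by (auto simp: P_def)
    then show "u \<in> times_J P" using G radical[OF spanF[OF u(1)]] tJD(2) by (simp add: indep_def)
  qed
  have "superfluous R P ?K"
    unfolding superfluous_def
  proof (intro conjI allI impI)
    show "submodule ?K R P"
      unfolding K by (rule mod_hom_vimage_submodule[OF \<theta>P P(1) M M.zero_submodule])
    fix N assume N: "submodule N R P" and sum: "?K <+>\<^bsub>P\<^esub> N = carrier P"
    show "N = carrier P"
      by (rule times_J_superfluous[OF P(1) N]) (use KJ in \<open>unfold sum[symmetric] set_add_iff, blast\<close>)
  qed
  then have "projective_cover R M P \<theta>"
    using P(2) \<theta>P onto by (simp add: projective_cover_def mod_epi_def)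
  then show ?thesis by (rule has_projective_coverI[OF M])
qed

end

lemma (in ring) corner_division_ring_of_dcc_rickart:
  assumes dcc: left_principal_dcc and rick: right_rickart
  shows "\<exists>E. corner_division_ring R E"
proof -
  obtain E where E: "finite E" "\<And>f. f \<in> E \<Longrightarrow> primitive f"
    "\<And>f g. f \<in> E \<Longrightarrow> g \<in> E \<Longrightarrow> f \<noteq> g \<Longrightarrow> f \<otimes> g = \<zero>" "(\<Oplus>f\<in>E. f) = \<one>"
    using primitive_decomposition[OF dcc, of \<one>] by (auto simp: idempotent_def)
  have "corner_division_ring R E"
  proof (unfold_locales)
    show "\<exists>u\<in>carrier R. a \<otimes> u = e" if "e \<in> E" "a \<in> carrier R" "a \<otimes> e = a" "e \<otimes> a = a" "a \<noteq> \<zero>" for e a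
      using primitive_corner_division[OF rick dcc E(2)[OF that(1)] that(2-5)] by blast
    show "f \<otimes> x = \<zero>" if "f \<in> E" "a \<in> carrier R" "a \<otimes> f = a" "a \<noteq> \<zero>" "x \<in> carrier R" "a \<otimes> x = \<zero>" for f a x
      by (rule primitive_left_cancel[OF rick E(2)[OF that(1)] that(2-6)])
  qed (use E in \<open>auto simp: primitive_def idempotent_def\<close>)
  then show ?thesis by blast
qed

section \<open>Coherence\<close>

lemma opp_ring_simps:
  "carrier (opp_ring R) = carrier R" "x \<otimes>\<^bsub>opp_ring R\<^esub> y = y \<otimes>\<^bsub>R\<^esub> x" "x \<oplus>\<^bsub>opp_ring R\<^esub> y = x \<oplus>\<^bsub>R\<^esub> y"
  "\<zero>\<^bsub>opp_ring R\<^esub> = \<zero>\<^bsub>R\<^esub>" "\<one>\<^bsub>opp_ring R\<^esub> = \<one>\<^bsub>R\<^esub>"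
  by (simp_all add: opp_ring_def)

lemma finsum_opp_ring: "finsum (opp_ring R) f A = finsum R f A"
  by (simp add: finsum_def finprod_def opp_ring_def)

lemma ring_opp_ring:
  assumes "ring R" shows "ring (opp_ring R)"
proof -
  interpret ring R by fact
  show ?thesis
  proof (rule ringI)
    show "abelian_group (opp_ring R)"
      by (rule abelian_groupI)
        (auto simp: opp_ring_simps a_assoc a_comm a_lcomm intro!: bexI[of _ "\<ominus>\<^bsub>R\<^esub> _"] l_neg)
    show "monoid (opp_ring R)"
      by (rule monoidI) (auto simp: opp_ring_simps m_assoc)
  qed (auto simp: opp_ring_simps l_distr r_distr)
qed

text \<open>
  The kernel of the presentation is \<open>K\<close>, and its elements are coded by the lists in \<open>I\<close>, which index the
  power of \<open>R\<close> that is used. The vectors \<open>x i\<close> are the tautological ones,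
  and the coordinates of all of them vanish outside a finite set \<open>J\<close>. The generators of \<open>K\<close> are the
  vectors \<open>\<rho> \<beta>\<close> of \<open>\<beta>\<close>-th coordinates, for \<open>\<beta>\<close> in \<open>J\<close>.
\<close>

lemma left_coherent_of_projective_powers:
  fixes R :: "('a, 'r) ring_scheme"
  assumes R: "ring R" and proj: "\<And>I :: 'a list set. projective R (power_module R I)"
  shows "left_coherent R"
  unfolding left_coherent_def Let_def
proof (intro allI impI)
  let ?S = "opp_ring R"
  let ?reg = "regular_module ?S"
  interpret R: ring R by fact
  have S: "ring ?S" by (rule ring_opp_ring[OF R])
  note regS = right_module_regular[OF S] and regR = right_module_regular[OF R]
  fix L assume L: "submodule L ?S ?reg"
  let ?N = "?reg\<lparr>carrier := L\<rparr>"
  assume "fin_gen ?S ?N"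
  then obtain X where X: "finite X" "X \<subseteq> L" "\<And>H. submodule H ?S ?N \<Longrightarrow> X \<subseteq> H \<Longrightarrow> H = L"
    by (auto simp: fin_gen_def)
  have N: "right_module ?S ?N" by (rule right_module_submodule[OF regS L])
  interpret N: right_module ?S ?N by fact
  have LR: "x \<in> carrier R" if "x \<in> L" for x
    using that submoduleD(1)[OF L] by (auto simp: regular_module_simps opp_ring_simps)
  obtain as where as: "set as = X" using finite_list[OF X(1)] by blast
  define n where "n = length as"
  define a where "a i = as ! i" for i
  have aL: "a i \<in> L" if "i < n" for i using that X(2) as by (auto simp: a_def n_def)
  let ?W = "power_module ?S {..<n}"
  have W: "right_module ?S ?W" by (rule right_module_power[OF S])
  interpret W: right_module ?S ?W by fact
  define f where "f u = (\<Oplus>\<^bsub>?N\<^esub> i \<in> {..<n}. u i \<odot>\<^bsub>?N\<^esub> a i)" for u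
  have f: "f \<in> mod_hom ?S ?W ?N"
    unfolding f_def by (rule N.linear_combination_hom) (use aL in auto)
  have Wc: "u i \<in> carrier R" if "u \<in> carrier ?W" "i < n" for u i
    using that by (auto simp: power_module_simps opp_ring_simps)
  have fR: "f u = (\<Oplus>\<^bsub>R\<^esub> i \<in> {..<n}. u i \<otimes>\<^bsub>R\<^esub> a i)" if u: "u \<in> carrier ?W" for u
  proof -
    have "f u = (\<Oplus>\<^bsub>?reg\<^esub> i \<in> {..<n}. u i \<odot>\<^bsub>?N\<^esub> a i)"
      unfolding f_def
      by (rule mod_hom_finsum[OF mod_hom_inclusion[OF L] N regS])
        (use Wc[OF u] aL submoduleD(4)[OF L] in \<open>auto simp: opp_ring_simps\<close>)
    then show ?thesis
      by (simp add: finsum_regular_module finsum_opp_ring regular_module_simps opp_ring_simps)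
  qed
  have "submodule (f ` carrier ?W) ?S ?N"
    by (rule mod_hom_image_submodule[OF f W N W.submodule_carrier])
  moreover have "X \<subseteq> f ` carrier ?W"
  proof
    fix x assume "x \<in> X"
    then obtain i where i: "i < n" "x = a i"
      using as by (metis in_set_conv_nth n_def a_def)
    define u where "u = (\<lambda>j\<in>{..<n}. if i = j then \<one>\<^bsub>R\<^esub> else \<zero>\<^bsub>R\<^esub>)"
    have u: "u \<in> carrier ?W" by (auto simp: u_def power_module_simps opp_ring_simps)
    have "f u = (\<Oplus>\<^bsub>R\<^esub> j \<in> {..<n}. if i = j then a j else \<zero>\<^bsub>R\<^esub>)"
      unfolding fR[OF u] by (rule R.finsum_cong') (use aL LR in \<open>auto simp: u_def\<close>)
    also have "\<dots> = a i" by (rule R.finsum_singleton) (use i aL LR in auto)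
    finally show "x \<in> f ` carrier ?W" using u i(2) by (intro image_eqI[where x = u]) simp_all
  qed
  ultimately have "f ` carrier ?W = L" by (rule X(3))
  then have fe: "f \<in> mod_epi ?S ?W ?N" using f by (simp add: mod_epi_def)
  define K where "K = a_kernel ?W ?N f"
  have Kiff: "u \<in> K \<longleftrightarrow> u \<in> carrier ?W \<and> f u = \<zero>\<^bsub>R\<^esub>" for u
    by (auto simp: K_def a_kernel_def kernel_def regular_module_simps opp_ring_simps)
  have Ksub: "submodule K ?S ?W"
  proof -
    from mod_hom_vimage_submodule[OF f W N N.zero_submodule] show ?thesis
      by (auto simp: K_def a_kernel_def kernel_def)
  qed
  let ?WK = "?W\<lparr>carrier := K\<rparr>"
  have WK: "right_module ?S ?WK" by (rule right_module_submodule[OF W Ksub])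
  interpret WK: right_module ?S ?WK by fact
  define I where "I = {xs. length xs = n \<and> restrict (nth xs) {..<n} \<in> K}"
  let ?A = "power_module R I"
  have A: "right_module R ?A" by (rule right_module_power[OF R])
  interpret A: right_module R ?A by fact
  let ?F = "free_module R (carrier ?A)" and ?p = "free_ext R (carrier ?A) ?A (\<lambda>x. x)"
  obtain s where s: "s \<in> mod_hom R ?A ?F" and ps: "\<And>x. x \<in> carrier ?A \<Longrightarrow> ?p (s x) = x"
    using projective_coordinates[OF proj[of I]] by blast
  define x where "x i = (\<lambda>k\<in>I. k ! i)" for i
  have Ik: "restrict (nth k) {..<n} \<in> carrier ?W" "f (restrict (nth k) {..<n}) = \<zero>\<^bsub>R\<^esub>" if "k \<in> I" for k
    using that by (auto simp: I_def Kiff)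
  have kR: "k ! i \<in> carrier R" if "k \<in> I" "i < n" for k i
    using Wc[OF Ik(1)[OF that(1)] that(2)] that by simp
  have xA: "x i \<in> carrier ?A" if "i < n" for i
    using kR that by (auto simp: x_def power_module_simps)
  have aR: "a i \<in> carrier R" if "i < n" for i using aL LR that by blast
  have axA: "(\<lambda>i. a i \<odot>\<^bsub>?A\<^esub> x i) \<in> {..<n} \<rightarrow> carrier ?A"
    using aR xA by (auto intro!: A.smult_closed)
  define t where "t = (\<Oplus>\<^bsub>?A\<^esub> i \<in> {..<n}. a i \<odot>\<^bsub>?A\<^esub> x i)"
  have "t \<in> carrier ?A" unfolding t_def by (rule A.M.finsum_closed[OF axA])
  moreover have "t k = \<zero>\<^bsub>R\<^esub>" if k: "k \<in> I" for k
  proof -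
    have "t k = (\<Oplus>\<^bsub>regular_module R\<^esub> i \<in> {..<n}. (a i \<odot>\<^bsub>?A\<^esub> x i) k)"
      unfolding t_def by (rule mod_hom_finsum[OF eval_hom_power[OF k] A regR _ axA]) simp
    also have "\<dots> = (\<Oplus>\<^bsub>R\<^esub> i \<in> {..<n}. restrict (nth k) {..<n} i \<otimes>\<^bsub>R\<^esub> a i)"
      unfolding finsum_regular_module
      by (rule R.finsum_cong') (use k kR aR in \<open>auto simp: power_module_simps x_def\<close>)
    also have "\<dots> = \<zero>\<^bsub>R\<^esub>" using fR[OF Ik(1)[OF k]] Ik(2)[OF k] by simp
    finally show ?thesis .
  qed
  ultimately have t0: "t = \<zero>\<^bsub>?A\<^esub>"
    by (intro extensionalityI[of _ I]) (auto simp: power_module_simps PiE_def)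
  define J where "J = (\<Union>i<n. {\<beta> \<in> carrier ?A. s (x i) \<beta> \<noteq> \<zero>\<^bsub>R\<^esub>})"
  have sx: "s (x i) \<in> carrier ?F" if "i < n" for i by (rule mod_homD(1)[OF s xA[OF that]])
  have Jfin: "finite J" using sx by (auto simp: J_def free_module_simps)
  have JA: "J \<subseteq> carrier ?A" by (auto simp: J_def)
  have sxR: "s (x i) \<beta> \<in> carrier R" if "i < n" "\<beta> \<in> carrier ?A" for i \<beta>
    using sx[OF that(1)] that(2) by (auto simp: free_module_simps)
  define \<rho> where "\<rho> \<beta> = (\<lambda>i\<in>{..<n}. s (x i) \<beta>)" for \<beta>
  have \<rho>K: "\<rho> \<beta> \<in> K" if \<beta>: "\<beta> \<in> carrier ?A" for \<beta>
  proof -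
    have W\<beta>: "\<rho> \<beta> \<in> carrier ?W" using sxR \<beta> by (auto simp: \<rho>_def power_module_simps opp_ring_simps)
    note hom = mod_hom_comp[OF s eval_hom_free[OF \<beta>]]
    have "f (\<rho> \<beta>) = (\<Oplus>\<^bsub>R\<^esub> i \<in> {..<n}. s (a i \<odot>\<^bsub>?A\<^esub> x i) \<beta>)"
      unfolding fR[OF W\<beta>]
      by (rule R.finsum_cong')
        (use mod_homD(3)[OF s aR xA] sxR \<beta> aR in \<open>auto simp: \<rho>_def free_module_simps\<close>)
    also have "\<dots> = s t \<beta>"
      unfolding t_def finsum_regular_module[of R, symmetric]
      by (rule mod_hom_finsum[OF hom A regR _ axA, symmetric]) simp
    also have "\<dots> = \<zero>\<^bsub>R\<^esub>" using mod_hom_zero[OF hom A regR] by (simp add: t0 regular_module_simps)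
    finally show ?thesis using W\<beta> by (simp add: Kiff)
  qed
  have "fin_gen ?S ?WK"
    unfolding fin_gen_def
  proof (intro exI[of _ "\<rho> ` J"] conjI allI impI)
    show "finite (\<rho> ` J)" using Jfin by simp
    show "\<rho> ` J \<subseteq> carrier ?WK" using \<rho>K JA by auto
    fix H assume H: "submodule H ?S ?WK" and \<rho>H: "\<rho> ` J \<subseteq> H"
    have "u \<in> H" if u: "u \<in> K" for u
    proof -
      have uW: "u \<in> carrier ?W" using u by (simp add: Kiff)
      define k where "k = map u [0..<n]"
      have "restrict (nth k) {..<n} = u"
        using uW by (auto simp: k_def fun_eq_iff power_module_simps PiE_def extensional_def)
      then have k: "k \<in> I" using u by (simp add: I_def) (simp add: k_def)
      have \<beta>k: "\<beta> k \<in> carrier R" if "\<beta> \<in> J" for \<beta>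
        using that JA k by (auto simp: power_module_simps)
      \<comment> \<open>The dual basis expansion \<open>x i = \<Sum> \<beta> (s (x i) \<beta>)\<close>, read at the index \<open>k\<close>, says that this is \<open>u\<close>.\<close>
      define v where "v = (\<Oplus>\<^bsub>?WK\<^esub> \<beta> \<in> J. \<beta> k \<odot>\<^bsub>?WK\<^esub> \<rho> \<beta>)"
      have vH: "v \<in> H"
        unfolding v_def by (rule WK.finsum_mem_submodule[OF H Jfin])
          (use submoduleD(4)[OF H] \<beta>k \<rho>H in \<open>auto simp: opp_ring_simps\<close>)
      then have vW: "v \<in> carrier ?W" using submoduleD(1)[OF H] by (auto simp: Kiff)
      have "v i = u i" if i: "i < n" for i
      proof -
        have ev: "(\<lambda>w. w i) \<in> mod_hom ?S ?WK ?reg"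
          by (rule mod_hom_comp[OF mod_hom_inclusion[OF Ksub] eval_hom_power]) (use i in simp)
        have "v i = (\<Oplus>\<^bsub>?reg\<^esub> \<beta> \<in> J. (\<beta> k \<odot>\<^bsub>?WK\<^esub> \<rho> \<beta>) i)"
          unfolding v_def
        proof (rule mod_hom_finsum[OF ev WK regS Jfin])
          show "(\<lambda>\<beta>. \<beta> k \<odot>\<^bsub>?WK\<^esub> \<rho> \<beta>) \<in> J \<rightarrow> carrier ?WK"
            using \<beta>k \<rho>K JA by (intro funcsetI WK.smult_closed) (auto simp: opp_ring_simps)
        qed
        also have "\<dots> = (\<Oplus>\<^bsub>R\<^esub> \<beta> \<in> J. (s (x i) \<beta> \<odot>\<^bsub>?A\<^esub> \<beta>) k)"
          unfolding finsum_regular_module finsum_opp_ring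
          by (rule R.finsum_cong')
            (use i k \<beta>k sxR[OF i] JA in \<open>auto simp: \<rho>_def power_module_simps opp_ring_simps\<close>)
        also have "\<dots> = (\<Oplus>\<^bsub>?A\<^esub> \<beta> \<in> J. s (x i) \<beta> \<odot>\<^bsub>?A\<^esub> \<beta>) k"
          unfolding finsum_regular_module[of R, symmetric]
          by (rule mod_hom_finsum[OF eval_hom_power[OF k] A regR Jfin, symmetric])
            (use sxR[OF i] JA in \<open>auto intro!: A.smult_closed\<close>)
        also have "(\<Oplus>\<^bsub>?A\<^esub> \<beta> \<in> J. s (x i) \<beta> \<odot>\<^bsub>?A\<^esub> \<beta>) = ?p (s (x i))"
          by (rule A.free_ext_eq[OF Jfin _ JA, symmetric])
            (use i sxR[OF i] in \<open>auto simp: J_def\<close>)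
        also have "\<dots> k = u i" using ps[OF xA[OF i]] k i by (simp add: x_def) (simp add: k_def)
        finally show ?thesis .
      qed
      then have "v = u"
        using vW uW by (intro extensionalityI[of _ "{..<n}"]) (auto simp: power_module_simps PiE_def)
      then show ?thesis using vH by simp
    qed
    then show "H = carrier ?WK" using submoduleD(1)[OF H] by auto
  qed
  then show "fin_presented ?S ?N"
    unfolding fin_presented_def using N fe by (auto simp: K_def)
qed

section \<open>Splitting off projective summands\<close>

text \<open>
  A nonzero element \<open>x\<close> of \<open>N\<close> is detected by a homomorphism \<open>\<phi>\<close> to \<open>R\<close>. The right ideal \<open>\<phi> N\<close> is projective,
  and it is nonzero as it contains \<open>\<phi> x\<close>; a section of \<open>\<phi>\<close> embeds it in \<open>N\<close> as a direct summand. In the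
  finitely generated case, \<open>\<phi> N\<close> is generated by the values of \<open>\<phi>\<close> at the \<open>N\<close>-components of generators of \<open>M\<close>.
\<close>

lemma nonzero_torsionless_summand_not_stable:
  fixes R :: "('a, 'r) ring_scheme" and M :: "('a, 'm) module"
  assumes tl: "torsionless R M"
    and her: "right_hereditary R \<or> right_semihereditary R \<and> fin_gen R M"
    and ds: "internal_direct_sum R M P N" and nz: "N \<noteq> {\<zero>\<^bsub>M\<^esub>}"
  shows "\<not> stable R (M\<lparr>carrier := N\<rparr>)"
proof
  assume st: "stable R (M\<lparr>carrier := N\<rparr>)"
  have M: "right_module R M" using tl by (simp add: torsionless_def)
  interpret M: right_module R M by fact
  have P: "submodule P R M" and N: "submodule N R M" and PN: "P \<inter> N = {\<zero>\<^bsub>M\<^esub>}" and sum: "P <+>\<^bsub>M\<^esub> N = carrier M"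
    using ds by (auto simp: internal_direct_sum_def)
  note PD = submoduleD[OF P] and ND = submoduleD[OF N]
  let ?reg = "regular_module R" and ?N = "M\<lparr>carrier := N\<rparr>"
  have R: "ring R" by (rule M.R.ring_axioms)
  note reg = right_module_regular[OF R]
  have NM: "right_module R ?N" by (rule right_module_submodule[OF M N])
  interpret N: right_module R ?N by fact
  obtain x where x: "x \<in> N" "x \<noteq> \<zero>\<^bsub>M\<^esub>" using nz ND(2) by blast
  obtain I :: "('m \<Rightarrow> 'a) set" and F
    where F: "F \<in> mod_hom R M (power_module R I)" and inj: "inj_on F (carrier M)"
    using tl by (auto simp: torsionless_def)
  have F0: "F \<zero>\<^bsub>M\<^esub> = \<zero>\<^bsub>power_module R I\<^esub>" by (rule mod_hom_zero[OF F M right_module_power[OF R]])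
  have "F x \<noteq> \<zero>\<^bsub>power_module R I\<^esub>"
    using inj x ND(1) unfolding F0[symmetric] by (auto dest: inj_onD)
  moreover have "F x \<in> carrier (power_module R I)" using mod_homD(1)[OF F] x ND(1) by auto
  ultimately have "\<exists>i \<in> I. F x i \<noteq> \<zero>\<^bsub>R\<^esub>"
    using extensionalityI[of "F x" I "\<lambda>i\<in>I. \<zero>\<^bsub>R\<^esub>"] by (auto simp: power_module_simps PiE_def)
  then obtain i where i: "i \<in> I" "F x i \<noteq> \<zero>\<^bsub>R\<^esub>" by blast
  define \<phi> where "\<phi> y = F y i" for y
  have \<phi>: "\<phi> \<in> mod_hom R M ?reg" unfolding \<phi>_def by (rule mod_hom_comp[OF F eval_hom_power[OF i(1)]])
  have \<phi>N: "\<phi> \<in> mod_hom R ?N ?reg" by (rule mod_hom_comp[OF mod_hom_inclusion[OF N] \<phi>])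
  note \<phi>D = mod_homD[OF \<phi>N, simplified]
  have "submodule (\<phi> ` carrier ?N) R ?reg"
    by (rule mod_hom_image_submodule[OF \<phi>N NM reg N.submodule_carrier])
  then have im: "submodule (\<phi> ` N) R ?reg" by simp
  let ?I = "?reg\<lparr>carrier := \<phi> ` N\<rparr>"
  have IM: "right_module R ?I" by (rule right_module_submodule[OF reg im])
  have "fin_gen R ?I" if "fin_gen R M"
  proof -
    obtain X where X: "finite X" "X \<subseteq> carrier M" "\<And>H. submodule H R M \<Longrightarrow> X \<subseteq> H \<Longrightarrow> H = carrier M"
      using \<open>fin_gen R M\<close> by (auto simp: fin_gen_def)
    have "\<forall>y \<in> carrier M. \<exists>q. q \<in> N \<and> (\<exists>p \<in> P. y = p \<oplus>\<^bsub>M\<^esub> q)"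
    proof
      fix y assume "y \<in> carrier M"
      then have "y \<in> P <+>\<^bsub>M\<^esub> N" using sum by simp
      then show "\<exists>q. q \<in> N \<and> (\<exists>p \<in> P. y = p \<oplus>\<^bsub>M\<^esub> q)" unfolding set_add_iff by blast
    qed
    from bchoice[OF this] obtain \<pi>
      where \<pi>: "\<And>y. y \<in> carrier M \<Longrightarrow> \<pi> y \<in> N" "\<And>y. y \<in> carrier M \<Longrightarrow> \<exists>p \<in> P. y = p \<oplus>\<^bsub>M\<^esub> \<pi> y"
      by blast
    show ?thesis
      unfolding fin_gen_def
    proof (intro exI[of _ "(\<lambda>y. \<phi> (\<pi> y)) ` X"] conjI allI impI)
      show "finite ((\<lambda>y. \<phi> (\<pi> y)) ` X)" using X by simp
      show "(\<lambda>y. \<phi> (\<pi> y)) ` X \<subseteq> carrier ?I" using X \<pi> by auto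
      fix H assume H: "submodule H R ?I" and XH: "(\<lambda>y. \<phi> (\<pi> y)) ` X \<subseteq> H"
      let ?D = "{q \<in> N. \<phi> q \<in> H}"
      have "submodule ?D R ?N"
        using mod_hom_vimage_submodule[OF \<phi>N NM reg submodule_trans[OF reg im H]] by simp
      then have D: "submodule ?D R M" by (rule submodule_trans[OF M N])
      have "X \<subseteq> P <+>\<^bsub>M\<^esub> ?D"
      proof
        fix y assume y: "y \<in> X"
        then have yc: "y \<in> carrier M" using X by blast
        then obtain p where "p \<in> P" "y = p \<oplus>\<^bsub>M\<^esub> \<pi> y" using \<pi>(2) by blast
        moreover have "\<pi> y \<in> ?D" using \<pi>(1)[OF yc] XH y by auto
        ultimately show "y \<in> P <+>\<^bsub>M\<^esub> ?D" unfolding set_add_iff by blast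
      qed
      then have all: "P <+>\<^bsub>M\<^esub> ?D = carrier M" by (rule X(3)[OF M.set_add_submodule[OF P D]])
      have "\<phi> q \<in> H" if q: "q \<in> N" for q
      proof -
        have qc: "q \<in> carrier M" using q ND(1) by blast
        then obtain p q' where pq: "p \<in> P" "q' \<in> ?D" "q = p \<oplus>\<^bsub>M\<^esub> q'"
          unfolding all[symmetric] set_add_iff by blast
        have c: "p \<in> carrier M" "q' \<in> carrier M" using pq PD(1) ND(1) by auto
        have "p = q \<oplus>\<^bsub>M\<^esub> \<ominus>\<^bsub>M\<^esub> q'" using pq c by (simp add: M.M.a_assoc M.M.r_neg)
        moreover have "q \<oplus>\<^bsub>M\<^esub> \<ominus>\<^bsub>M\<^esub> q' \<in> N" using ND(3,5) q pq(2) by blast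
        ultimately have "p \<in> N" by simp
        then have "p = \<zero>\<^bsub>M\<^esub>" using PN pq by auto
        then show ?thesis using pq c by simp
      qed
      then show "H = carrier ?I" using submoduleD(1)[OF H] by auto
    qed
  qed
  then have proj: "projective R ?I"
    using her im by (auto simp: right_hereditary_def right_semihereditary_def)
  have \<phi>I: "\<phi> \<in> mod_epi R ?N ?I"
    unfolding mod_epi_def by (auto simp: \<phi>D intro!: mod_homI)
  obtain s where s: "s \<in> mod_hom R ?I ?N" and \<phi>s: "\<And>c. c \<in> \<phi> ` N \<Longrightarrow> \<phi> (s c) = c"
    using projective_split_epi[OF proj NM \<phi>I] by auto
  note sD = mod_homD[OF s, simplified]
  interpret I: right_module R ?I by fact
  have "submodule (s ` carrier ?I) R ?N"
    by (rule mod_hom_image_submodule[OF s IM NM I.submodule_carrier])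
  then have T: "submodule (s ` (\<phi> ` N)) R ?N" by simp
  have T': "submodule (s ` (\<phi> ` N)) R M" by (rule submodule_trans[OF M N T])
  let ?T = "?N\<lparr>carrier := s ` (\<phi> ` N)\<rparr>"
  have "projective R ?T"
  proof (rule projective_retract[OF proj right_module_submodule[OF NM T]])
    show "\<phi> \<in> mod_hom R ?T ?I"
      by (rule mod_hom_comp[OF mod_hom_inclusion[OF T]]) (use \<phi>I in \<open>simp add: mod_epi_def\<close>)
    show "s \<in> mod_hom R ?I ?T" by (rule mod_homI) (use sD in auto)
    show "s (\<phi> y) = y" if "y \<in> carrier ?T" for y using that \<phi>s by auto
  qed
  moreover have "internal_direct_sum R ?N (s ` (\<phi> ` N)) {y \<in> N. \<phi> y \<in> {\<zero>\<^bsub>R\<^esub>}}"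
    unfolding internal_direct_sum_def
  proof (intro conjI)
    interpret reg: right_module R ?reg by (rule reg)
    have z: "submodule {\<zero>\<^bsub>R\<^esub>} R ?reg"
      using reg.zero_submodule by (simp add: regular_module_simps)
    show K: "submodule {y \<in> N. \<phi> y \<in> {\<zero>\<^bsub>R\<^esub>}} R ?N"
      using mod_hom_vimage_submodule[OF \<phi>N NM reg z] by simp
    have s0: "s \<zero>\<^bsub>R\<^esub> = \<zero>\<^bsub>M\<^esub>" using mod_hom_zero[OF s IM NM] by (simp add: regular_module_simps)
    have "y = \<zero>\<^bsub>M\<^esub>" if y: "y \<in> s ` (\<phi> ` N)" "\<phi> y = \<zero>\<^bsub>R\<^esub>" for y
    proof -
      obtain c where c: "c \<in> \<phi> ` N" "y = s c" using y(1) by (rule imageE)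
      have "c = \<zero>\<^bsub>R\<^esub>" using \<phi>s[OF c(1)] unfolding c(2)[symmetric] y(2) by (rule sym)
      then show ?thesis using c(2) s0 by simp
    qed
    then show "s ` (\<phi> ` N) \<inter> {y \<in> N. \<phi> y \<in> {\<zero>\<^bsub>R\<^esub>}} = {\<zero>\<^bsub>?N\<^esub>}"
      using submoduleD(2)[OF T] submoduleD(2)[OF K] unfolding submodule_carrier_simps by blast
    show "s ` (\<phi> ` N) <+>\<^bsub>?N\<^esub> {y \<in> N. \<phi> y \<in> {\<zero>\<^bsub>R\<^esub>}} = carrier ?N"
    proof
      show "s ` (\<phi> ` N) <+>\<^bsub>?N\<^esub> {y \<in> N. \<phi> y \<in> {\<zero>\<^bsub>R\<^esub>}} \<subseteq> carrier ?N"
        using submoduleD(1)[OF N.set_add_submodule[OF T K]] .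
      show "carrier ?N \<subseteq> s ` (\<phi> ` N) <+>\<^bsub>?N\<^esub> {y \<in> N. \<phi> y \<in> {\<zero>\<^bsub>R\<^esub>}}"
      proof
        fix y assume "y \<in> carrier ?N"
        then have y: "y \<in> N" by simp
        define w where "w = s (\<phi> y)"
        have w: "w \<in> N" "w \<in> s ` (\<phi> ` N)" "\<phi> w = \<phi> y" using y sD(1) \<phi>s by (auto simp: w_def)
        have c: "y \<in> carrier M" "w \<in> carrier M" using y w ND(1) by auto
        have d: "\<ominus>\<^bsub>M\<^esub> w \<oplus>\<^bsub>M\<^esub> y \<in> N" using ND(3,5) y w by simp
        have "\<phi> y = \<phi> w \<oplus>\<^bsub>?reg\<^esub> \<phi> (\<ominus>\<^bsub>M\<^esub> w \<oplus>\<^bsub>M\<^esub> y)"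
          using \<phi>D(2)[OF w(1) d] c by (simp add: M.M.r_neg2)
        moreover have "\<phi> (\<ominus>\<^bsub>M\<^esub> w \<oplus>\<^bsub>M\<^esub> y) \<in> carrier ?reg" "\<phi> w \<in> carrier ?reg"
          using \<phi>D(1)[OF d] \<phi>D(1)[OF w(1)] .
        ultimately have "\<phi> (\<ominus>\<^bsub>M\<^esub> w \<oplus>\<^bsub>M\<^esub> y) = \<zero>\<^bsub>?reg\<^esub>"
          using w(3) reg.M.add.l_cancel_one' by metis
        then have k: "\<ominus>\<^bsub>M\<^esub> w \<oplus>\<^bsub>M\<^esub> y \<in> {y \<in> N. \<phi> y \<in> {\<zero>\<^bsub>R\<^esub>}}"
          using d by (simp add: regular_module_simps)
        have "y = w \<oplus>\<^bsub>?N\<^esub> (\<ominus>\<^bsub>M\<^esub> w \<oplus>\<^bsub>M\<^esub> y)" using c by (simp add: M.M.r_neg2)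
        then show "y \<in> s ` (\<phi> ` N) <+>\<^bsub>?N\<^esub> {y \<in> N. \<phi> y \<in> {\<zero>\<^bsub>R\<^esub>}}"
          unfolding set_add_iff using w(2) k by blast
      qed
    qed
  qed (rule T)
  ultimately have "s ` (\<phi> ` N) = {\<zero>\<^bsub>?N\<^esub>}" using st by (simp only: stable_def)
  then have "s (\<phi> x) = \<zero>\<^bsub>M\<^esub>" using x by auto
  then have "\<phi> x = \<phi> \<zero>\<^bsub>M\<^esub>" using \<phi>s[of "\<phi> x"] x by simp
  then have "\<phi> x = \<zero>\<^bsub>R\<^esub>" using mod_hom_zero[OF \<phi> M reg] by (simp add: regular_module_simps)
  then show False using i by (simp add: \<phi>_def)
qed

section \<open>Rings whose torsionless modules are projective\<close>

lemma perfect_coherent_of_torsionless_projective: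
  fixes R :: "('a, 'r) ring_scheme"
  assumes R: "ring R"
    and tp: "\<And>M :: ('a, 'a list \<Rightarrow> 'a) module. torsionless R M \<Longrightarrow> projective R M"
  shows "right_perfect TYPE('m) R" and "left_coherent R"
proof -
  interpret ring R by fact
  have pp: "projective R (power_module R I)" for I :: "'a list set"
  proof -
    interpret right_module R "power_module R I" by (rule right_module_power[OF R])
    show ?thesis using tp[OF torsionless_submodule_power[OF R submodule_carrier]] by simp
  qed
  then show "left_coherent R" by (rule left_coherent_of_projective_powers[OF R])
  have dcc: left_principal_dcc
    unfolding left_principal_dcc_def
  proof (intro allI impI)
    fix a :: "nat \<Rightarrow> 'a"
    assume "\<forall>n. a n \<in> carrier R \<and> (\<exists>r\<in>carrier R. a (Suc n) = r \<otimes>\<^bsub>R\<^esub> a n)"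
    then interpret left_principal_chain R a by unfold_locales auto
    show "\<exists>n. \<exists>r\<in>carrier R. a n = r \<otimes>\<^bsub>R\<^esub> a (Suc n)" by (rule chain_stabilises[OF pp])
  qed
  have rick: right_rickart
    unfolding right_rickart_def
  proof
    fix a assume a: "a \<in> carrier R"
    let ?A = "power_module R (UNIV :: 'a list set)" and ?reg = "regular_module R"
    \<comment> \<open>The right ideal \<open>aR\<close>, realised by constant vectors in a power of the ring.\<close>
    define g :: "'a \<Rightarrow> 'a list \<Rightarrow> 'a" where "g x = (\<lambda>_. a \<otimes>\<^bsub>R\<^esub> x)" for x
    have A: "right_module R ?A" and reg: "right_module R ?reg"
      by (rule right_module_power[OF R], rule right_module_regular[OF R])
    interpret reg: right_module R ?reg by fact
    have g: "g \<in> mod_hom R ?reg ?A"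
      by (rule mod_homI) (auto simp: g_def regular_module_simps power_UNIV_simps a r_distr m_assoc)
    let ?H = "g ` carrier ?reg"
    have H: "submodule ?H R ?A" by (rule mod_hom_image_submodule[OF g reg A reg.submodule_carrier])
    have ge: "g \<in> mod_epi R ?reg (?A\<lparr>carrier := ?H\<rparr>)"
      unfolding mod_epi_def using mod_homD[OF g] by (auto intro!: mod_homI)
    from epi_from_ring_idempotent[OF R tp[OF torsionless_submodule_power[OF R H]] ge]
    obtain c where c: "c \<in> carrier R" "g c = g \<one>\<^bsub>R\<^esub>"
      "\<And>x. x \<in> carrier R \<Longrightarrow> g x = \<zero>\<^bsub>?A\<^esub> \<Longrightarrow> c \<otimes>\<^bsub>R\<^esub> x = \<zero>\<^bsub>R\<^esub>" by auto
    have "a \<otimes>\<^bsub>R\<^esub> c = a" using fun_cong[OF c(2)] a by (simp add: g_def)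
    moreover have "c \<otimes>\<^bsub>R\<^esub> x = \<zero>\<^bsub>R\<^esub>" if "x \<in> carrier R" "a \<otimes>\<^bsub>R\<^esub> x = \<zero>\<^bsub>R\<^esub>" for x
      by (rule c(3)) (use that in \<open>auto simp: g_def power_UNIV_simps\<close>)
    ultimately show "\<exists>c\<in>carrier R. a \<otimes>\<^bsub>R\<^esub> c = a \<and>
        (\<forall>x\<in>carrier R. a \<otimes>\<^bsub>R\<^esub> x = \<zero>\<^bsub>R\<^esub> \<longrightarrow> c \<otimes>\<^bsub>R\<^esub> x = \<zero>\<^bsub>R\<^esub>)"
      using c(1) by blast
  qed
  obtain E where "corner_division_ring R E"
    using corner_division_ring_of_dcc_rickart[OF dcc rick] by blast
  then show "right_perfect TYPE('m) R"
    unfolding right_perfect_def using corner_division_ring.every_module_has_projective_cover by blast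
qed

theorem theorem4p1:
  fixes R :: "('a, 'r) ring_scheme"
  assumes "ring R"
  shows "(\<not> right_perfect TYPE('m) R \<or> \<not> left_coherent R \<longrightarrow>
            (\<exists>M :: ('a, 'a list \<Rightarrow> 'a) module. torsionless R M \<and> \<not> projective R M)) \<and>
         (\<forall>M :: ('a, 'n) module.
            torsionless R M \<and> \<not> projective R M \<and>
            (right_hereditary R \<or> right_semihereditary R \<and> fin_gen R M) \<longrightarrow>
            \<not> (\<exists>P N. internal_direct_sum R M P N \<and>
                 projective R (M\<lparr>carrier := P\<rparr>) \<and> stable R (M\<lparr>carrier := N\<rparr>)))"
proof (intro conjI impI allI notI)
  assume "\<not> right_perfect TYPE('m) R \<or> \<not> left_coherent R"
  then show "\<exists>M :: ('a, 'a list \<Rightarrow> 'a) module. torsionless R M \<and> \<not> projective R M"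
    using perfect_coherent_of_torsionless_projective[OF assms] by blast
next
  fix M :: "('a, 'n) module"
  assume M: "torsionless R M \<and> \<not> projective R M \<and>
    (right_hereditary R \<or> right_semihereditary R \<and> fin_gen R M)"
  assume "\<exists>P N. internal_direct_sum R M P N \<and>
    projective R (M\<lparr>carrier := P\<rparr>) \<and> stable R (M\<lparr>carrier := N\<rparr>)"
  then obtain P N where ds: "internal_direct_sum R M P N" and P: "projective R (M\<lparr>carrier := P\<rparr>)"
    and N: "stable R (M\<lparr>carrier := N\<rparr>)" by blast
  have "N = {\<zero>\<^bsub>M\<^esub>}" using nonzero_torsionless_summand_not_stable[OF _ _ ds] M N by blast
  moreover interpret right_module R M using M by (simp add: torsionless_def)
  have "P \<subseteq> carrier M" "P <+>\<^bsub>M\<^esub> N = carrier M"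
    using ds submoduleD(1) by (auto simp: internal_direct_sum_def)
  ultimately have "P = carrier M" by (auto simp: set_add_iff set_eq_iff subset_iff)
  then show False using P M by simp
qed

end
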